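(* Let $\mathcal I$ be a normed ideal of $\mathcal B(\mathcal H)$ endowed with a positive $\|\cdot\|_{\mathcal I}$-bounded trace $\tau_{\mathcal I}$. Assume that $\mathcal I^{1/2}$ is a normed ideal with ideal norm $\|\cdot\|_{\mathcal I^{1/2}}$ and that $\|AB\|_{\mathcal I}\le\|A\|_{\mathcal I^{1/2}}\|B\|_{\mathcal I^{1/2}}$ for all $A,B\in\mathcal I^{1/2}$. Let $\mathbf A_n=(A_1,\ldots,A_n)$ and $\mathbf B_n=(B_1,\ldots,B_n)$ be $n$-tuples of pairwise commuting contractions on $\mathcal H$ such that $V_j=B_j-A_j\in\mathcal I^{1/2}$, $1\le j\le n$, and let $X_j(s)=A_j+sV_j$, $\mathbf X_n(s)=(X_1(s),\ldots,X_n(s))$, $s\in[0,1]$. Suppose $t\in[0,1]$ is such that $\mathbf X_n(t)$ is a tuple of pairwise commuting contractions admitting a commuting contractive normal dilation. Then, for every $f\in\mathcal A(\mathbb D^n_{1+\epsilon})$, $\epsilon>0$, and $1\le i\le j\le n$, $$\big|\tau_{\mathcal I}\big(D_f^{i,j}(t)\big)\big|\le\big(\tau_{\mathcal I}(|V_i|^2)\big)^{1/2}\big(\tau_{\mathcal I}(|V_j|^2)\big)^{1/2}\Big\|\frac{\partial^2f}{\partial z_i\partial z_j}\Big\|_{L^\infty(\Omega^n)},\qquad ( * )$$ where $\Omega=\mathbb T$ and $D_f^{i,j}(t)$ are the operators defined in the context. If, in addition, $\mathbf X_n(t)$ is a tuple of self-adjoint contractions, then $( * )$ holds with $\Omega=[-1,1]$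 for $f\in\mathcal A((-1-\epsilon,1+\epsilon)^n)$, $\epsilon>0$.
   Context: $\mathcal H$ is a separable Hilbert space, $\mathcal B(\mathcal H)$ the bounded linear operators on it. A contraction is an operator of norm $\le1$. $\mathbb T$ is the unit circle. Function spaces. $\mathbb D^n_{1+\epsilon}=\{(z_1,\ldots,z_n)\in\mathbb C^n:|z_j|<1+\epsilon,\ 1\le j\le n\}$, and $\mathcal A(\mathbb D^n_{1+\epsilon})$ is the space of functions holomorphic on $\mathbb D^n_{1+\epsilon}$, given by an absolutely convergent series $f(z_1,\ldots,z_n)=\sum_{k_1,\ldots,k_n\ge0}c_{k_1,\ldots,k_n}z_1^{k_1}\cdots z_n^{k_n}$. $\mathcal A((-1-\epsilon,1+\epsilon)^n)$ is the space of functions on $(-1-\epsilon,1+\epsilon)^n$ representable there by such a Taylor series. The operators $D_f^{i,j}(t)$. With $c_{k_1,\ldots,k_n}$ the Taylor coefficients of $f$, for $i<j$, $$D_f^{i,j}(t)=\sum_{k_1,\ldots,k_n\ge0}c_{k_1,\ldots,k_n}X_1(t)^{k_1}\cdots X_{i-1}(t)^{k_{i-1}}\Big(\frac{d}{ds}\Big|_{s=t}X_i(s)^{k_i}\Big)X_{i+1}(t)^{k_{i+1}}\cdots X_{j-1}(t)^{k_{j-1}}\Big(\frac{d}{ds}\Big|_{s=t}X_j(s)^{k_j}\Big)X_{j+1}(t)^{k_{j+1}}\cdots X_n(t)^{k_n},$$ and $$D_f^{j,j}(t)=\sum_{k_1,\ldots,k_n\ge0}c_{k_1,\ldots,k_n}X_1(t)^{k_1}\cdots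 X_{j-1}(t)^{k_{j-1}}\Big(\frac{d^2}{ds^2}\Big|_{s=t}X_j(s)^{k_j}\Big)X_{j+1}(t)^{k_{j+1}}\cdots X_n(t)^{k_n}$$ (empty products are the identity; derivatives in the operator norm). Dilation. A tuple $(X_1,\ldots,X_n)$ of commuting contractions on $\mathcal H$ admits a commuting contractive normal dilation if there are a Hilbert space $\mathcal K\supset\mathcal H$ and a tuple $(U_1,\ldots,U_n)$ of commuting normal contractions on $\mathcal K$ such that $X_{j_1}\cdots X_{j_l}=P_{\mathcal H}U_{j_1}\cdots U_{j_l}|_{\mathcal H}$ for all $l\in\mathbb N$ and $1\le j_1,\ldots,j_l\le n$, where $P_{\mathcal H}$ is the orthogonal projection of $\mathcal K$ onto $\mathcal H$. Normed ideal. An ideal $\mathcal I$ of $\mathcal B(\mathcal H)$ is a normed ideal if it is equipped with an ideal norm $\|\cdot\|_{\mathcal I}$, i.e. a norm such that (i) $A\in\mathcal B(\mathcal H)$, $B\in\mathcal I$, $0\le A\le B$ implies $\|A\|_{\mathcal I}\le\|B\|_{\mathcal I}$; (ii) there is $K>0$ with $\|B\|\le K\|B\|_{\mathcal I}$ for all $B\in\mathcal I$; (iii) $\|ABC\|_{\mathcal I}\le\|A\|\|B\|_{\mathcal I}\|C\|$ for $A,C\in\mathcal B(\mathcal H)$, $B\in\mathcal I$. A trace $\tau_{\mathcal I}$ on $\mathcal I$ is $\|\cdot\|_{\mathcal I}$-bounded if there is $M>0$ with $|\tau_{\mathcal I}(A)|\le M\|A\|_{\mathcal I}$ for all $A\in\mathcal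 I$. $\mathcal I^{1/2}=\{A\in\mathcal B(\mathcal H):|A|^2\in\mathcal I\}$.
   Formalization: Since a normed ideal need not be complete, τ_I(D_f^{i,j}(t)) can be undefined; the formal statement assumes, for each f, i, j, that I is complete in its norm or that the series defining D_f^{i,j}(t) converges to it in the norm of I. *)

theory Defs
  imports "HOL-Analysis.Analysis"
begin

section \<open>Complex Hilbert spaces and their bounded operators\<close>

text \<open>The inner product is linear in the first argument. Completeness is part of \<^class>\<open>banach\<close>.\<close>

class complex_hilbert = banach +
  fixes scaleC :: "complex \<Rightarrow> 'a \<Rightarrow> 'a" (infixr "*\<^sub>C" 75)
    and cinner :: "'a \<Rightarrow> 'a \<Rightarrow> complex"
  assumes scaleC_of_real: "complex_of_real r *\<^sub>C x = r *\<^sub>R x"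
    and scaleC_add_right: "a *\<^sub>C (x + y) = a *\<^sub>C x + a *\<^sub>C y"
    and scaleC_add_left: "(a + b) *\<^sub>C x = a *\<^sub>C x + b *\<^sub>C x"
    and scaleC_scaleC: "a *\<^sub>C b *\<^sub>C x = (a * b) *\<^sub>C x"
    and cinner_commute: "cinner x y = cnj (cinner y x)"
    and cinner_add_left: "cinner (x + y) z = cinner x z + cinner y z"
    and cinner_scaleC_left: "cinner (a *\<^sub>C x) y = a * cinner x y"
    and norm_eq_sqrt_cinner: "norm x = sqrt (Re (cinner x x))"

lemma norm_scaleC: "norm (a *\<^sub>C x) = cmod a * norm (x :: 'a::complex_hilbert)"
proof -
  have "cinner (a *\<^sub>C x) (a *\<^sub>C x) = a * cinner x (a *\<^sub>C x)"
    by (rule cinner_scaleC_left)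
  also have "cinner x (a *\<^sub>C x) = cnj a * cinner x x"
    by (metis cinner_commute cinner_scaleC_left complex_cnj_mult)
  finally have "cinner (a *\<^sub>C x) (a *\<^sub>C x) = complex_of_real ((cmod a)\<^sup>2) * cinner x x"
    by (simp only: complex_norm_square mult.assoc)
  then have "Re (cinner (a *\<^sub>C x) (a *\<^sub>C x)) = (cmod a)\<^sup>2 * Re (cinner x x)"
    by (simp only: Re_complex_of_real Im_complex_of_real times_complex.sel mult_zero_left diff_0_right)
  then show ?thesis
    by (simp add: norm_eq_sqrt_cinner real_sqrt_mult)
qed

lemma bounded_linear_scaleC: "bounded_linear (\<lambda>x :: 'a::complex_hilbert. a *\<^sub>C x)"
proof (rule bounded_linear_intro)
  show "a *\<^sub>C (x + y) = a *\<^sub>C x + a *\<^sub>C y" for x y :: 'a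
    by (rule scaleC_add_right)
  show "a *\<^sub>C (r *\<^sub>R x) = r *\<^sub>R (a *\<^sub>C x)" for r and x :: 'a
    by (metis scaleC_of_real scaleC_scaleC mult.commute)
  show "norm (a *\<^sub>C x) \<le> norm x * cmod a" for x :: 'a
    by (simp add: norm_scaleC mult.commute)
qed

text \<open>\<^typ>\<open>'a \<Rightarrow>\<^sub>L 'b\<close> consists of the real-linear bounded maps (with the operator norm).
  \<open>clinear_op\<close> singles out the complex-linear ones, so \<open>{A. clinear_op A}\<close> is
  \<open>B(H)\<close>.\<close>

definition clinear_op :: "('a::complex_hilbert \<Rightarrow>\<^sub>L 'b::complex_hilbert) \<Rightarrow> bool" where
  "clinear_op A \<longleftrightarrow> (\<forall>a x. A (a *\<^sub>C x) = a *\<^sub>C A x)"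

lift_definition op_scaleC ::
    "complex \<Rightarrow> ('a::complex_hilbert \<Rightarrow>\<^sub>L 'b::complex_hilbert) \<Rightarrow> 'a \<Rightarrow>\<^sub>L 'b"
  is "\<lambda>a A x. a *\<^sub>C A x"
  by (rule bounded_linear_compose[OF bounded_linear_scaleC])

definition adj :: "('a::complex_hilbert \<Rightarrow>\<^sub>L 'a) \<Rightarrow> 'a \<Rightarrow>\<^sub>L 'a" where
  "adj A = (THE B :: 'a \<Rightarrow>\<^sub>L 'a. \<forall>x y. cinner (A x) y = cinner x (B y))"

text \<open>\<open>|A|\<^sup>2\<close>, where \<open>|A| = (A\<^sup>* A)\<^bsup>1/2\<^esup>\<close>.\<close>

definition abs_sq :: "('a::complex_hilbert \<Rightarrow>\<^sub>L 'a) \<Rightarrow> 'a \<Rightarrow>\<^sub>L 'a" where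
  "abs_sq A = adj A o\<^sub>L A"

definition positive_op :: "('a::complex_hilbert \<Rightarrow>\<^sub>L 'a) \<Rightarrow> bool" where
  "positive_op A \<longleftrightarrow> clinear_op A \<and> (\<forall>x. cinner (A x) x \<in> \<real> \<and> 0 \<le> Re (cinner (A x) x))"

definition contraction :: "('a::complex_hilbert \<Rightarrow>\<^sub>L 'a) \<Rightarrow> bool" where
  "contraction A \<longleftrightarrow> clinear_op A \<and> norm A \<le> 1"

definition normal_op :: "('a::complex_hilbert \<Rightarrow>\<^sub>L 'a) \<Rightarrow> bool" where
  "normal_op A \<longleftrightarrow> clinear_op A \<and> adj A o\<^sub>L A = A o\<^sub>L adj A"

definition self_adjoint_op :: "('a::complex_hilbert \<Rightarrow>\<^sub>L 'a) \<Rightarrow> bool" where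
  "self_adjoint_op A \<longleftrightarrow> clinear_op A \<and> adj A = A"

definition op_pow :: "('a::complex_hilbert \<Rightarrow>\<^sub>L 'a) \<Rightarrow> nat \<Rightarrow> 'a \<Rightarrow>\<^sub>L 'a" where
  "op_pow A k = (((o\<^sub>L) A) ^^ k) id_blinfun"

definition op_prod :: "('a::complex_hilbert \<Rightarrow>\<^sub>L 'a) list \<Rightarrow> 'a \<Rightarrow>\<^sub>L 'a" where
  "op_prod As = foldr (o\<^sub>L) As id_blinfun"

text \<open>An \<open>n\<close>-tuple is a function on \<^typ>\<open>nat\<close>, of which only the values on \<open>{1..n}\<close> matter.\<close>

definition commuting_contractions :: "nat \<Rightarrow> (nat \<Rightarrow> 'a::complex_hilbert \<Rightarrow>\<^sub>L 'a) \<Rightarrow> bool" where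
  "commuting_contractions n A \<longleftrightarrow>
     (\<forall>i\<in>{1..n}. contraction (A i)) \<and> (\<forall>i\<in>{1..n}. \<forall>j\<in>{1..n}. A i o\<^sub>L A j = A j o\<^sub>L A i)"


section \<open>Dilations\<close>

definition orth_proj :: "'a::complex_hilbert set \<Rightarrow> 'a \<Rightarrow> 'a" where
  "orth_proj S y = (THE p. p \<in> S \<and> (\<forall>s\<in>S. cinner (y - p) s = 0))"

text \<open>The larger space is a type \<open>'k\<close> into which \<open>'h\<close> is embedded by a linear isometry \<open>J\<close>.
  As a hypothesis of a theorem in which \<open>'k\<close> is otherwise unconstrained, this expresses
  the existence of some Hilbert space carrying the dilation.\<close>

definition has_normal_dilation ::
    "'k::complex_hilbert itself \<Rightarrow> nat \<Rightarrow> (nat \<Rightarrow> 'h::complex_hilbert \<Rightarrow>\<^sub>L 'h) \<Rightarrow> bool" where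
  "has_normal_dilation _ n X \<longleftrightarrow>
     (\<exists>(J :: 'h \<Rightarrow>\<^sub>L 'k) (U :: nat \<Rightarrow> 'k \<Rightarrow>\<^sub>L 'k).
        clinear_op J \<and> (\<forall>x. norm (J x) = norm x) \<and>
        commuting_contractions n U \<and> (\<forall>j\<in>{1..n}. normal_op (U j)) \<and>
        (\<forall>js x. set js \<subseteq> {1..n} \<longrightarrow>
           J (op_prod (map X js) x) = orth_proj (range J) (op_prod (map U js) (J x))))"


section \<open>Normed ideals and traces\<close>

definition op_ideal :: "('a::complex_hilbert \<Rightarrow>\<^sub>L 'a) set \<Rightarrow> bool" where
  "op_ideal I \<longleftrightarrow> (\<forall>B\<in>I. clinear_op B) \<and> 0 \<in> I \<and> (\<forall>A\<in>I. \<forall>B\<in>I. A + B \<in> I) \<and>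
     (\<forall>A C. \<forall>B\<in>I. clinear_op A \<longrightarrow> clinear_op C \<longrightarrow> A o\<^sub>L B o\<^sub>L C \<in> I)"

definition normed_ideal ::
    "('a::complex_hilbert \<Rightarrow>\<^sub>L 'a) set \<Rightarrow> (('a \<Rightarrow>\<^sub>L 'a) \<Rightarrow> real) \<Rightarrow> bool" where
  "normed_ideal I N \<longleftrightarrow> op_ideal I \<and>
     (\<forall>B\<in>I. 0 \<le> N B \<and> (N B = 0 \<longleftrightarrow> B = 0)) \<and>
     (\<forall>B\<in>I. \<forall>a. N (op_scaleC a B) = cmod a * N B) \<and>
     (\<forall>A\<in>I. \<forall>B\<in>I. N (A + B) \<le> N A + N B) \<and>
     (\<forall>A. \<forall>B\<in>I. positive_op A \<longrightarrow> positive_op (B - A) \<longrightarrow> N A \<le> N B) \<and>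
     (\<exists>K>0. \<forall>B\<in>I. norm B \<le> K * N B) \<and>
     (\<forall>A C. \<forall>B\<in>I. clinear_op A \<longrightarrow> clinear_op C \<longrightarrow>
        N (A o\<^sub>L B o\<^sub>L C) \<le> norm A * N B * norm C)"

definition ideal_sqrt :: "('a::complex_hilbert \<Rightarrow>\<^sub>L 'a) set \<Rightarrow> ('a \<Rightarrow>\<^sub>L 'a) set" where
  "ideal_sqrt I = {A. clinear_op A \<and> abs_sq A \<in> I}"

definition ideal_trace ::
    "('a::complex_hilbert \<Rightarrow>\<^sub>L 'a) set \<Rightarrow> (('a \<Rightarrow>\<^sub>L 'a) \<Rightarrow> complex) \<Rightarrow> bool" where
  "ideal_trace I \<tau> \<longleftrightarrow>
     (\<forall>A\<in>I. \<forall>B\<in>I. \<tau> (A + B) = \<tau> A + \<tau> B) \<and>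
     (\<forall>A\<in>I. \<forall>a. \<tau> (op_scaleC a A) = a * \<tau> A) \<and>
     (\<forall>A\<in>I. \<forall>B. clinear_op B \<longrightarrow> \<tau> (A o\<^sub>L B) = \<tau> (B o\<^sub>L A))"

definition positive_trace ::
    "('a::complex_hilbert \<Rightarrow>\<^sub>L 'a) set \<Rightarrow> (('a \<Rightarrow>\<^sub>L 'a) \<Rightarrow> complex) \<Rightarrow> bool" where
  "positive_trace I \<tau> \<longleftrightarrow> ideal_trace I \<tau> \<and>
     (\<forall>A\<in>I. positive_op A \<longrightarrow> \<tau> A \<in> \<real> \<and> 0 \<le> Re (\<tau> A))"

definition trace_bounded ::
    "('a::complex_hilbert \<Rightarrow>\<^sub>L 'a) set \<Rightarrow> (('a \<Rightarrow>\<^sub>L 'a) \<Rightarrow> real) \<Rightarrow> (('a \<Rightarrow>\<^sub>L 'a) \<Rightarrow> complex) \<Rightarrow> bool" where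
  "trace_bounded I N \<tau> \<longleftrightarrow> (\<exists>M>0. \<forall>A\<in>I. cmod (\<tau> A) \<le> M * N A)"

text \<open>A normed ideal as above need not be complete in its norm. The next two notions say when
  a series of elements of \<open>I\<close> has a sum to which a bounded trace on \<open>I\<close> can be applied.\<close>

definition ideal_complete ::
    "('a::complex_hilbert \<Rightarrow>\<^sub>L 'a) set \<Rightarrow> (('a \<Rightarrow>\<^sub>L 'a) \<Rightarrow> real) \<Rightarrow> bool" where
  "ideal_complete I N \<longleftrightarrow>
     (\<forall>T. range T \<subseteq> I \<longrightarrow> (\<forall>e>0. \<exists>m. \<forall>p\<ge>m. \<forall>q\<ge>m. N (T p - T q) < e) \<longrightarrow>
        (\<exists>S\<in>I. (\<lambda>p::nat. N (T p - S)) \<longlonglongrightarrow> 0))"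

definition has_sum_in_ideal ::
    "('a::complex_hilbert \<Rightarrow>\<^sub>L 'a) set \<Rightarrow> (('a \<Rightarrow>\<^sub>L 'a) \<Rightarrow> real) \<Rightarrow>
      ('k \<Rightarrow> 'a \<Rightarrow>\<^sub>L 'a) \<Rightarrow> 'k set \<Rightarrow> 'a \<Rightarrow>\<^sub>L 'a \<Rightarrow> bool" where
  "has_sum_in_ideal I N T M S \<longleftrightarrow> (\<forall>k\<in>M. T k \<in> I) \<and> S \<in> I \<and>
     ((\<lambda>F. N ((\<Sum>k\<in>F. T k) - S)) \<longlongrightarrow> 0) (finite_subsets_at_top M)"


section \<open>Power series in several variables\<close>

definition multi_indices :: "nat \<Rightarrow> (nat \<Rightarrow> nat) set" where
  "multi_indices n = {1..n} \<rightarrow>\<^sub>E UNIV"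

definition taylor_rep_at :: "nat \<Rightarrow> ((nat \<Rightarrow> nat) \<Rightarrow> complex) \<Rightarrow> (nat \<Rightarrow> complex) \<Rightarrow> complex \<Rightarrow> bool" where
  "taylor_rep_at n c z w \<longleftrightarrow>
     (\<lambda>k. norm (c k * (\<Prod>j\<in>{1..n}. z j ^ k j))) summable_on multi_indices n \<and>
     ((\<lambda>k. c k * (\<Prod>j\<in>{1..n}. z j ^ k j)) has_sum w) (multi_indices n)"

text \<open>\<open>f\<close> belongs to \<open>A(D\<^sup>n)\<close>, \<open>D\<close> the open disc of radius \<open>r\<close> (resp. to \<open>A((-r, r)\<^sup>n)\<close>), and
  has Taylor coefficients \<open>c\<close>. Holomorphy of \<open>f\<close> on the polydisc follows from the
  representation.\<close>

definition polydisc_taylor ::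
    "nat \<Rightarrow> real \<Rightarrow> ((nat \<Rightarrow> nat) \<Rightarrow> complex) \<Rightarrow> ((nat \<Rightarrow> complex) \<Rightarrow> complex) \<Rightarrow> bool" where
  "polydisc_taylor n r c f \<longleftrightarrow> (\<forall>z \<in> {1..n} \<rightarrow>\<^sub>E ball 0 r. taylor_rep_at n c z (f z))"

definition cube_taylor ::
    "nat \<Rightarrow> real \<Rightarrow> ((nat \<Rightarrow> nat) \<Rightarrow> complex) \<Rightarrow> ((nat \<Rightarrow> real) \<Rightarrow> complex) \<Rightarrow> bool" where
  "cube_taylor n r c f \<longleftrightarrow>
     (\<forall>x \<in> {1..n} \<rightarrow>\<^sub>E {-r<..<r}. taylor_rep_at n c (\<lambda>j. complex_of_real (x j)) (f x))"

definition cpartial :: "nat \<Rightarrow> ((nat \<Rightarrow> complex) \<Rightarrow> complex) \<Rightarrow> (nat \<Rightarrow> complex) \<Rightarrow> complex" where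
  "cpartial j f z = deriv (\<lambda>w. f (z(j := w))) (z j)"

definition rpartial :: "nat \<Rightarrow> ((nat \<Rightarrow> real) \<Rightarrow> complex) \<Rightarrow> (nat \<Rightarrow> real) \<Rightarrow> complex" where
  "rpartial j f x = vector_derivative (\<lambda>s. f (x(j := s))) (at (x j))"

definition Linf_norm :: "'a measure \<Rightarrow> ('a \<Rightarrow> complex) \<Rightarrow> real" where
  "Linf_norm M g = Inf {C. 0 \<le> C \<and> (AE x in M. cmod (g x) \<le> C)}"

text \<open>Normalised arc length on the unit circle (as a measure on the plane carried by the
  circle), and Lebesgue measure on \<open>[-1, 1]\<close>; their \<open>n\<close>-fold products are the reference
  measures for the essential suprema over the torus and over the cube.\<close>

definition circle_measure :: "complex measure" where
  "circle_measure = distr (uniform_measure lborel {0..2 * pi}) borel cis"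

definition torus_measure :: "nat \<Rightarrow> (nat \<Rightarrow> complex) measure" where
  "torus_measure n = PiM {1..n} (\<lambda>_. circle_measure)"

definition cube_measure :: "nat \<Rightarrow> (nat \<Rightarrow> real) measure" where
  "cube_measure n = PiM {1..n} (\<lambda>_. restrict_space lborel {-1..1})"


section \<open>The operators \<open>D\<^sub>f\<^bsup>i,j\<^esup>(t)\<close>\<close>

text \<open>Derivatives are taken in the operator norm for the path parameter in \<open>[0, 1]\<close>, hence
  are one-sided at the end points.\<close>

definition op_deriv :: "(real \<Rightarrow> 'a::complex_hilbert \<Rightarrow>\<^sub>L 'a) \<Rightarrow> real \<Rightarrow> 'a \<Rightarrow>\<^sub>L 'a" where
  "op_deriv Y t = vector_derivative Y (at t within {0..1})"

definition D_term ::
    "nat \<Rightarrow> (nat \<Rightarrow> real \<Rightarrow> 'a::complex_hilbert \<Rightarrow>\<^sub>L 'a) \<Rightarrow> nat \<Rightarrow> nat \<Rightarrow> real \<Rightarrow> (nat \<Rightarrow> nat) \<Rightarrow> 'a \<Rightarrow>\<^sub>L 'a" where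
  "D_term n X i j t k = op_prod (map (\<lambda>l.
      if l = i \<and> l = j then op_deriv (op_deriv (\<lambda>s. op_pow (X l s) (k l))) t
      else if l = i \<or> l = j then op_deriv (\<lambda>s. op_pow (X l s) (k l)) t
      else op_pow (X l t) (k l)) [1..<n+1])"

definition D_op ::
    "nat \<Rightarrow> ((nat \<Rightarrow> nat) \<Rightarrow> complex) \<Rightarrow> (nat \<Rightarrow> real \<Rightarrow> 'a::complex_hilbert \<Rightarrow>\<^sub>L 'a) \<Rightarrow>
      nat \<Rightarrow> nat \<Rightarrow> real \<Rightarrow> 'a \<Rightarrow>\<^sub>L 'a" where
  "D_op n c X i j t = (\<Sum>\<^sub>\<infinity>k\<in>multi_indices n. op_scaleC (c k) (D_term n X i j t k))"

text \<open>\<open>\<tau>(D\<^sub>f\<^bsup>i,j\<^esup>(t))\<close> is meaningful: automatic if \<open>I\<close> is complete; otherwise the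
  series defining the operator has to converge in the norm of \<open>I\<close>.\<close>

definition D_op_traceable ::
    "('a::complex_hilbert \<Rightarrow>\<^sub>L 'a) set \<Rightarrow> (('a \<Rightarrow>\<^sub>L 'a) \<Rightarrow> real) \<Rightarrow>
      nat \<Rightarrow> ((nat \<Rightarrow> nat) \<Rightarrow> complex) \<Rightarrow> (nat \<Rightarrow> real \<Rightarrow> 'a \<Rightarrow>\<^sub>L 'a) \<Rightarrow> nat \<Rightarrow> nat \<Rightarrow> real \<Rightarrow> bool" where
  "D_op_traceable I N n c X i j t \<longleftrightarrow> ideal_complete I N \<or>
     has_sum_in_ideal I N (\<lambda>k. op_scaleC (c k) (D_term n X i j t k)) (multi_indices n)
       (D_op n c X i j t)"

end

theory Submission
  imports Defs "HOL-Complex_Analysis.Complex_Analysis"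
begin

text \<open>
  Write \<open>x\<^sub>l = X\<^sub>l(t)\<close>. By cyclicity of the trace, \<open>\<tau>(D\<^sub>f\<^bsup>i,j\<^esup>(t))\<close> is a series of terms
  \<open>\<tau>(x\<^sup>\<alpha> V\<^sub>i x\<^sup>\<beta> V\<^sub>j)\<close>, whose symbol \<open>\<phi>(\<lambda>, \<mu>)\<close>, with \<open>\<lambda>\<^sup>\<alpha> \<mu>\<^sup>\<beta>\<close> in place of the operators, is a
  divided difference of \<open>f\<close> in the variables \<open>i\<close> and \<open>j\<close>. Such a divided difference is an average of
  \<open>\<partial>\<^sub>i \<partial>\<^sub>j f\<close> over convex combinations of the coordinates of \<open>\<lambda>\<close> and \<open>\<mu>\<close>, so on \<open>\<Omega>\<^sup>n\<close> it is bounded by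
  the supremum of \<open>\<partial>\<^sub>i \<partial>\<^sub>j f\<close>, with the maximum principle if \<open>\<Omega>\<close> is the circle
  (\<open>symbol_bound\<close>, \<open>polynomial_max_modulus\<close>).

  If \<open>x\<^sup>\<alpha> = \<integral> \<lambda>\<^sup>\<alpha> dE(\<lambda>)\<close> for a positive operator-valued measure \<open>E\<close> on \<open>\<Omega>\<^sup>n\<close> of total mass \<open>1\<close>, then the
  trace is \<open>\<integral>\<integral> \<phi>(\<lambda>, \<mu>) \<tau>(dE(\<lambda>) V\<^sub>i dE(\<mu>) V\<^sub>j)\<close>. The form \<open>(S, T) \<mapsto> \<tau>(E S F T\<^sup>*)\<close> is positive for
  positive \<open>E\<close> and \<open>F\<close>, and the Cauchy--Schwarz inequality bounds the total variation of the
  bimeasure by \<open>\<tau>(V\<^sub>i V\<^sub>i\<^sup>*)\<^bsup>1/2\<^esup> \<tau>(V\<^sub>j\<^sup>* V\<^sub>j)\<^bsup>1/2\<^esup>\<close> (\<open>trace_double_sum_bound\<close>). Finally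
  \<open>\<tau>(V V\<^sup>*) = \<tau>(V\<^sup>* V)\<close> by polar decomposition.

  No spectral theorem is used. It suffices to have finitely supported measures \<open>E\<close> whose moments
  converge to \<open>x\<^sup>\<alpha>\<close> (\<open>joint_resolution\<close>), and these are explicit: the Fejer kernel at roots of unity
  for a contraction, and the Bernstein kernel for a self-adjoint contraction. For several operators
  the kernels are multiplied; the product is positive because the factors commute, which for
  commuting normal operators is Fuglede's theorem. A normal dilation is resolved in this way and the
  measures are compressed to the original space (\<open>joint_resolution_compression\<close>).
\<close>

section \<open>Inner products and the Riesz representation\<close>

lemma scaleC_one [simp]: "1 *\<^sub>C (x::'a::complex_hilbert) = x"
  using scaleC_of_real[of 1 x] by simp

lemma scaleC_zero_right [simp]: "a *\<^sub>C (0::'a::complex_hilbert) = 0"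
  using scaleC_add_right[of a 0 "0::'a"] by simp

lemma scaleC_zero_left [simp]: "0 *\<^sub>C (x::'a::complex_hilbert) = 0"
  using scaleC_of_real[of 0 x] by simp

lemma scaleC_diff_left: "(a - b) *\<^sub>C (x::'a::complex_hilbert) = a *\<^sub>C x - b *\<^sub>C x"
  using scaleC_add_left[of "a - b" b x] by simp

lemma scaleC_minus_one: "(-1) *\<^sub>C (x::'a::complex_hilbert) = - x"
  using scaleC_of_real[of "-1" x] by simp

lemma cinner_zero_left [simp]: "cinner 0 (x::'a::complex_hilbert) = 0"
  using cinner_add_left[of 0 "0::'a" x] by simp

lemma cinner_zero_right [simp]: "cinner (x::'a::complex_hilbert) 0 = 0"
  by (metis cinner_commute cinner_zero_left complex_cnj_zero)

lemma cinner_add_right: "cinner (x::'a::complex_hilbert) (y + z) = cinner x y + cinner x z"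
  by (metis cinner_add_left cinner_commute complex_cnj_add)

lemma cinner_scaleC_right: "cinner (x::'a::complex_hilbert) (a *\<^sub>C y) = cnj a * cinner x y"
  by (metis cinner_commute cinner_scaleC_left complex_cnj_mult)

lemma cinner_minus_left: "cinner (- x) (y::'a::complex_hilbert) = - cinner x y"
  using cinner_scaleC_left[of "-1" x y] by (simp add: scaleC_minus_one)

lemma cinner_minus_right: "cinner x (- y::'a::complex_hilbert) = - cinner x y"
  using cinner_scaleC_right[of x "-1" y] by (simp add: scaleC_minus_one)

lemma cinner_diff_left: "cinner (x - y) (z::'a::complex_hilbert) = cinner x z - cinner y z"
  using cinner_add_left[of x "-y" z] by (simp add: cinner_minus_left)

lemma cinner_diff_right: "cinner x (y - z::'a::complex_hilbert) = cinner x y - cinner x z"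
  using cinner_add_right[of x y "-z"] by (simp add: cinner_minus_right)

lemma cinner_scaleR_left: "cinner (r *\<^sub>R x) (y::'a::complex_hilbert) = of_real r * cinner x y"
  by (metis cinner_scaleC_left scaleC_of_real)

lemma cinner_scaleR_right: "cinner x (r *\<^sub>R y::'a::complex_hilbert) = of_real r * cinner x y"
  by (metis cinner_scaleC_right scaleC_of_real complex_cnj_complex_of_real)

lemmas cinner_simps = cinner_add_left cinner_add_right cinner_diff_left cinner_diff_right
  cinner_minus_left cinner_minus_right cinner_scaleC_left cinner_scaleC_right
  cinner_scaleR_left cinner_scaleR_right

lemma Im_cinner_self [simp]: "Im (cinner x (x::'a::complex_hilbert)) = 0"
  using cinner_commute[of x x] by (metis Im_complex_of_real complex_cnj_cancel_iff Reals_cnj_iff complex_is_Real_iff)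

lemma Re_cinner_self: "Re (cinner x (x::'a::complex_hilbert)) = (norm x)\<^sup>2"
proof -
  have "sqrt (Re (cinner x x)) \<ge> 0" using norm_ge_zero[of x] by (simp only: norm_eq_sqrt_cinner)
  then show ?thesis by (simp add: norm_eq_sqrt_cinner)
qed

lemma cinner_self: "cinner x (x::'a::complex_hilbert) = of_real ((norm x)\<^sup>2)"
  by (simp add: complex_eq_iff Re_cinner_self)

lemma cinner_sum_left: "cinner (\<Sum>i\<in>F. f i) (y::'a::complex_hilbert) = (\<Sum>i\<in>F. cinner (f i) y)"
  by (induction F rule: infinite_finite_induct) (auto simp: cinner_add_left)

text \<open>All Cauchy--Schwarz inequalities below (for the inner product, for a positive operator,
  for a positive trace) come from expanding a positive form at \<open>S + a T\<close>; this is their common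
  numerical content. Hermitian symmetry \<open>\<gamma>' = cnj \<gamma>\<close> follows from the values being real.\<close>

lemma positive_form_discriminant:
  fixes \<alpha> \<beta> :: real and \<gamma> \<gamma>' :: complex
  assumes pos: "\<And>a. of_real \<alpha> + cnj a * \<gamma> + a * \<gamma>' + of_real ((cmod a)\<^sup>2 * \<beta>) \<in> \<real> \<and>
                     0 \<le> Re (of_real \<alpha> + cnj a * \<gamma> + a * \<gamma>' + of_real ((cmod a)\<^sup>2 * \<beta>))"
    and \<beta>: "0 \<le> \<beta>"
  shows "(cmod \<gamma>)\<^sup>2 \<le> \<alpha> * \<beta>"
proof -
  have "Im \<gamma> + Im \<gamma>' = 0" using pos[of 1] by (simp add: complex_is_Real_iff)
  moreover have "Re \<gamma>' = Re \<gamma>" using pos[of \<i>] by (simp add: complex_is_Real_iff)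
  ultimately have \<gamma>': "\<gamma>' = cnj \<gamma>" by (simp add: complex_eq_iff)
  have gg: "cmod \<gamma> * cmod \<gamma> = Re \<gamma> * Re \<gamma> + Im \<gamma> * Im \<gamma>"
    using cmod_power2[of \<gamma>] by (simp add: power2_eq_square)
  have *: "0 \<le> \<alpha> - 2 * s * (cmod \<gamma>)\<^sup>2 + s\<^sup>2 * (cmod \<gamma>)\<^sup>2 * \<beta>" for s :: real
    using pos[of "- of_real s * \<gamma>"] gg
    by (simp add: \<gamma>' norm_mult power_mult_distrib power2_eq_square algebra_simps)
  show ?thesis
  proof (cases "\<beta> = 0")
    case True
    have "\<gamma> = 0"
    proof (rule ccontr)
      assume "\<gamma> \<noteq> 0"
      then have "(cmod \<gamma>)\<^sup>2 > 0" by simp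
      then show False using *[of "(\<alpha> + 1) / (2 * (cmod \<gamma>)\<^sup>2)"] True by simp
    qed
    then show ?thesis using True by simp
  next
    case False
    then have "\<beta> > 0" using \<beta> by simp
    then show ?thesis using *[of "1 / \<beta>"] by (simp add: field_simps power2_eq_square)
  qed
qed

lemma norm_cinner_le: "cmod (cinner x (y::'a::complex_hilbert)) \<le> norm x * norm y"
proof -
  have "(cmod (cinner x y))\<^sup>2 \<le> (norm x)\<^sup>2 * (norm y)\<^sup>2"
  proof (rule positive_form_discriminant[where \<gamma>' = "cinner y x"])
    fix a
    have e: "of_real ((norm x)\<^sup>2) + cnj a * cinner x y + a * cinner y x + of_real ((cmod a)\<^sup>2 * (norm y)\<^sup>2)
        = cinner (x + a *\<^sub>C y) (x + a *\<^sub>C y)"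
      unfolding of_real_mult complex_norm_square cinner_simps cinner_self[of x] cinner_self[of y]
      by (simp add: algebra_simps)
    show "of_real ((norm x)\<^sup>2) + cnj a * cinner x y + a * cinner y x + of_real ((cmod a)\<^sup>2 * (norm y)\<^sup>2) \<in> \<real> \<and>
      0 \<le> Re (of_real ((norm x)\<^sup>2) + cnj a * cinner x y + a * cinner y x + of_real ((cmod a)\<^sup>2 * (norm y)\<^sup>2))"
      unfolding e by (simp add: complex_is_Real_iff Re_cinner_self)
  qed simp
  then show ?thesis by (metis norm_ge_zero power2_le_imp_le power_mult_distrib mult_nonneg_nonneg)
qed

lemma bounded_linear_cinner_left: "bounded_linear (\<lambda>x. cinner x (y::'a::complex_hilbert))"
  by (rule bounded_linear_intro[where K="norm y"])
    (simp_all add: cinner_simps scaleR_conv_of_real norm_cinner_le)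

lemma bounded_linear_cinner_right: "bounded_linear (\<lambda>y. cinner (x::'a::complex_hilbert) y)"
  by (rule bounded_linear_intro[where K="norm x"])
    (simp_all add: cinner_simps scaleR_conv_of_real norm_cinner_le mult.commute[of "norm _" "norm x"])

lemmas tendsto_cinner_right = bounded_linear.tendsto[OF bounded_linear_cinner_right]

definition csubspace :: "'a::complex_hilbert set \<Rightarrow> bool" where
  "csubspace M \<longleftrightarrow> 0 \<in> M \<and> (\<forall>x\<in>M. \<forall>y\<in>M. x + y \<in> M) \<and> (\<forall>a. \<forall>x\<in>M. a *\<^sub>C x \<in> M)"

lemma csubspace_scaleR: "csubspace M \<Longrightarrow> x \<in> M \<Longrightarrow> r *\<^sub>R x \<in> M"
  unfolding csubspace_def by (metis scaleC_of_real)

lemma csubspace_closure: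
  assumes "csubspace M" shows "csubspace (closure M)"
proof -
  have "0 \<in> closure M" using assms closure_subset unfolding csubspace_def by blast
  moreover have "x + y \<in> closure M" if xy: "x \<in> closure M" "y \<in> closure M" for x y
  proof -
    obtain f g where "\<And>n::nat. f n \<in> M" "f \<longlonglongrightarrow> x" "\<And>n::nat. g n \<in> M" "g \<longlonglongrightarrow> y"
      using xy unfolding closure_sequential by blast
    then have "\<And>n. f n + g n \<in> M" "(\<lambda>n. f n + g n) \<longlonglongrightarrow> x + y"
      using assms by (auto simp: csubspace_def intro: tendsto_add)
    then show ?thesis unfolding closure_sequential by (intro exI[of _ "\<lambda>n. f n + g n"]) simp
  qed
  moreover have "a *\<^sub>C x \<in> closure M" if x: "x \<in> closure M" for a x
  proof -
    obtain f where "\<And>n::nat. f n \<in> M" "f \<longlonglongrightarrow> x" using x unfolding closure_sequential by blast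
    then have "\<And>n. a *\<^sub>C f n \<in> M" "(\<lambda>n. a *\<^sub>C f n) \<longlonglongrightarrow> a *\<^sub>C x"
      using assms by (auto simp: csubspace_def intro: bounded_linear.tendsto[OF bounded_linear_scaleC])
    then show ?thesis unfolding closure_sequential by (intro exI[of _ "\<lambda>n. a *\<^sub>C f n"]) simp
  qed
  ultimately show ?thesis by (simp add: csubspace_def)
qed

lemma closure_orthogonal_bound:
  assumes "z \<in> closure M" "\<And>x. x \<in> M \<Longrightarrow> cmod (cinner x z) \<le> k * norm x"
  shows "(norm z)\<^sup>2 \<le> k * norm (z::'a::complex_hilbert)"
proof -
  have "closed {x. cmod (cinner x z) \<le> k * norm x}"
    by (intro closed_Collect_le continuous_intros bounded_linear.continuous_on[OF bounded_linear_cinner_left])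
  then have "closure M \<subseteq> {x. cmod (cinner x z) \<le> k * norm x}"
    using assms(2) by (intro closure_minimal) auto
  then have "cmod (cinner z z) \<le> k * norm z" using assms(1) by blast
  then show ?thesis by (simp add: cinner_self norm_power)
qed

text \<open>The representing vector is the limit of a minimising sequence of
  \<open>\<parallel>x\<parallel>\<^sup>2 - 2 Re (\<phi> x)\<close> on \<open>M\<close>, Cauchy by the parallelogram law. Allowing \<open>M\<close> to be a
  subspace that is not closed serves the polar decomposition below.\<close>

lemma riesz_subspace:
  fixes \<phi> :: "'a::complex_hilbert \<Rightarrow> complex"
  assumes M: "csubspace M"
    and add: "\<And>x y. x \<in> M \<Longrightarrow> y \<in> M \<Longrightarrow> \<phi> (x + y) = \<phi> x + \<phi> y"
    and hom: "\<And>a x. x \<in> M \<Longrightarrow> \<phi> (a *\<^sub>C x) = a * \<phi> x"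
    and bd: "\<And>x. x \<in> M \<Longrightarrow> cmod (\<phi> x) \<le> c * norm x"
  shows "\<exists>z\<in>closure M. \<forall>x\<in>M. \<phi> x = cinner x z"
proof -
  define J where "J x = (norm x)\<^sup>2 - 2 * Re (\<phi> x)" for x
  have homR: "\<phi> (r *\<^sub>R x) = of_real r * \<phi> x" if "x \<in> M" for r x
    using hom[OF that, of "of_real r"] by (simp add: scaleC_of_real)
  have lower: "- c\<^sup>2 \<le> J x" if "x \<in> M" for x
  proof -
    have "Re (\<phi> x) \<le> c * norm x" using bd[OF that] complex_Re_le_cmod order_trans by blast
    then have "J x \<ge> (norm x)\<^sup>2 - 2 * (c * norm x)" by (simp add: J_def)
    moreover have "(norm x)\<^sup>2 - 2 * (c * norm x) + c\<^sup>2 = (norm x - c)\<^sup>2"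
      by (simp add: power2_diff algebra_simps)
    ultimately show ?thesis using zero_le_power2[of "norm x - c"] by linarith
  qed
  define d where "d = Inf (J ` M)"
  have bdd: "bdd_below (J ` M)" using lower by (rule bdd_belowI2)
  have ne: "J ` M \<noteq> {}" using M by (auto simp: csubspace_def)
  have dle: "d \<le> J x" if "x \<in> M" for x
    unfolding d_def using bdd that by (simp add: cInf_lower)
  have "\<exists>x\<in>M. J x < d + 1 / real (Suc n)" for n
    using cInf_less_iff[OF ne bdd, of "d + 1 / real (Suc n)"] by (auto simp: d_def)
  then obtain f where f: "\<And>n. f n \<in> M" "\<And>n. J (f n) < d + 1 / real (Suc n)" by metis
  have par: "J x + J y - 2 * J ((1/2) *\<^sub>R (x + y)) = (norm (x - y))\<^sup>2 / 2" if "x \<in> M" "y \<in> M" for x y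
  proof -
    have "x + y \<in> M" using that M by (auto simp: csubspace_def)
    then show ?thesis using that
      unfolding J_def Re_cinner_self[symmetric] cinner_simps 
      by (simp add: homR add csubspace_scaleR[OF M] field_simps)
  qed
  have Cd: "(norm (f m - f n))\<^sup>2 \<le> 2 * (1 / real (Suc m) + 1 / real (Suc n))" for m n
  proof -
    have "f m + f n \<in> M" using f(1)[of m] f(1)[of n] M by (simp add: csubspace_def)
    then have "(1/2) *\<^sub>R (f m + f n) \<in> M" by (rule csubspace_scaleR[OF M])
    moreover have "q \<le> 2 * (a + b)" if "d \<le> l" "j + k - 2 * l = q / 2" "j < d + a" "k < d + b"
      for a b j k l q :: real using that by (simp add: field_simps)
    ultimately show ?thesis using dle par[OF f(1) f(1)] f(2) by metis
  qed
  have "Cauchy f"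
  proof (rule metric_CauchyI)
    fix e :: real assume e: "0 < e"
    obtain N where N: "1 / real (Suc N) < e\<^sup>2 / 4"
      using e nat_approx_posE[of "e\<^sup>2 / 4"] by auto
    show "\<exists>N. \<forall>m\<ge>N. \<forall>n\<ge>N. dist (f m) (f n) < e"
    proof (intro exI[of _ N] allI impI)
      fix m n assume mn: "m \<ge> N" "n \<ge> N"
      have "1 / real (Suc m) \<le> 1 / real (Suc N)" "1 / real (Suc n) \<le> 1 / real (Suc N)"
        using mn by (simp_all add: frac_le)
      then have "2 * (1 / real (Suc m) + 1 / real (Suc n)) \<le> 2 * (1 / real (Suc N) + 1 / real (Suc N))"
        by (intro mult_left_mono add_mono) auto
      also have "\<dots> < e\<^sup>2" using N by simp
      finally have "(norm (f m - f n))\<^sup>2 < e\<^sup>2" using Cd[of m n] by simp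
      then show "dist (f m) (f n) < e" using e by (simp add: dist_norm power2_less_imp_less)
    qed
  qed
  then obtain z where z: "f \<longlonglongrightarrow> z" using Cauchy_convergent convergent_def by blast
  have zM: "z \<in> closure M" using z f(1) unfolding closure_sequential by blast
  have ReE: "Re (\<phi> w) = Re (cinner w z)" if w: "w \<in> M" for w
  proof -
    define b where "b = Re (cinner w z) - Re (\<phi> w)"
    have *: "0 \<le> t\<^sup>2 * (norm w)\<^sup>2 + 2 * t * b" for t :: real
    proof (rule tendsto_lowerbound)
      have "(\<lambda>n. 1 / real (Suc n)) \<longlonglongrightarrow> 0"
        using LIMSEQ_inverse_real_of_nat by (simp add: inverse_eq_divide)
      then have "(\<lambda>n. t\<^sup>2 * (norm w)\<^sup>2 + 2 * t * (Re (cinner w (f n)) - Re (\<phi> w)) + 1 / real (Suc n))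
         \<longlonglongrightarrow> t\<^sup>2 * (norm w)\<^sup>2 + 2 * t * (Re (cinner w z) - Re (\<phi> w)) + 0"
        by (intro tendsto_intros tendsto_cinner_right z)
      then show "(\<lambda>n. t\<^sup>2 * (norm w)\<^sup>2 + 2 * t * (Re (cinner w (f n)) - Re (\<phi> w)) + 1 / real (Suc n))
         \<longlonglongrightarrow> t\<^sup>2 * (norm w)\<^sup>2 + 2 * t * b"
        by (simp add: b_def)
      show "\<forall>\<^sub>F n in sequentially. 0 \<le> t\<^sup>2 * (norm w)\<^sup>2 + 2 * t * (Re (cinner w (f n)) - Re (\<phi> w)) + 1 / real (Suc n)"
      proof (rule always_eventually, rule allI)
        fix n
        have tw: "t *\<^sub>R w \<in> M" using w M by (simp add: csubspace_scaleR)
        have "f n + t *\<^sub>R w \<in> M" using tw f M by (simp add: csubspace_def)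
        then have "d \<le> J (f n + t *\<^sub>R w)" by (rule dle)
        also have "J (f n + t *\<^sub>R w) = J (f n) + t\<^sup>2 * (norm w)\<^sup>2 + 2 * t * (Re (cinner w (f n)) - Re (\<phi> w))"
        proof -
          have "Re (cinner (f n) w) = Re (cinner w (f n))" by (metis cinner_commute cnj.sel(1))
          then show ?thesis
            using w tw f(1) unfolding J_def Re_cinner_self[symmetric] cinner_simps
            by (simp add: add homR power2_eq_square algebra_simps)
        qed
        finally show "0 \<le> t\<^sup>2 * (norm w)\<^sup>2 + 2 * t * (Re (cinner w (f n)) - Re (\<phi> w)) + 1 / real (Suc n)"
          using f(2)[of n] by linarith
      qed
    qed simp
    have "b = 0"
    proof (rule ccontr)
      assume b: "b \<noteq> 0"
      define s where "s = 1 / ((norm w)\<^sup>2 + 1)"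
      have pos: "(norm w)\<^sup>2 + 1 > 0" by (smt (verit) zero_le_power2)
      have s: "s > 0" "s * (norm w)\<^sup>2 < 1" using pos by (auto simp: s_def field_simps)
      have "0 \<le> s * b\<^sup>2 * (s * (norm w)\<^sup>2 - 2)"
        using *[of "- (s * b)"] by (simp add: power2_eq_square algebra_simps)
      moreover have "s * b\<^sup>2 > 0" using s b by simp
      ultimately show False using s by (simp add: zero_le_mult_iff)
    qed
    then show ?thesis by (simp add: b_def)
  qed
  have "\<phi> w = cinner w z" if w: "w \<in> M" for w
  proof -
    have "\<i> *\<^sub>C w \<in> M" using w M by (simp add: csubspace_def)
    from ReE[OF this] have "Im (\<phi> w) = Im (cinner w z)" using w by (simp add: hom cinner_simps)
    then show ?thesis using ReE[OF w] by (simp add: complex_eq_iff)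
  qed
  then show ?thesis using zM by blast
qed

text \<open>A bounded sesquilinear form, given on a subspace in the linear variable, is
  \<open>\<langle>x, Z y\<rangle>\<close> for a bounded operator \<open>Z\<close>. Adjoints, compressions and partial isometries are
  all instances.\<close>

lemma sesquilinear_representation:
  fixes \<phi> :: "'b::complex_hilbert \<Rightarrow> 'a::complex_hilbert \<Rightarrow> complex"
  assumes M: "csubspace M"
    and add: "\<And>y x x'. x \<in> M \<Longrightarrow> x' \<in> M \<Longrightarrow> \<phi> y (x + x') = \<phi> y x + \<phi> y x'"
    and hom: "\<And>y a x. x \<in> M \<Longrightarrow> \<phi> y (a *\<^sub>C x) = a * \<phi> y x"
    and add': "\<And>y y' x. x \<in> M \<Longrightarrow> \<phi> (y + y') x = \<phi> y x + \<phi> y' x"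
    and hom': "\<And>y a x. x \<in> M \<Longrightarrow> \<phi> (a *\<^sub>C y) x = cnj a * \<phi> y x"
    and bd: "\<And>y x. x \<in> M \<Longrightarrow> cmod (\<phi> y x) \<le> c * norm y * norm x"
  shows "\<exists>Z :: 'b \<Rightarrow>\<^sub>L 'a. clinear_op Z \<and> (\<forall>y. Z y \<in> closure M) \<and> (\<forall>y. \<forall>x\<in>M. \<phi> y x = cinner x (Z y))"
proof -
  have "\<exists>z\<in>closure M. \<forall>x\<in>M. \<phi> y x = cinner x z" for y
    using add hom bd by (intro riesz_subspace[OF M, where c="c * norm y"]) auto
  then obtain Z where Z: "\<And>y. Z y \<in> closure M" "\<And>y x. x \<in> M \<Longrightarrow> \<phi> y x = cinner x (Z y)" by metis
  have cM: "csubspace (closure M)" using M by (rule csubspace_closure)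
  have uniq: "z = z'" if zz: "z \<in> closure M" "z' \<in> closure M" "\<And>x. x \<in> M \<Longrightarrow> cinner x z = cinner x z'" for z z'
  proof -
    have "z + (-1) *\<^sub>C z' \<in> closure M" using cM zz by (simp add: csubspace_def)
    then have "z - z' \<in> closure M" by (simp add: scaleC_minus_one)
    then have "(norm (z - z'))\<^sup>2 \<le> 0 * norm (z - z')"
      using zz(3) by (intro closure_orthogonal_bound) (auto simp: cinner_diff_right)
    then show ?thesis by simp
  qed
  have 1: "Z (y + y') = Z y + Z y'" for y y'
    using cM Z(1) by (intro uniq) (auto simp: csubspace_def cinner_add_right add' simp flip: Z(2))
  have 2: "Z (a *\<^sub>C y) = a *\<^sub>C Z y" for a y
    using cM Z(1) by (intro uniq) (auto simp: csubspace_def cinner_scaleC_right hom' simp flip: Z(2))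
  have 3: "norm (Z y) \<le> norm y * \<bar>c\<bar>" for y
  proof -
    have "(norm (Z y))\<^sup>2 \<le> (c * norm y) * norm (Z y)"
      using Z bd by (intro closure_orthogonal_bound) (auto simp flip: Z(2))
    then have "norm (Z y) \<le> c * norm y \<or> norm (Z y) = 0"
      unfolding power2_eq_square
      by (metis mult_le_cancel_right_pos norm_ge_zero order_le_less)
    moreover have "c * norm y \<le> norm y * \<bar>c\<bar>"
      by (metis abs_ge_self mult.commute mult_left_mono norm_ge_zero)
    ultimately show ?thesis by fastforce
  qed
  have "bounded_linear Z"
    by (rule bounded_linear_intro[OF 1 _ 3]) (metis 2 scaleC_of_real)
  then have "blinfun_apply (Blinfun Z) = Z" by (rule bounded_linear_Blinfun_apply)
  then show ?thesis using Z 2 by (intro exI[of _ "Blinfun Z"]) (auto simp: clinear_op_def)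
qed


section \<open>The ring of bounded operators\<close>

text \<open>A ring structure makes the simplifier's algebra available. The class
  \<^class>\<open>real_normed_algebra_1\<close> is avoided: it demands \<open>\<parallel>1\<parallel> = 1\<close>, which fails on the zero space.\<close>

typedef (overloaded) 'a bop = "{A :: 'a::complex_hilbert \<Rightarrow>\<^sub>L 'a. clinear_op A}"
  morphisms blin Bop
  by (rule exI[of _ 0]) (simp add: clinear_op_def)

setup_lifting type_definition_bop

lift_definition app :: "'a::complex_hilbert bop \<Rightarrow> 'a \<Rightarrow> 'a" (infixr "\<cdot>" 90) is blinfun_apply .

lemma clinear_blin [simp]: "clinear_op (blin A)" using blin[of A] by simp

lemma blin_Bop: "clinear_op A \<Longrightarrow> blin (Bop A) = A" by (simp add: Bop_inverse)

instantiation bop :: (complex_hilbert) real_normed_vector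
begin
lift_definition zero_bop :: "'a bop" is 0 by (simp add: clinear_op_def)
lift_definition plus_bop :: "'a bop \<Rightarrow> 'a bop \<Rightarrow> 'a bop" is "(+)"
  by (simp add: clinear_op_def blinfun.add_left scaleC_add_right)
lift_definition uminus_bop :: "'a bop \<Rightarrow> 'a bop" is uminus
  by (simp add: clinear_op_def blinfun.minus_left) (metis linear_neg bounded_linear.linear bounded_linear_scaleC)
lift_definition minus_bop :: "'a bop \<Rightarrow> 'a bop \<Rightarrow> 'a bop" is "(-)"
  by (simp add: clinear_op_def blinfun.diff_left) (metis linear_diff bounded_linear.linear bounded_linear_scaleC)
lift_definition scaleR_bop :: "real \<Rightarrow> 'a bop \<Rightarrow> 'a bop" is "(*\<^sub>R)"
  by (simp add: clinear_op_def blinfun.scaleR_left) (metis linear_scale bounded_linear.linear bounded_linear_scaleC)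
lift_definition norm_bop :: "'a bop \<Rightarrow> real" is norm .
definition dist_bop :: "'a bop \<Rightarrow> 'a bop \<Rightarrow> real" where "dist_bop a b = norm (a - b)"
definition sgn_bop :: "'a bop \<Rightarrow> 'a bop" where "sgn_bop a = scaleR (inverse (norm a)) a"
definition uniformity_bop :: "('a bop \<times> 'a bop) filter" where
  "uniformity_bop = (INF e\<in>{0 <..}. principal {(x, y). dist x y < e})"
definition open_bop :: "'a bop set \<Rightarrow> bool" where
  "open_bop S = (\<forall>x\<in>S. \<forall>\<^sub>F (x', y) in uniformity. x' = x \<longrightarrow> y \<in> S)"
instance
  by standard (unfold dist_bop_def sgn_bop_def uniformity_bop_def open_bop_def, (transfer, auto simp: algebra_simps norm_triangle_ineq)+)
end

instantiation bop :: (complex_hilbert) "{real_normed_algebra, monoid_mult}"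
begin
lift_definition one_bop :: "'a bop" is id_blinfun by (simp add: clinear_op_def)
lift_definition times_bop :: "'a bop \<Rightarrow> 'a bop \<Rightarrow> 'a bop" is "(o\<^sub>L)" by (simp add: clinear_op_def)
instance
  by standard (transfer, auto intro!: blinfun_eqI simp: blinfun.bilinear_simps norm_blinfun_compose)+
end

lemma app_simps [simp]:
  "(A + B) \<cdot> x = A \<cdot> x + B \<cdot> x" "(A - B) \<cdot> x = A \<cdot> x - B \<cdot> x" "(- A) \<cdot> x = - (A \<cdot> x)"
  "(A * B) \<cdot> x = A \<cdot> B \<cdot> x" "1 \<cdot> x = x" "0 \<cdot> x = 0" "(r *\<^sub>R A) \<cdot> x = r *\<^sub>R (A \<cdot> x)"
  "A \<cdot> (x + y) = A \<cdot> x + A \<cdot> y" "A \<cdot> (x - y) = A \<cdot> x - A \<cdot> y" "A \<cdot> (- x) = - (A \<cdot> x)"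
  "A \<cdot> 0 = 0" "A \<cdot> (r *\<^sub>R x) = r *\<^sub>R (A \<cdot> x)" "A \<cdot> (a *\<^sub>C x) = a *\<^sub>C (A \<cdot> x)"
  by (transfer, simp add: blinfun.bilinear_simps clinear_op_def)+

lemma app_sum: "(\<Sum>i\<in>F. f i) \<cdot> x = (\<Sum>i\<in>F. f i \<cdot> x)"
  by (induction F rule: infinite_finite_induct) auto

lemma bop_eqI: "(\<And>x. A \<cdot> x = B \<cdot> x) \<Longrightarrow> A = B"
  by transfer (rule blinfun_eqI)

lemma norm_app_le: "norm (A \<cdot> x) \<le> norm A * norm x"
  by transfer (rule norm_blinfun)

lemma norm_bop_bound: "0 \<le> c \<Longrightarrow> (\<And>x. norm (A \<cdot> x) \<le> c * norm x) \<Longrightarrow> norm A \<le> c"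
  by transfer (rule norm_blinfun_bound)

lemma norm_one_bop_le: "norm (1 :: 'a::complex_hilbert bop) \<le> 1"
  by (rule norm_bop_bound) auto

lemma norm_power_bop_le: "norm (A ^ k) \<le> norm (A :: 'a::complex_hilbert bop) ^ k"
proof (induction k)
  case 0 then show ?case by (simp add: norm_one_bop_le)
next
  case (Suc k)
  have "norm (A ^ Suc k) \<le> norm A * norm (A ^ k)" by (simp add: norm_mult_ineq)
  also have "\<dots> \<le> norm A * norm A ^ k" using Suc by (simp add: mult_left_mono)
  finally show ?case by simp
qed

lemma bop_ext_cinner:
  assumes "\<And>x y. cinner (A \<cdot> x) y = cinner (B \<cdot> x) y" shows "A = B"
proof (rule bop_eqI)
  fix x
  have "cinner (A \<cdot> x - B \<cdot> x) (A \<cdot> x - B \<cdot> x) = 0" using assms by (simp add: cinner_diff_left)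
  then show "A \<cdot> x = B \<cdot> x" by (simp add: cinner_self)
qed

lemma bounded_linear_app: "bounded_linear (\<lambda>A. A \<cdot> x)"
  by (rule bounded_linear_intro[where K="norm x"]) (auto simp: norm_app_le)

lemma blin_simps:
  "blin 0 = 0" "blin 1 = id_blinfun" "blin (A + B) = blin A + blin B" "blin (A - B) = blin A - blin B"
  "blin (A * B) = blin A o\<^sub>L blin B" "blin (r *\<^sub>R A) = r *\<^sub>R blin A" "norm (blin A) = norm A"
  "blin (- A) = - blin A"
  by (simp_all add: zero_bop.rep_eq one_bop.rep_eq plus_bop.rep_eq minus_bop.rep_eq times_bop.rep_eq
      scaleR_bop.rep_eq norm_bop.rep_eq uminus_bop.rep_eq)

lemma bounded_linear_blin: "bounded_linear blin"
  by (rule bounded_linear_intro[where K=1]) (auto simp: blin_simps)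

instance bop :: (complex_hilbert) banach
proof
  fix X :: "nat \<Rightarrow> 'a bop" assume "Cauchy X"
  then have "Cauchy (\<lambda>n. blin (X n))"
    by (simp add: Cauchy_def dist_norm flip: blin_simps)
  then obtain L where L: "(\<lambda>n. blin (X n)) \<longlonglongrightarrow> L" using Cauchy_convergent convergent_def by blast
  have lim: "(\<lambda>n. blin (X n) x) \<longlonglongrightarrow> L x" for x
    using L by (rule blinfun.tendsto) simp
  have "L (a *\<^sub>C x) = a *\<^sub>C L x" for a x
  proof (rule LIMSEQ_unique[OF lim])
    have "(\<lambda>n. a *\<^sub>C blin (X n) x) \<longlonglongrightarrow> a *\<^sub>C L x"
      by (rule bounded_linear.tendsto[OF bounded_linear_scaleC lim])
    then show "(\<lambda>n. blin (X n) (a *\<^sub>C x)) \<longlonglongrightarrow> a *\<^sub>C L x"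
      by (simp add: clinear_blin[unfolded clinear_op_def])
  qed
  then have c: "clinear_op L" by (simp add: clinear_op_def)
  have "norm (X n - Bop L) = norm (blin (X n) - L)" for n
    by (metis blin_simps(4,7) blin_Bop[OF c])
  then have "X \<longlonglongrightarrow> Bop L"
    using L by (simp add: tendsto_iff dist_norm)
  then show "convergent X" by (auto simp: convergent_def)
qed

text \<open>Complex scalars are central elements of the ring, so that no separate complex scalar
  multiplication of operators is needed.\<close>

lift_definition sc :: "complex \<Rightarrow> 'a::complex_hilbert bop" is "\<lambda>a. op_scaleC a id_blinfun"
  by (simp add: clinear_op_def op_scaleC.rep_eq scaleC_scaleC mult.commute)

lemma sc_app [simp]: "sc a \<cdot> x = a *\<^sub>C x"
  by transfer (simp add: op_scaleC.rep_eq)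

lemma sc_simps:
  "sc (a + b) = sc a + sc b" "sc (a * b) = sc a * sc b" "sc 0 = 0" "sc 1 = 1" "sc (- a) = - sc a"
  "sc (a - b) = sc a - sc b"
  "sc (of_real r) = r *\<^sub>R 1"
  using scaleC_diff_left[of 0 a]
  by (auto intro!: bop_eqI simp: scaleC_add_left scaleC_diff_left scaleC_scaleC scaleC_of_real mult.commute)

lemma sc_commute: "A * sc a = sc a * A"
  by (rule bop_eqI) simp

lemma sc_sum: "sc (\<Sum>i\<in>F. f i) = (\<Sum>i\<in>F. sc (f i))"
  by (induction F rule: infinite_finite_induct) (auto simp: sc_simps)

lemma blin_sc_mult: "blin (sc a * A) = op_scaleC a (blin A)"
  by transfer (auto intro!: blinfun_eqI simp: op_scaleC.rep_eq)

lemma norm_sc_mult: "norm (sc a * A) = cmod a * norm (A :: 'a::complex_hilbert bop)"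
proof -
  have le: "norm (sc a * A) \<le> cmod a * norm A" for a and A :: "'a bop"
    by (rule norm_bop_bound) (auto simp: norm_scaleC mult.assoc intro!: mult_left_mono norm_app_le)
  show ?thesis
  proof (cases "a = 0")
    case False
    have "norm A = norm (sc (inverse a) * (sc a * A))"
      using False by (simp flip: mult.assoc sc_simps) (simp add: sc_simps)
    also have "\<dots> \<le> cmod (inverse a) * norm (sc a * A)" by (rule le)
    finally show ?thesis using le[of a A] False by (simp add: norm_inverse norm_divide field_simps)
  qed (simp add: sc_simps)
qed

subsection \<open>Adjoints\<close>

lemma adj_exists:
  assumes "clinear_op (A :: 'a::complex_hilbert \<Rightarrow>\<^sub>L 'a)"
  shows "\<exists>B. clinear_op B \<and> (\<forall>x y. cinner (A x) y = cinner x (B y))"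
proof -
  have "\<exists>Z :: 'a \<Rightarrow>\<^sub>L 'a. clinear_op Z \<and> (\<forall>y. Z y \<in> closure UNIV) \<and> (\<forall>y. \<forall>x\<in>UNIV. cinner (A x) y = cinner x (Z y))"
  proof (rule sesquilinear_representation[where c="norm A"])
    fix y x
    have "cmod (cinner (A x) y) \<le> norm (A x) * norm y" by (rule norm_cinner_le)
    also have "\<dots> \<le> norm A * norm x * norm y" by (intro mult_right_mono norm_blinfun) auto
    finally show "cmod (cinner (A x) y) \<le> norm A * norm y * norm x" by (simp add: mult_ac)
  qed (use assms in \<open>auto simp: csubspace_def clinear_op_def blinfun.add_right cinner_simps\<close>)
  then show ?thesis by auto
qed

lemma adj_eqI:
  fixes A B :: "'a::complex_hilbert \<Rightarrow>\<^sub>L 'a"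
  assumes "\<And>x y. cinner (A x) y = cinner x (B y)" shows "adj A = B"
  unfolding adj_def
proof (rule the_equality)
  fix C :: "'a \<Rightarrow>\<^sub>L 'a" assume C: "\<forall>x y. cinner (A x) y = cinner x (C y)"
  show "C = B"
  proof (rule blinfun_eqI)
    fix y
    have "cinner (C y - B y) (C y - B y) = 0" using C assms by (simp add: cinner_diff_right)
    then show "C y = B y" by (simp add: cinner_self)
  qed
qed (use assms in blast)

lift_definition star :: "'a::complex_hilbert bop \<Rightarrow> 'a bop" is adj
  using adj_exists adj_eqI by metis

lemma cinner_app_left: "cinner (A \<cdot> x) y = cinner x (star A \<cdot> y)"
  by transfer (metis adj_exists adj_eqI)

lemma cinner_app_right: "cinner x (A \<cdot> y) = cinner (star A \<cdot> x) y"
  by (metis cinner_app_left cinner_commute)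

lemma star_eqI: "(\<And>x y. cinner (A \<cdot> x) y = cinner x (B \<cdot> y)) \<Longrightarrow> star A = B"
  by transfer (rule adj_eqI)

lemma star_simps [simp]:
  "star (star A) = A" "star (A * B) = star B * star A" "star (A + B) = star A + star B"
  "star (A - B) = star A - star B" "star 1 = 1" "star 0 = 0" "star (r *\<^sub>R A) = r *\<^sub>R star A"
  "star (sc a) = sc (cnj a)" "star (- A) = - star A"
  by (rule star_eqI, simp add: cinner_app_right)
    (rule star_eqI; simp add: cinner_app_left cinner_simps)+

lemma star_power [simp]: "star (A ^ k) = star A ^ k"
  by (induction k) (auto simp: power_commutes)

lemma norm_star [simp]: "norm (star A) = norm (A :: 'a::complex_hilbert bop)"
proof -
  have "norm (star A) \<le> norm A" for A :: "'a bop"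
  proof (rule norm_bop_bound)
    fix x
    have "(norm (star A \<cdot> x))\<^sup>2 = cmod (cinner (A \<cdot> star A \<cdot> x) x)"
      by (simp add: cinner_app_left cinner_self norm_power)
    also have "\<dots> \<le> norm (A \<cdot> star A \<cdot> x) * norm x" by (rule norm_cinner_le)
    also have "\<dots> \<le> norm A * norm (star A \<cdot> x) * norm x" by (intro mult_right_mono norm_app_le) auto
    finally have "norm (star A \<cdot> x) * norm (star A \<cdot> x) \<le> (norm A * norm x) * norm (star A \<cdot> x)"
      by (simp add: power2_eq_square mult_ac)
    then show "norm (star A \<cdot> x) \<le> norm A * norm x"
      by (cases "norm (star A \<cdot> x) = 0") (simp_all add: mult_le_cancel_right)
  qed simp
  from this[of A] this[of "star A"] show ?thesis by simp
qed

lemma bounded_linear_star: "bounded_linear star"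
  by (rule bounded_linear_intro[where K=1]) auto

section \<open>Positive operators, square roots and polar decomposition\<close>

definition pos :: "'a::complex_hilbert bop \<Rightarrow> bool" where
  "pos A \<longleftrightarrow> (\<forall>x. cinner (A \<cdot> x) x \<in> \<real> \<and> 0 \<le> Re (cinner (A \<cdot> x) x))"

lemma pos_iff_positive_op: "pos A \<longleftrightarrow> positive_op (blin A)"
  by (simp add: pos_def positive_op_def app.rep_eq)

lemma star_pos: assumes "pos A" shows "star A = A"
proof (rule star_eqI)
  fix x y
  have r: "Im (cinner (A \<cdot> z) z) = 0" for z using assms by (simp add: pos_def complex_is_Real_iff)
  have "Im (cinner (A \<cdot> x) y) + Im (cinner (A \<cdot> y) x) = 0"
    using r[of "x + y"] r[of x] r[of y] by (simp add: cinner_simps)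
  moreover have "Re (cinner (A \<cdot> y) x) = Re (cinner (A \<cdot> x) y)"
    using r[of "x + \<i> *\<^sub>C y"] r[of x] r[of y] by (simp add: cinner_simps)
  ultimately have "cinner (A \<cdot> x) y = cnj (cinner (A \<cdot> y) x)" by (simp add: complex_eq_iff)
  then show "cinner (A \<cdot> x) y = cinner x (A \<cdot> y)" by (metis cinner_commute)
qed

lemma pos_star_mult: "pos (star A * A)"
  by (simp add: pos_def cinner_app_left cinner_self)

lemma pos_conj: "pos A \<Longrightarrow> pos (star B * A * B)"
  unfolding pos_def by (simp add: cinner_app_left[of "star B"])

lemma pos_conj': "pos A \<Longrightarrow> pos (B * A * star B)"
  using pos_conj[of A "star B"] by simp

lemma pos_add: "pos A \<Longrightarrow> pos B \<Longrightarrow> pos (A + B)"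
  by (simp add: pos_def cinner_add_left)

lemma pos_0 [simp]: "pos 0" and pos_1 [simp]: "pos 1"
  by (simp_all add: pos_def cinner_self flip: of_real_power)

lemma pos_scaleR: "0 \<le> r \<Longrightarrow> pos A \<Longrightarrow> pos (r *\<^sub>R A)"
  by (simp add: pos_def cinner_scaleR_left)

lemma pos_cauchy_schwarz:
  assumes "pos A"
  shows "(cmod (cinner (A \<cdot> x) y))\<^sup>2 \<le> Re (cinner (A \<cdot> x) x) * Re (cinner (A \<cdot> y) y)"
proof (rule positive_form_discriminant[where \<gamma>' = "cinner (A \<cdot> y) x"])
  fix a
  have r: "cinner (A \<cdot> z) z = of_real (Re (cinner (A \<cdot> z) z))" for z
    using assms by (simp add: pos_def of_real_Re)
  have "of_real (Re (cinner (A \<cdot> x) x)) + cnj a * cinner (A \<cdot> x) y + a * cinner (A \<cdot> y) x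
      + of_real ((cmod a)\<^sup>2 * Re (cinner (A \<cdot> y) y)) = cinner (A \<cdot> (x + a *\<^sub>C y)) (x + a *\<^sub>C y)"
    unfolding of_real_mult complex_norm_square r[symmetric]
    by (simp add: cinner_simps algebra_simps)
  then show "of_real (Re (cinner (A \<cdot> x) x)) + cnj a * cinner (A \<cdot> x) y + a * cinner (A \<cdot> y) x
      + of_real ((cmod a)\<^sup>2 * Re (cinner (A \<cdot> y) y)) \<in> \<real> \<and>
      0 \<le> Re (of_real (Re (cinner (A \<cdot> x) x)) + cnj a * cinner (A \<cdot> x) y + a * cinner (A \<cdot> y) x
      + of_real ((cmod a)\<^sup>2 * Re (cinner (A \<cdot> y) y)))"
    using assms unfolding pos_def by metis
qed (use assms in \<open>simp add: pos_def\<close>)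

text \<open>The quadratic form controls the norm: take \<open>y = A x\<close> in the Cauchy--Schwarz inequality of
  \<open>A\<close>.\<close>

lemma norm_pos_le:
  assumes A: "pos A" and c: "0 \<le> c" "\<And>x. Re (cinner (A \<cdot> x) x) \<le> c * (norm x)\<^sup>2"
  shows "norm A \<le> c"
proof (rule norm_bop_bound[OF c(1)])
  fix x
  have "((norm (A \<cdot> x))\<^sup>2)\<^sup>2 = (cmod (cinner (A \<cdot> x) (A \<cdot> x)))\<^sup>2" by (simp add: cinner_self norm_power)
  also have "\<dots> \<le> Re (cinner (A \<cdot> x) x) * Re (cinner (A \<cdot> A \<cdot> x) (A \<cdot> x))"
    by (rule pos_cauchy_schwarz[OF A])
  also have "\<dots> \<le> (c * (norm x)\<^sup>2) * (c * (norm (A \<cdot> x))\<^sup>2)"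
    using A c by (intro mult_mono) (auto simp: pos_def)
  finally have *: "(norm (A \<cdot> x))\<^sup>2 * (norm (A \<cdot> x))\<^sup>2 \<le> (c * norm x)\<^sup>2 * (norm (A \<cdot> x))\<^sup>2"
    by (simp add: power2_eq_square mult_ac)
  have "(norm (A \<cdot> x))\<^sup>2 \<le> (c * norm x)\<^sup>2"
  proof (cases "A \<cdot> x = 0")
    case False
    then have "0 < (norm (A \<cdot> x))\<^sup>2" by simp
    with * show ?thesis by (rule mult_right_le_imp_le)
  qed simp
  then show "norm (A \<cdot> x) \<le> c * norm x" by (rule power2_le_imp_le) (simp add: c(1))
qed

text \<open>With \<open>P = 1 - C\<close> normalised to \<open>0 \<le> C \<le> 1\<close>, the root is \<open>1 - L\<close> for the fixed point
  \<open>L\<close> of \<open>S \<mapsto> (C + S\<^sup>2) / 2\<close>. The iterates starting at \<open>0\<close> are Cauchy because their increments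
  are dominated by those of the same iteration for the number \<open>1\<close> in place of \<open>C\<close>.\<close>

lemma pos_sqrt_contraction:
  assumes C: "pos C" "norm C \<le> 1"
  shows "\<exists>Q. star Q = Q \<and> Q * Q = 1 - C \<and> (\<forall>T. T * C = C * T \<longrightarrow> T * Q = Q * T)"
proof -
  define S where "S = rec_nat 0 (\<lambda>_ s. (1/2::real) *\<^sub>R (C + s * s))"
  define s where "s = rec_nat 0 (\<lambda>_ s. (1/2::real) * (1 + s * s))"
  have S0: "S 0 = 0" and SS: "\<And>k. S (Suc k) = (1/2) *\<^sub>R (C + S k * S k)" by (simp_all add: S_def)
  have s0: "s 0 = 0" and sS: "\<And>k. s (Suc k) = (1/2) * (1 + s k * s k)" by (simp_all add: s_def)
  have comm: "T * S k = S k * T" if T: "T * C = C * T" for T k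
  proof (induction k)
    case (Suc k)
    have "T * (S k * S k) = (S k * S k) * T" by (metis Suc mult.assoc)
    then show ?case by (simp add: SS distrib_left distrib_right T)
  qed (simp add: S0)
  have SC: "S k * C = C * S k" for k using comm[of C k] by simp
  have SSc: "S k * S m = S m * S k" for k m using comm[OF SC] .
  have starS: "star (S k) = S k" for k
    by (induction k) (simp_all add: S0 SS star_pos[OF C(1)])
  have s01: "0 \<le> s k \<and> s k \<le> 1" for k
  proof (induction k)
    case (Suc k)
    then have "s k * s k \<le> 1" by (simp add: mult_le_one)
    then show ?case using Suc by (simp add: sS)
  qed (simp add: s0)
  have nS: "norm (S k) \<le> s k" for k
  proof (induction k)
    case (Suc k)
    have "norm (C + S k * S k) \<le> norm C + norm (S k) * norm (S k)"
      by (intro norm_triangle_le add_mono norm_mult_ineq order_refl)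
    also have "\<dots> \<le> 1 + s k * s k" using C(2) Suc s01[of k] by (intro add_mono mult_mono) auto
    finally show ?case by (simp add: SS sS)
  qed (simp add: S0 s0)
  have inc: "norm (S (Suc k) - S k) \<le> s (Suc k) - s k" for k
  proof (induction k)
    case 0
    then show ?case using nS[of 1] by (simp add: S0 s0)
  next
    case (Suc k)
    have "S (Suc (Suc k)) - S (Suc k) = (1/2) *\<^sub>R (C + S (Suc k) * S (Suc k)) - (1/2) *\<^sub>R (C + S k * S k)"
      by (rule arg_cong2[of _ _ _ _ "(-)", OF SS SS])
    also have "\<dots> = (1/2) *\<^sub>R (S (Suc k) * S (Suc k) - S k * S k)"
      by (simp flip: scaleR_diff_right)
    also have "S (Suc k) * S (Suc k) - S k * S k = (S (Suc k) - S k) * (S (Suc k) + S k)"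
      by (simp add: distrib_left left_diff_distrib SSc[of k "Suc k"])
    finally have "S (Suc (Suc k)) - S (Suc k) = (1/2) *\<^sub>R ((S (Suc k) - S k) * (S (Suc k) + S k))" .
    then have "norm (S (Suc (Suc k)) - S (Suc k)) = (1/2) * norm ((S (Suc k) - S k) * (S (Suc k) + S k))"
      by simp
    also have "\<dots> \<le> (1/2) * (norm (S (Suc k) - S k) * norm (S (Suc k) + S k))"
      by (simp add: norm_mult_ineq)
    also have "\<dots> \<le> (1/2) * ((s (Suc k) - s k) * (s (Suc k) + s k))"
    proof -
      have "norm (S (Suc k) + S k) \<le> s (Suc k) + s k"
        using norm_triangle_ineq[of "S (Suc k)" "S k"] nS[of "Suc k"] nS[of k] by linarith
      moreover have "0 \<le> s (Suc k) - s k" using Suc norm_ge_zero order_trans by blast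
      ultimately show ?thesis using Suc by (simp add: mult_mono)
    qed
    also have "\<dots> = (1/2) * (1 + s (Suc k) * s (Suc k)) - (1/2) * (1 + s k * s k)"
      by (simp add: algebra_simps)
    also have "\<dots> = s (Suc (Suc k)) - s (Suc k)"
      by (rule arg_cong2[of _ _ _ _ "(-)", OF sS[symmetric] sS[symmetric]])
    finally show ?case .
  qed
  have tele: "norm (S (m + k) - S k) \<le> s (m + k) - s k" for m k
  proof (induction m)
    case (Suc m)
    have "S (Suc m + k) - S k = (S (Suc (m + k)) - S (m + k)) + (S (m + k) - S k)" by simp
    then have "norm (S (Suc m + k) - S k) \<le> norm (S (Suc (m + k)) - S (m + k)) + norm (S (m + k) - S k)"
      by (metis norm_triangle_ineq)
    then show ?case using Suc inc[of "m + k"] by simp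
  qed simp
  have "incseq s"
  proof (rule incseq_SucI)
    fix k show "s k \<le> s (Suc k)" using order_trans[OF norm_ge_zero inc[of k]] by simp
  qed
  then have "convergent s" using s01 by (metis incseq_convergent convergentI)
  then have Cs: "Cauchy s" by (rule convergent_Cauchy)
  have "Cauchy S"
  proof (rule metric_CauchyI)
    fix e :: real assume "0 < e"
    then obtain N where N: "\<And>m n. m \<ge> N \<Longrightarrow> n \<ge> N \<Longrightarrow> dist (s m) (s n) < e"
      using Cs unfolding Cauchy_def by blast
    have *: "dist (S (m + n)) (S n) < e" if "n \<ge> N" for m n
      using tele[of m n] N[of "m + n" n] that by (simp add: dist_norm dist_real_def)
    have "dist (S m) (S n) < e" if "m \<ge> N" "n \<ge> N" for m n
      using *[of n "m - n"] *[of m "n - m"] that by (cases "n \<le> m") (simp_all add: dist_commute)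
    then show "\<exists>N. \<forall>m\<ge>N. \<forall>n\<ge>N. dist (S m) (S n) < e" by blast
  qed
  then obtain L where L: "S \<longlonglongrightarrow> L" using Cauchy_convergent convergent_def by blast
  have "(\<lambda>k. S (Suc k)) \<longlonglongrightarrow> (1/2) *\<^sub>R (C + L * L)"
    unfolding SS by (intro tendsto_intros L)
  then have fixL: "L = (1/2) *\<^sub>R (C + L * L)" using LIMSEQ_Suc[OF L] LIMSEQ_unique by blast
  have starL: "star L = L"
    using bounded_linear.tendsto[OF bounded_linear_star L] L LIMSEQ_unique unfolding starS by blast
  have commL: "T * L = L * T" if T: "T * C = C * T" for T
  proof -
    have "(\<lambda>k. T * S k) \<longlonglongrightarrow> T * L" "(\<lambda>k. S k * T) \<longlonglongrightarrow> L * T" by (intro tendsto_intros L)+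
    then show ?thesis using LIMSEQ_unique by (simp add: comm[OF T])
  qed
  have "L + L = C + L * L" using arg_cong[OF fixL, of "\<lambda>x. 2 *\<^sub>R x"] by (simp add: scaleR_2)
  then have "(1 - L) * (1 - L) = 1 - C" by (simp add: algebra_simps)
  moreover have "T * (1 - L) = (1 - L) * T" if "T * C = C * T" for T
    using commL[OF that] by (simp add: right_diff_distrib left_diff_distrib)
  moreover have "star (1 - L) = 1 - L" using starL by simp
  ultimately show ?thesis by blast
qed

lemma pos_sqrt:
  assumes P: "pos P"
  shows "\<exists>Q. star Q = Q \<and> Q * Q = P \<and> (\<forall>T. T * P = P * T \<longrightarrow> T * Q = Q * T)"
proof (cases "P = 0")
  case True then show ?thesis by (intro exI[of _ 0]) simp
next
  case False
  define c where "c = norm P"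
  have c: "c > 0" using False by (simp add: c_def)
  define C where "C = 1 - (1/c) *\<^sub>R P"
  have le: "0 \<le> Re (cinner (C \<cdot> x) x)" and le1: "Re (cinner (C \<cdot> x) x) \<le> 1 * (norm x)\<^sup>2" for x
  proof -
    have "Re (cinner (P \<cdot> x) x) \<le> norm (P \<cdot> x) * norm x"
      using complex_Re_le_cmod norm_cinner_le order_trans by blast
    also have "\<dots> \<le> c * norm x * norm x" by (intro mult_right_mono) (auto simp: c_def norm_app_le)
    finally have "Re (cinner (P \<cdot> x) x) / c \<le> (norm x)\<^sup>2"
      using c by (simp add: field_simps power2_eq_square)
    then show "0 \<le> Re (cinner (C \<cdot> x) x)" by (simp add: C_def cinner_simps Re_cinner_self)
    show "Re (cinner (C \<cdot> x) x) \<le> 1 * (norm x)\<^sup>2"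
      using P c by (simp add: C_def cinner_simps Re_cinner_self pos_def)
  qed
  have "pos C" unfolding pos_def
  proof (intro allI conjI le)
    fix x show "cinner (C \<cdot> x) x \<in> \<real>"
      using P by (simp add: C_def cinner_simps pos_def complex_is_Real_iff)
  qed
  moreover have "norm C \<le> 1" using norm_pos_le[OF \<open>pos C\<close>, of 1] le1 by simp
  ultimately obtain Q where Q: "star Q = Q" "Q * Q = 1 - C" "\<And>T. T * C = C * T \<Longrightarrow> T * Q = Q * T"
    using pos_sqrt_contraction by metis
  show ?thesis
  proof (intro exI[of _ "sqrt c *\<^sub>R Q"] conjI allI impI)
    show "sqrt c *\<^sub>R Q * sqrt c *\<^sub>R Q = P" using c Q(2) by (simp add: C_def)
    fix T assume "T * P = P * T"
    then have "T * C = C * T" by (simp add: C_def algebra_simps)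
    then show "T * sqrt c *\<^sub>R Q = sqrt c *\<^sub>R Q * T" using Q(3)[of T] by simp
  qed (use Q(1) in simp)
qed

text \<open>The root \<open>Q\<close> of \<open>A\<close> commutes with \<open>B\<close>, so \<open>A B = Q B Q\<close>.\<close>

lemma pos_mult_commuting:
  assumes "pos A" "pos B" "A * B = B * A" shows "pos (A * B)"
proof -
  obtain Q where Q: "star Q = Q" "Q * Q = A" "\<And>T. T * A = A * T \<Longrightarrow> T * Q = Q * T"
    using pos_sqrt[OF assms(1)] by metis
  have "B * Q = Q * B" using Q(3)[of B] assms(3) by simp
  then have "A * B = star Q * B * Q" by (metis Q(1,2) mult.assoc)
  then show ?thesis using pos_conj[OF assms(2)] by simp
qed

text \<open>A form of the polar decomposition: \<open>Q = |S|\<close>, and \<open>Z\<close> is the adjoint of the partial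
  isometry. In particular \<open>star S = Z * S * Z\<close>, so that two-sided ideals are self-adjoint.\<close>

lemma polar_decomposition:
  fixes S :: "'a::complex_hilbert bop"
  shows "\<exists>Q Z. star Q = Q \<and> Q * Q = star S * S \<and> Z * S = Q \<and> star S = Q * Z"
proof -
  obtain Q where Q: "star Q = Q" "Q * Q = star S * S" using pos_sqrt[OF pos_star_mult] by metis
  have inner: "cinner (Q \<cdot> u) (Q \<cdot> v) = cinner (S \<cdot> u) (S \<cdot> v)" for u v
    using arg_cong[OF Q(2), of "\<lambda>T. cinner u (T \<cdot> v)"] by (simp add: cinner_app_left Q(1))
  have nrm: "norm (S \<cdot> u) = norm (Q \<cdot> u)" for u
    using inner[of u u] by (simp add: cinner_self flip: of_real_power)
  define g where "g x = S \<cdot> (SOME u. Q \<cdot> u = x)" for x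
  have g: "g (Q \<cdot> u) = S \<cdot> u" for u
  proof -
    have "Q \<cdot> (SOME v. Q \<cdot> v = Q \<cdot> u) = Q \<cdot> u" by (rule someI[of _ u]) simp
    then have "norm (Q \<cdot> ((SOME v. Q \<cdot> v = Q \<cdot> u) - u)) = 0" by simp
    then show ?thesis unfolding g_def using nrm[of "(SOME v. Q \<cdot> v = Q \<cdot> u) - u"] by simp
  qed
  let ?M = "range (app Q)"
  have M: "csubspace ?M" unfolding csubspace_def
  proof (intro conjI ballI allI)
    show "0 \<in> ?M" using app_simps(11)[of Q] by (metis rangeI)
    fix x y assume "x \<in> ?M" "y \<in> ?M"
    then obtain u v where "x = Q \<cdot> u" "y = Q \<cdot> v" by blast
    then have "x + y = Q \<cdot> (u + v)" by simp
    then show "x + y \<in> ?M" by blast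
  next
    fix a x assume "x \<in> ?M"
    then obtain u where "x = Q \<cdot> u" by blast
    then have "a *\<^sub>C x = Q \<cdot> (a *\<^sub>C u)" by simp
    then show "a *\<^sub>C x \<in> ?M" by blast
  qed
  have "\<exists>Z :: 'a \<Rightarrow>\<^sub>L 'a. clinear_op Z \<and> (\<forall>y. Z y \<in> closure ?M) \<and> (\<forall>y. \<forall>x\<in>?M. cinner (g x) y = cinner x (Z y))"
  proof (rule sesquilinear_representation[OF M, where c=1])
    fix y x assume "x \<in> ?M"
    then obtain u where "x = Q \<cdot> u" by blast
    then show "cmod (cinner (g x) y) \<le> 1 * norm y * norm x"
      using norm_cinner_le[of "S \<cdot> u" y] by (simp add: g nrm mult.commute)
  next
    fix y x x' assume "x \<in> ?M" "x' \<in> ?M"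
    then obtain u u' where "x = Q \<cdot> u" "x' = Q \<cdot> u'" by blast
    then show "cinner (g (x + x')) y = cinner (g x) y + cinner (g x') y"
      using g[of "u + u'"] by (simp add: g cinner_simps)
  next
    fix y a x assume "x \<in> ?M"
    then obtain u where "x = Q \<cdot> u" by blast
    then show "cinner (g (a *\<^sub>C x)) y = a * cinner (g x) y"
      using g[of "a *\<^sub>C u"] by (simp add: g cinner_simps)
  qed (simp_all add: cinner_simps)
  then obtain Z0 :: "'a \<Rightarrow>\<^sub>L 'a" where Z0: "clinear_op Z0" "\<And>y. Z0 y \<in> closure ?M"
    "\<And>y u. cinner (g (Q \<cdot> u)) y = cinner (Q \<cdot> u) (Z0 y)" by blast
  define Z where "Z = Bop Z0"
  have Z: "Z \<cdot> y \<in> closure ?M" "cinner (S \<cdot> u) y = cinner (Q \<cdot> u) (Z \<cdot> y)" for y u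
    using Z0(2)[of y] Z0(3)[of u y] unfolding g by (simp_all add: Z_def app.rep_eq[of "Bop Z0"] blin_Bop[OF Z0(1)])
  have "star S = Q * Z"
  proof (rule star_eqI)
    fix x y
    have "cinner (S \<cdot> x) y = cinner (Q \<cdot> x) (Z \<cdot> y)" by (rule Z(2))
    also have "\<dots> = cinner x ((Q * Z) \<cdot> y)" by (simp add: cinner_app_left[of Q] Q(1))
    finally show "cinner (S \<cdot> x) y = cinner x ((Q * Z) \<cdot> y)" .
  qed
  moreover have "Z * S = Q"
  proof (rule bop_eqI)
    fix x
    have "Z \<cdot> S \<cdot> x + (-1) *\<^sub>C (Q \<cdot> x) \<in> closure ?M"
    proof -
      have "Z \<cdot> S \<cdot> x \<in> closure ?M" "(-1) *\<^sub>C (Q \<cdot> x) \<in> closure ?M"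
        using csubspace_closure[OF M] Z(1)[of "S \<cdot> x"] subsetD[OF closure_subset[of ?M] rangeI[of "app Q" x]]
        unfolding csubspace_def by simp_all
      then show ?thesis using csubspace_closure[OF M] unfolding csubspace_def by simp
    qed
    then have "Z \<cdot> S \<cdot> x - Q \<cdot> x \<in> closure ?M"
      unfolding scaleC_minus_one diff_conv_add_uminus[symmetric] .
    then have "(norm (Z \<cdot> S \<cdot> x - Q \<cdot> x))\<^sup>2 \<le> 0 * norm (Z \<cdot> S \<cdot> x - Q \<cdot> x)"
    proof (rule closure_orthogonal_bound)
      fix v assume "v \<in> ?M"
      then obtain u where u: "v = Q \<cdot> u" by blast
      show "cmod (cinner v (Z \<cdot> S \<cdot> x - Q \<cdot> x)) \<le> 0 * norm v"
        unfolding u cinner_diff_right Z(2)[symmetric] inner by simp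
    qed
    then show "(Z * S) \<cdot> x = Q \<cdot> x" by simp
  qed
  ultimately show ?thesis using Q by metis
qed

section \<open>Fuglede's theorem\<close>

lemma power_mult_commuting:
  assumes "x * y = y * (x::'a::monoid_mult)" shows "(x * y) ^ k = x ^ k * y ^ k"
proof (induction k)
  case (Suc k)
  have "x ^ k * y = y * x ^ k" using assms by (rule power_commuting_commutes)
  have "(x * y) ^ Suc k = x * (y * x ^ k) * y ^ k" by (simp add: Suc mult.assoc)
  also have "\<dots> = x ^ Suc k * y ^ Suc k"
    using \<open>x ^ k * y = y * x ^ k\<close> by (simp add: mult.assoc flip: \<open>x ^ k * y = y * x ^ k\<close>)
  finally show ?case .
qed simp

lemma norm_one_plus_power_le:
  fixes c :: "'a::complex_hilbert bop"
  assumes "norm c \<le> r" shows "norm ((1 + c) ^ m) \<le> (1 + r) ^ m"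
proof -
  have "norm ((1 + c) ^ m) \<le> norm (1 + c) ^ m" by (rule norm_power_bop_le)
  also have "\<dots> \<le> (1 + r) ^ m"
    using norm_triangle_ineq[of 1 c] norm_one_bop_le[where 'a='a] assms by (intro power_mono) auto
  finally show ?thesis .
qed

lemma norm_one_minus_power_diff_le:
  fixes c :: "'a::complex_hilbert bop"
  assumes c: "norm c \<le> r" shows "norm (1 - (1 - c) ^ m) \<le> (1 + r) ^ m - 1"
proof (induction m)
  case (Suc m)
  have r: "0 \<le> r" using c norm_ge_zero order_trans by blast
  have "1 - (1 - c) ^ Suc m = (1 - (1 - c) ^ m) + c * (1 - c) ^ m" by (simp add: algebra_simps)
  then have "norm (1 - (1 - c) ^ Suc m) \<le> norm (1 - (1 - c) ^ m) + norm c * norm ((1 - c) ^ m)"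
    by (metis norm_triangle_le add_left_mono norm_mult_ineq)
  also have "\<dots> \<le> ((1 + r) ^ m - 1) + r * (1 + r) ^ m"
    using Suc c norm_one_plus_power_le[of "- c" r m] r by (intro add_mono mult_mono) auto
  finally show ?case by (simp add: algebra_simps)
qed simp

lemma sc_bounded_linear: "bounded_linear (\<lambda>z. sc z * (a :: 'a::complex_hilbert bop))"
  by (rule bounded_linear_intro[where K="norm a"])
    (auto simp: sc_simps norm_sc_mult algebra_simps scaleR_conv_of_real)

lemma has_derivative_one_plus_sc_power:
  fixes a :: "'a::complex_hilbert bop"
  shows "\<exists>G'. (\<forall>z. ((\<lambda>z. (1 + sc z * a) ^ k) has_derivative (\<lambda>h. sc h * G' z)) (at z)) \<and> G' 0 = real k *\<^sub>R a"
proof (induction k)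
  case 0
  then show ?case by (intro exI[of _ "\<lambda>_. 0"]) simp
next
  case (Suc k)
  then obtain G' where G': "\<And>z. ((\<lambda>z. (1 + sc z * a) ^ k) has_derivative (\<lambda>h. sc h * G' z)) (at z)"
    "G' 0 = real k *\<^sub>R a" by blast
  have 1: "((\<lambda>z. 1 + sc z * a) has_derivative (\<lambda>h. 0 + sc h * a)) (at z)" for z
    by (intro has_derivative_add has_derivative_const bounded_linear_imp_has_derivative sc_bounded_linear)
  have "((\<lambda>z. (1 + sc z * a) * (1 + sc z * a) ^ k) has_derivative
     (\<lambda>h. (1 + sc z * a) * (sc h * G' z) + (0 + sc h * a) * (1 + sc z * a) ^ k)) (at z)" for z
    by (rule has_derivative_mult[OF 1 G'(1)])
  moreover have "(1 + sc z * a) * (sc h * G' z) = sc h * ((1 + sc z * a) * G' z)" for z h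
    by (metis mult.assoc sc_commute)
  ultimately show ?case using G'(2)
    by (intro exI[of _ "\<lambda>z. (1 + sc z * a) * G' z + a * (1 + sc z * a) ^ k"])
      (simp add: algebra_simps sc_simps)
qed

text \<open>The matrix coefficients of the polynomial \<open>F\<close> below have derivative
  \<open>\<langle>(star N * T - T * star N) x, y\<rangle>\<close> at \<open>0\<close>. With \<open>a = z star N / m\<close> and
  \<open>b = star a\<close>, which commutes with \<open>T\<close>, the operator
  \<open>((1+a)(1-b))\<^sup>m T ((1+b)(1-a))\<^sup>m\<close> differs from \<open>F\<close> only by a factor \<open>(1-b\<^sup>2)\<^sup>m\<close>,
  and \<open>(1+a)(1-b)\<close> is unitary up to \<open>O(1/m\<^sup>2)\<close>. So \<open>F\<close> is bounded by nearly
  \<open>\<parallel>T\<parallel>\<close> on large circles, and Cauchy's estimate forces the derivative to vanish.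
  This is the exponential proof of Fuglede's theorem with each exponential \<open>e\<^sup>c\<close> replaced by
  \<open>(1 + c/m)\<^sup>m\<close>.\<close>

lemma fuglede_estimate:
  fixes N T :: "'a::complex_hilbert bop" and m :: nat
  assumes N: "star N * N = N * star N" and T: "N * T = T * N" and R: "0 < R" and m: "0 < m"
  defines "\<kappa> \<equiv> R * norm N"
  shows "R * cmod (cinner ((star N * T - T * star N) \<cdot> x) y)
    \<le> norm T * (exp (2 * \<kappa>\<^sup>2 / m) + exp (2 * \<kappa>) * (exp (\<kappa>\<^sup>2 / m) - 1)) * norm x * norm y"
proof -
  define n where "n = (1 / real m) *\<^sub>R star N"
  obtain G' where G': "\<And>z. ((\<lambda>z. (1 + sc z * n) ^ m) has_derivative (\<lambda>h. sc h * G' z)) (at z)"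
    "G' 0 = real m *\<^sub>R n" using has_derivative_one_plus_sc_power by metis
  obtain H' where H': "\<And>z. ((\<lambda>z. (1 + sc z * (- n)) ^ m) has_derivative (\<lambda>h. sc h * H' z)) (at z)"
    "H' 0 = real m *\<^sub>R (- n)" using has_derivative_one_plus_sc_power by metis
  define F where "F z = (1 + sc z * n) ^ m * T * (1 + sc z * (- n)) ^ m" for z
  define F' where "F' z = G' z * T * (1 + sc z * (- n)) ^ m + (1 + sc z * n) ^ m * T * H' z" for z
  have F'0: "F' 0 = star N * T - T * star N"
    using m by (simp add: F'_def G' H' sc_simps n_def)
  have derF: "(F has_derivative (\<lambda>h. sc h * F' z)) (at z)" for z
  proof -
    have "((\<lambda>z. ((1 + sc z * n) ^ m * T) * (1 + sc z * (- n)) ^ m) has_derivative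
      (\<lambda>h. ((1 + sc z * n) ^ m * T) * (sc h * H' z) + ((1 + sc z * n) ^ m * 0 + (sc h * G' z) * T) * (1 + sc z * (- n)) ^ m)) (at z)"
      by (intro has_derivative_mult G'(1) H'(1) has_derivative_const)
    moreover have "((1 + sc z * n) ^ m * T) * (sc h * H' z) = sc h * ((1 + sc z * n) ^ m * T * H' z)" for h
      by (metis mult.assoc sc_commute)
    ultimately show ?thesis by (simp add: F_def[abs_def] F'_def algebra_simps)
  qed
  define f where "f z = cinner (F z \<cdot> x) y" for z
  have bl: "bounded_linear (\<lambda>A. cinner (A \<cdot> x) y)"
    by (rule bounded_linear_compose[OF bounded_linear_cinner_left bounded_linear_app])
  have derf: "(f has_field_derivative cinner (F' z \<cdot> x) y) (at z)" for z
    using bounded_linear.has_derivative[OF bl derF[of z]]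
    by (simp add: f_def[abs_def] has_field_derivative_def cinner_scaleC_left mult_commute_abs)
  have bound: "norm (F z) \<le> norm T * (exp (2 * \<kappa>\<^sup>2 / m) + exp (2 * \<kappa>) * (exp (\<kappa>\<^sup>2 / m) - 1))"
    if z: "cmod z = R" for z
  proof -
    define a where "a = sc z * n"
    define b where "b = star a"
    define \<rho> where "\<rho> = \<kappa> / m"
    have b: "b = sc (cnj z) * ((1 / real m) *\<^sub>R N)" by (simp add: b_def a_def n_def sc_commute)
    have na: "norm a = \<rho>" using m z by (simp add: a_def n_def norm_sc_mult \<rho>_def \<kappa>_def)
    then have nb: "norm b = \<rho>" by (simp add: b_def)
    have \<rho>0: "0 \<le> \<rho>" using na norm_ge_zero by metis
    have NN: "star N \<cdot> N \<cdot> u = N \<cdot> star N \<cdot> u" for u using N by (metis app_simps(4))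
    have TN: "N \<cdot> T \<cdot> u = T \<cdot> N \<cdot> u" for u using T by (metis app_simps(4))
    have ab: "a * b = b * a"
      by (rule bop_eqI) (simp add: a_def b n_def NN scaleC_scaleC mult.commute)
    have bT: "b * T = T * b"
      by (rule bop_eqI) (simp add: b TN)
    define P where "P = (1 + a) * (1 - b)"
    define Q where "Q = (1 + b) * (1 - a)"
    have QP: "Q = star P" by (simp add: P_def Q_def b_def[symmetric] algebra_simps ab) (simp add: b_def)
    have "star P * P = (1 - a * a) * (1 - b * b)"
    proof -
      have h: "(1 + b) * (1 - a) = (1 - a) * (1 + b)" "(1 + b) * (1 + a) = (1 + a) * (1 + b)"
        by (simp_all add: distrib_left distrib_right left_diff_distrib right_diff_distrib ab)
      have "Q * P = ((1 + b) * (1 - a)) * (1 + a) * (1 - b)"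
        unfolding P_def Q_def by (simp only: mult.assoc)
      also have "\<dots> = (1 - a) * ((1 + b) * (1 + a)) * (1 - b)" unfolding h(1) by (simp only: mult.assoc)
      also have "\<dots> = ((1 - a) * (1 + a)) * ((1 + b) * (1 - b))" unfolding h(2) by (simp only: mult.assoc)
      also have "(1 - a) * (1 + a) = 1 - a * a" by (simp add: algebra_simps)
      also have "(1 + b) * (1 - b) = 1 - b * b" by (simp add: algebra_simps)
      finally show ?thesis unfolding QP .
    qed
    also have "norm \<dots> \<le> norm (1 - a * a) * norm (1 - b * b)" by (rule norm_mult_ineq)
    also have "\<dots> \<le> (1 + \<rho>\<^sup>2) * (1 + \<rho>\<^sup>2)"
    proof -
      have *: "norm (1 - c * c) \<le> 1 + \<rho>\<^sup>2" if "norm c = \<rho>" for c :: "'a bop"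
        using norm_triangle_ineq4[of 1 "c * c"] norm_one_bop_le[where 'a='a] norm_mult_ineq[of c c] that
        by (simp add: power2_eq_square)
      show ?thesis using \<rho>0 by (intro mult_mono * na nb) auto
    qed
    finally have nPP: "norm (star P * P) \<le> (1 + \<rho>\<^sup>2)\<^sup>2" by (simp add: power2_eq_square)
    have nP: "norm P \<le> 1 + \<rho>\<^sup>2"
    proof (rule norm_bop_bound)
      fix u
      have "(norm (P \<cdot> u))\<^sup>2 = cmod (cinner ((star P * P) \<cdot> u) u)"
        by (simp add: cinner_app_left cinner_self norm_power)
      also have "\<dots> \<le> norm ((star P * P) \<cdot> u) * norm u" by (rule norm_cinner_le)
      also have "\<dots> \<le> (1 + \<rho>\<^sup>2)\<^sup>2 * norm u * norm u"
        by (intro mult_right_mono order_trans[OF norm_app_le] nPP) auto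
      finally have "(norm (P \<cdot> u))\<^sup>2 \<le> ((1 + \<rho>\<^sup>2) * norm u)\<^sup>2" by (simp add: power2_eq_square mult_ac)
      then show "norm (P \<cdot> u) \<le> (1 + \<rho>\<^sup>2) * norm u" by (rule power2_le_imp_le) auto
    qed auto
    have nQ: "norm Q \<le> 1 + \<rho>\<^sup>2" using nP by (simp add: QP)
    have comm1: "(1 + a) * (1 - b) = (1 - b) * (1 + a)" "(1 + b) * (1 - a) = (1 - a) * (1 + b)"
      "(1 - b) * T = T * (1 - b)" "(1 - b) * (1 + b) = (1 + b) * (1 - b)"
      by (simp_all add: algebra_simps ab bT)
    have Pm: "P ^ m = (1 + a) ^ m * (1 - b) ^ m" unfolding P_def by (rule power_mult_commuting[OF comm1(1)])
    have Qm: "Q ^ m = (1 + b) ^ m * (1 - a) ^ m" unfolding Q_def by (rule power_mult_commuting[OF comm1(2)])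
    have Tm: "(1 - b) ^ m * T = T * (1 - b) ^ m" by (rule power_commuting_commutes[OF comm1(3)])
    have bm: "(1 - b * b) ^ m = (1 - b) ^ m * (1 + b) ^ m"
      unfolding power_mult_commuting[OF comm1(4), symmetric] by (simp add: algebra_simps)
    have eq: "P ^ m * T * Q ^ m = (1 + a) ^ m * T * (1 - b * b) ^ m * (1 - a) ^ m"
    proof -
      have "P ^ m * T * Q ^ m = (1 + a) ^ m * ((1 - b) ^ m * T) * ((1 + b) ^ m * (1 - a) ^ m)"
        unfolding Pm Qm by (simp only: mult.assoc)
      then show ?thesis unfolding Tm bm by (simp only: mult.assoc)
    qed
    have Fz: "F z = (1 + a) ^ m * T * (1 - a) ^ m" by (simp add: F_def a_def)
    have dec: "F z = P ^ m * T * Q ^ m + (1 + a) ^ m * T * (1 - (1 - b * b) ^ m) * (1 - a) ^ m"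
      unfolding eq Fz by (simp add: algebra_simps)
    have e1: "(1 + s) ^ m \<le> exp (m * s)" if "0 \<le> s" for s :: real
      using that by (simp add: exp_of_nat_mult power_mono)
    have m\<rho>: "m * \<rho> = \<kappa>" "m * \<rho>\<^sup>2 = \<kappa>\<^sup>2 / m" using m by (simp_all add: \<rho>_def power2_eq_square)
    have p1: "norm (P ^ m) \<le> exp (\<kappa>\<^sup>2 / m)" "norm (Q ^ m) \<le> exp (\<kappa>\<^sup>2 / m)"
      using e1[of "\<rho>\<^sup>2"] order_trans[OF norm_power_bop_le power_mono[OF nP norm_ge_zero]]
        order_trans[OF norm_power_bop_le power_mono[OF nQ norm_ge_zero]] m\<rho> by (auto intro: order_trans)
    have p2: "norm ((1 + a) ^ m) \<le> exp \<kappa>" "norm ((1 - a) ^ m) \<le> exp \<kappa>"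
      using e1[OF \<rho>0] norm_one_plus_power_le[of a \<rho> m] norm_one_plus_power_le[of "- a" \<rho> m] na m\<rho>
      by auto
    have "norm (b * b) \<le> \<rho>\<^sup>2" using norm_mult_ineq[of b b] nb by (simp add: power2_eq_square)
    then have p3: "norm (1 - (1 - b * b) ^ m) \<le> exp (\<kappa>\<^sup>2 / m) - 1"
      using norm_one_minus_power_diff_le[of "b * b" "\<rho>\<^sup>2" m] e1[of "\<rho>\<^sup>2"] m\<rho> by simp
    have nm3: "norm (A1 * A2 * A3) \<le> k1 * k2 * k3"
      if "norm A1 \<le> k1" "norm A2 \<le> k2" "norm A3 \<le> k3" for A1 A2 A3 :: "'a bop" and k1 k2 k3
    proof -
      have "norm (A1 * A2 * A3) \<le> norm A1 * norm A2 * norm A3"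
        by (meson mult_right_mono norm_ge_zero norm_mult_ineq order_trans)
      also have "\<dots> \<le> k1 * k2 * k3" using that
        by (intro mult_mono) (auto intro: order_trans[OF norm_ge_zero] mult_nonneg_nonneg)
      finally show ?thesis .
    qed
    have "norm (F z) \<le> norm (P ^ m * T * Q ^ m) + norm ((1 + a) ^ m * T * (1 - (1 - b * b) ^ m) * (1 - a) ^ m)"
      unfolding dec by (rule norm_triangle_ineq)
    also have "\<dots> \<le> exp (\<kappa>\<^sup>2 / m) * norm T * exp (\<kappa>\<^sup>2 / m) + (exp \<kappa> * norm T * (exp (\<kappa>\<^sup>2 / m) - 1)) * exp \<kappa>"
    proof (rule add_mono)
      show "norm (P ^ m * T * Q ^ m) \<le> exp (\<kappa>\<^sup>2 / m) * norm T * exp (\<kappa>\<^sup>2 / m)"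
        by (intro nm3 p1 order_refl)
      have "norm ((1 + a) ^ m * T * (1 - (1 - b * b) ^ m)) * norm ((1 - a) ^ m)
        \<le> (exp \<kappa> * norm T * (exp (\<kappa>\<^sup>2 / m) - 1)) * exp \<kappa>"
        by (intro mult_mono nm3 p2 p3 order_refl) auto
      then show "norm ((1 + a) ^ m * T * (1 - (1 - b * b) ^ m) * (1 - a) ^ m)
        \<le> (exp \<kappa> * norm T * (exp (\<kappa>\<^sup>2 / m) - 1)) * exp \<kappa>"
        by (rule order_trans[OF norm_mult_ineq])
    qed
    also have "\<dots> = norm T * (exp (2 * \<kappa>\<^sup>2 / m) + exp (2 * \<kappa>) * (exp (\<kappa>\<^sup>2 / m) - 1))"
    proof -
      have "exp (2 * \<kappa>\<^sup>2 / m) = exp (\<kappa>\<^sup>2 / m) * exp (\<kappa>\<^sup>2 / m)" "exp (2 * \<kappa>) = exp \<kappa> * exp \<kappa>"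
        by (simp_all flip: exp_add)
      then show ?thesis by (simp add: algebra_simps)
    qed
    finally show ?thesis .
  qed
  let ?B = "norm T * (exp (2 * \<kappa>\<^sup>2 / m) + exp (2 * \<kappa>) * (exp (\<kappa>\<^sup>2 / m) - 1))"
  have "f holomorphic_on A" for A
    using derf unfolding holomorphic_on_def field_differentiable_def
    by (meson has_field_derivative_at_within)
  moreover have "norm (f z) \<le> ?B * norm x * norm y" if "norm (0 - z) = R" for z
  proof -
    have "norm (f z) \<le> norm (F z \<cdot> x) * norm y" unfolding f_def by (rule norm_cinner_le)
    also have "\<dots> \<le> (norm (F z) * norm x) * norm y" by (intro mult_right_mono norm_app_le) auto
    also have "\<dots> \<le> ?B * norm x * norm y" using bound[of z] that by (intro mult_right_mono) auto
    finally show ?thesis .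
  qed
  ultimately have "norm ((deriv ^^ 1) f 0) \<le> fact 1 * (?B * norm x * norm y) / R ^ 1"
    using R by (intro Cauchy_inequality holomorphic_on_imp_continuous_on) auto
  moreover have "deriv f 0 = cinner ((star N * T - T * star N) \<cdot> x) y"
    using DERIV_imp_deriv[OF derf[of 0]] F'0 by simp
  ultimately show ?thesis using R by (simp add: field_simps)
qed

theorem fuglede:
  fixes N T :: "'a::complex_hilbert bop"
  assumes N: "star N * N = N * star N" and T: "N * T = T * N"
  shows "star N * T = T * star N"
proof -
  have "cinner ((star N * T - T * star N) \<cdot> x) y = 0" for x y
  proof (rule ccontr)
    let ?c = "cmod (cinner ((star N * T - T * star N) \<cdot> x) y)"
    assume "cinner ((star N * T - T * star N) \<cdot> x) y \<noteq> 0"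
    then have c: "?c > 0" by simp
    define R where "R = (norm T * norm x * norm y + 1) / ?c"
    have "0 < norm T * norm x * norm y + 1" by (smt (verit) mult_nonneg_nonneg norm_ge_zero)
    then have R: "R > 0" using c by (simp add: R_def)
    let ?\<kappa> = "R * norm N"
    have z: "(\<lambda>m. s / real (Suc m)) \<longlonglongrightarrow> 0" for s :: real
      by (intro LIMSEQ_Suc lim_const_over_n)
    have "(\<lambda>m. norm T * (exp (2 * ?\<kappa>\<^sup>2 / real (Suc m)) + exp (2 * ?\<kappa>) * (exp (?\<kappa>\<^sup>2 / real (Suc m)) - 1)) * norm x * norm y)
      \<longlonglongrightarrow> norm T * (exp 0 + exp (2 * ?\<kappa>) * (exp 0 - 1)) * norm x * norm y"
      by (intro tendsto_intros z)
    moreover have "R * ?c \<le> norm T * (exp (2 * ?\<kappa>\<^sup>2 / real (Suc m)) + exp (2 * ?\<kappa>) * (exp (?\<kappa>\<^sup>2 / real (Suc m)) - 1)) * norm x * norm y" for m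
      by (rule fuglede_estimate[OF N T R]) simp
    ultimately have "R * ?c \<le> norm T * (exp 0 + exp (2 * ?\<kappa>) * (exp 0 - 1)) * norm x * norm y"
      using LIMSEQ_le_const by blast
    then show False using c by (simp add: R_def)
  qed
  then have "star N * T - T * star N = 0" by (intro bop_ext_cinner) simp
  then show ?thesis by simp
qed

section \<open>Approximate spectral resolutions of a single operator\<close>

text \<open>Finitely supported positive operator-valued measures on \<open>\<Omega>\<close> whose moments converge to the
  powers of \<open>T\<close>; for a contraction on the circle they approximate the compressed spectral measure of
  a unitary dilation. Commutation with everything that commutes with \<open>T\<close> and \<open>star T\<close> is what allows
  the measures of different operators to be multiplied.\<close>

definition approx_resolution ::
    "complex set \<Rightarrow> 'a::complex_hilbert bop \<Rightarrow> (nat \<Rightarrow> nat) \<Rightarrow> (nat \<Rightarrow> nat \<Rightarrow> complex) \<Rightarrow> (nat \<Rightarrow> nat \<Rightarrow> 'a bop) \<Rightarrow> bool" where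
  "approx_resolution \<Omega> T m z E \<longleftrightarrow>
     (\<forall>R. \<forall>q<m R. z R q \<in> \<Omega> \<and> pos (E R q) \<and>
        (\<forall>Y. Y * T = T * Y \<longrightarrow> Y * star T = star T * Y \<longrightarrow> Y * E R q = E R q * Y)) \<and>
     (\<forall>R. (\<Sum>q<m R. E R q) = 1) \<and>
     (\<forall>k. (\<lambda>R. \<Sum>q<m R. sc (z R q ^ k) * E R q) \<longlonglongrightarrow> T ^ k)"

subsection \<open>Contractions: the Fejer kernel\<close>

definition geom :: "nat \<Rightarrow> 'a::complex_hilbert bop \<Rightarrow> 'a bop" where
  "geom r T = (\<Sum>a<r. T ^ a)"

text \<open>The sum over \<open>r < R\<close> of the Dirichlet kernels \<open>\<Sum>\<^bsub>|d|\<le>r\<^esub> T\<^sup>d\<close>, where \<open>T\<^sup>d\<close> means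
  \<open>(star T)\<^bsup>-d\<^esup>\<close> for \<open>d < 0\<close>. For a unitary \<open>T\<close> it equals \<open>star (geom R T) * geom R T\<close>.\<close>

definition fejer :: "nat \<Rightarrow> 'a::complex_hilbert bop \<Rightarrow> 'a bop" where
  "fejer R T = (\<Sum>r<R. geom (Suc r) T + star (T * geom r T))"

lemma geom_Suc: "geom (Suc r) T = 1 + T * geom r T"
  unfolding geom_def by (subst sum.lessThan_Suc_shift) (simp add: sum_distrib_left)

lemma posI: "star A = A \<Longrightarrow> (\<And>x. 0 \<le> Re (cinner (A \<cdot> x) x)) \<Longrightarrow> pos A"
  unfolding pos_def complex_is_Real_iff
  by (metis cinner_app_left cinner_commute cnj.sel(2) equal_neg_zero)

text \<open>With \<open>W = T * geom R T\<close>, the increment \<open>1 + W + star W\<close> of the kernel equals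
  \<open>star (1 + W) * (1 + W) - star W * W\<close>, where \<open>1 + W = geom (Suc R) T\<close>, and
  \<open>star W * W \<le> star (geom R T) * geom R T\<close> for a contraction \<open>T\<close>.\<close>

lemma pos_fejer:
  assumes T: "norm T \<le> 1" shows "pos (fejer R T)"
proof (rule posI)
  show "star (fejer R T) = fejer R T"
  proof -
    have "star (\<Sum>r<R. geom (Suc r) T + star (T * geom r T)) = (\<Sum>r<R. star (geom (Suc r) T + star (T * geom r T)))"
      by (rule bounded_linear.linear[OF bounded_linear_star, THEN linear_sum])
    also have "\<dots> = (\<Sum>r<R. geom (Suc r) T + star (T * geom r T))"
      by (rule sum.cong) (simp_all add: geom_Suc algebra_simps)
    finally show ?thesis by (simp add: fejer_def)
  qed
  fix x
  have "(norm (geom R T \<cdot> x))\<^sup>2 \<le> Re (cinner (fejer R T \<cdot> x) x)"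
  proof (induction R)
    case 0 then show ?case by (simp add: geom_def fejer_def)
  next
    case (Suc R)
    define W where "W = T * geom R T"
    define w where "w = W \<cdot> x"
    have "norm w \<le> norm T * norm (geom R T \<cdot> x)" by (simp add: w_def W_def norm_app_le)
    also have "\<dots> \<le> norm (geom R T \<cdot> x)" using T by (simp add: mult_left_le_one_le)
    finally have w: "(norm w)\<^sup>2 \<le> (norm (geom R T \<cdot> x))\<^sup>2" by (simp add: power_mono)
    have "cinner (star W \<cdot> x) x = cinner x w" by (simp add: w_def cinner_app_left)
    moreover have "Re (cinner w x) = Re (cinner x w)" by (metis cinner_commute cnj.sel(1))
    ultimately have "Re (cinner ((geom (Suc R) T + star W) \<cdot> x) x) = (norm (x + w))\<^sup>2 - (norm w)\<^sup>2"
      unfolding Re_cinner_self[symmetric] geom_Suc W_def[symmetric] app_simps(1) w_def[symmetric] cinner_simps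
      by simp
    moreover have "x + w = geom (Suc R) T \<cdot> x" by (simp add: geom_Suc w_def W_def)
    moreover have "fejer (Suc R) T = fejer R T + (geom (Suc R) T + star W)"
      by (simp add: fejer_def W_def)
    ultimately show ?case using Suc w by (simp only: app_simps(1)[of "fejer R T"] cinner_add_left[of "fejer R T \<cdot> x"] plus_complex.sel)
  qed
  then show "0 \<le> Re (cinner (fejer R T \<cdot> x) x)" by (rule order_trans[rotated]) simp
qed

definition unity_root :: "nat \<Rightarrow> nat \<Rightarrow> complex" where
  "unity_root m q = exp (2 * of_real pi * \<i> * of_nat q / of_nat m)"

lemma unity_root_power: "unity_root m q ^ j = unity_root m j ^ q"
  by (simp add: unity_root_def exp_of_nat_mult[symmetric] mult_ac)

lemma norm_unity_root [simp]: "cmod (unity_root m q) = 1"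
proof -
  have "unity_root m q = cis (2 * pi * q / m)" by (simp add: unity_root_def cis_conv_exp mult_ac)
  then show ?thesis by simp
qed

lemma sum_unity_root_power:
  assumes "0 < j" "j < m" shows "(\<Sum>q<m. unity_root m q ^ j) = 0"
proof -
  have "\<not> m dvd j" using assms by (auto dest: dvd_imp_le)
  then have 1: "unity_root m j \<noteq> 1"
    unfolding unity_root_def using complex_root_unity_eq_1[of m j] assms by auto
  have "unity_root m j ^ m = 1"
    unfolding unity_root_def using complex_root_unity[of m j] assms by auto
  then have "(\<Sum>q<m. unity_root m j ^ q) = 0" using geometric_sum[OF 1, of m] by simp
  then show ?thesis by (simp add: unity_root_power[of m _ j])
qed

lemma sum_unity_root_orthogonal:
  assumes "p < m" "a < m"
  shows "(\<Sum>q<m. unity_root m q ^ p * cnj (unity_root m q) ^ a) = (if p = a then of_nat m else 0)"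
proof -
  have u: "unity_root m q * cnj (unity_root m q) = 1" for q by (simp add: complex_norm_square[symmetric])
  consider "p = a" | "p < a" | "a < p" by linarith
  then show ?thesis
  proof cases
    case 1
    then show ?thesis using u by (simp flip: power_mult_distrib)
  next
    case 2
    have "unity_root m q ^ p * cnj (unity_root m q) ^ a = cnj (unity_root m q ^ (a - p))" for q
    proof -
      have "cnj (unity_root m q) ^ a = cnj (unity_root m q) ^ p * cnj (unity_root m q) ^ (a - p)"
        using 2 by (simp flip: power_add)
      then show ?thesis using u[of q] by (simp add: mult.assoc[symmetric] power_mult_distrib[symmetric])
    qed
    then have "(\<Sum>q<m. unity_root m q ^ p * cnj (unity_root m q) ^ a) = cnj (\<Sum>q<m. unity_root m q ^ (a - p))"
      by (simp only: cnj_sum)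
    then show ?thesis using 2 assms sum_unity_root_power[of "a - p" m] by simp
  next
    case 3
    have "unity_root m q ^ p * cnj (unity_root m q) ^ a = unity_root m q ^ (p - a)" for q
    proof -
      have "unity_root m q ^ p = unity_root m q ^ (p - a) * unity_root m q ^ a"
        using 3 by (simp flip: power_add)
      then show ?thesis using u[of q] by (simp add: mult.assoc power_mult_distrib[symmetric])
    qed
    then show ?thesis using 3 assms sum_unity_root_power[of "p - a" m] by simp
  qed
qed

lemma sc_of_real: "sc (of_real r) = (r *\<^sub>R 1 :: 'a::complex_hilbert bop)"
  by (rule sc_simps)

lemma sc_of_nat: "sc (of_nat k) = (real k *\<^sub>R 1 :: 'a::complex_hilbert bop)"
  using sc_of_real[of "real k"] by simp

lemma sc_power: "sc (a ^ k) = sc a ^ k"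
  by (induction k) (simp_all add: sc_simps)

lemma sc_mult_power: "(sc a * T) ^ k = sc (a ^ k) * T ^ k"
  by (simp add: sc_power power_mult_commuting sc_commute)

text \<open>The modulus \<open>2 R\<close> is large enough to prevent aliasing: the frequencies
  \<open>p - a\<close> and \<open>p + a + 1\<close> below lie strictly between \<open>-2 R\<close> and \<open>2 R\<close>.\<close>

lemma fejer_moment:
  fixes T :: "'a::complex_hilbert bop"
  assumes p: "p < R" defines "m \<equiv> 2 * R"
  shows "(\<Sum>q<m. sc (unity_root m q ^ p) * fejer R (sc (cnj (unity_root m q)) * T))
     = real (m * (R - p)) *\<^sub>R T ^ p"
proof -
  let ?z = "unity_root m"
  have A: "(\<Sum>q<m. sc (?z q ^ p) * geom (Suc r) (sc (cnj (?z q)) * T)) = (if p \<le> r then real m *\<^sub>R T ^ p else 0)"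
    if r: "r < R" for r
  proof -
    have "(\<Sum>q<m. sc (?z q ^ p) * geom (Suc r) (sc (cnj (?z q)) * T))
        = (\<Sum>q<m. \<Sum>a<Suc r. sc (?z q ^ p * cnj (?z q) ^ a) * T ^ a)"
      unfolding geom_def sum_distrib_left sc_mult_power by (simp add: sc_simps mult.assoc)
    also have "\<dots> = (\<Sum>a<Suc r. sc (\<Sum>q<m. ?z q ^ p * cnj (?z q) ^ a) * T ^ a)"
      unfolding sc_sum sum_distrib_right by (rule sum.swap)
    also have "\<dots> = (\<Sum>a<Suc r. if p = a then sc (of_nat m) * T ^ a else 0)"
    proof (rule sum.cong[OF refl])
      fix a assume "a \<in> {..<Suc r}"
      then have "a < m" "p < m" using r p by (auto simp: m_def)
      then show "sc (\<Sum>q<m. ?z q ^ p * cnj (?z q) ^ a) * T ^ a = (if p = a then sc (of_nat m) * T ^ a else 0)"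
        by (simp add: sum_unity_root_orthogonal sc_simps)
    qed
    also have "\<dots> = (if p \<le> r then real m *\<^sub>R T ^ p else 0)"
      by (auto simp: less_Suc_eq_le sc_of_nat)
    finally show ?thesis .
  qed
  have B: "(\<Sum>q<m. sc (?z q ^ p) * star ((sc (cnj (?z q)) * T) * geom r (sc (cnj (?z q)) * T))) = 0"
    if r: "r < R" for r
  proof -
    have "star ((sc c * T) * geom r (sc c * T)) = (\<Sum>a<r. sc (cnj c ^ Suc a) * star T ^ Suc a)" for c
    proof -
      have "star ((sc c * T) * geom r (sc c * T)) = star (\<Sum>a<r. (sc c * T) ^ Suc a)"
        by (simp add: geom_def sum_distrib_left)
      also have "\<dots> = (\<Sum>a<r. star ((sc c * T) ^ Suc a))"
        by (rule bounded_linear.linear[OF bounded_linear_star, THEN linear_sum])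
      also have "\<dots> = (\<Sum>a<r. sc (cnj c ^ Suc a) * star T ^ Suc a)"
        by (rule sum.cong[OF refl]) (simp only: star_power star_simps sc_mult_power sc_commute complex_cnj_power)
      finally show ?thesis .
    qed
    then have "(\<Sum>q<m. sc (?z q ^ p) * star ((sc (cnj (?z q)) * T) * geom r (sc (cnj (?z q)) * T)))
        = (\<Sum>q<m. \<Sum>a<r. sc (?z q ^ (p + Suc a)) * star T ^ Suc a)"
      by (simp only: sum_distrib_left power_add sc_simps(2) mult.assoc complex_cnj_cnj)
    also have "\<dots> = (\<Sum>a<r. sc (\<Sum>q<m. ?z q ^ (p + Suc a)) * star T ^ Suc a)"
      unfolding sc_sum sum_distrib_right by (rule sum.swap)
    also have "\<dots> = 0"
    proof (intro sum.neutral ballI)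
      fix a assume "a \<in> {..<r}"
      then have "(\<Sum>q<m. ?z q ^ (p + Suc a)) = 0"
        using r p by (intro sum_unity_root_power) (auto simp: m_def)
      then show "sc (\<Sum>q<m. ?z q ^ (p + Suc a)) * star T ^ Suc a = 0" by (simp only: sc_simps mult_zero_left)
    qed
    finally show ?thesis .
  qed
  have "(\<Sum>q<m. sc (?z q ^ p) * fejer R (sc (cnj (?z q)) * T))
      = (\<Sum>r<R. (\<Sum>q<m. sc (?z q ^ p) * geom (Suc r) (sc (cnj (?z q)) * T))
            + (\<Sum>q<m. sc (?z q ^ p) * star ((sc (cnj (?z q)) * T) * geom r (sc (cnj (?z q)) * T))))"
    unfolding fejer_def sum_distrib_left distrib_left sum.distrib[symmetric] by (rule sum.swap)
  also have "\<dots> = (\<Sum>r<R. if p \<le> r then real m *\<^sub>R T ^ p else 0)"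
    by (rule sum.cong) (simp_all only: A B add_0_right lessThan_iff)
  also have "\<dots> = (\<Sum>r\<in>{p..<R}. real m *\<^sub>R T ^ p)"
    by (rule sum.mono_neutral_cong_right) auto
  also have "\<dots> = real (m * (R - p)) *\<^sub>R T ^ p"
    by (simp add: sum_constant_scaleR mult.commute)
  finally show ?thesis .
qed

lemma commutes_sum: "(\<And>i. i \<in> F \<Longrightarrow> Y * f i = f i * Y) \<Longrightarrow> Y * (\<Sum>i\<in>F. f i) = (\<Sum>i\<in>F. f i) * (Y :: 'a::ring)"
  by (simp add: sum_distrib_left sum_distrib_right)

lemma commutes_mult: "Y * A = A * Y \<Longrightarrow> Y * B = B * Y \<Longrightarrow> Y * (A * B) = (A * B) * (Y :: 'a::monoid_mult)"
  by (metis mult.assoc)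

lemma commutes_geom: "Y * T = T * Y \<Longrightarrow> Y * geom r T = geom r T * Y"
  unfolding geom_def by (intro commutes_sum) (metis power_commuting_commutes)

lemma commutes_fejer:
  assumes Y: "Y * T = T * Y" "Y * star T = star T * Y" shows "Y * fejer R T = fejer R T * Y"
proof -
  have "star Y * T = T * star Y" using arg_cong[OF Y(2), of star] by simp
  then have "star Y * (T * geom r T) = (T * geom r T) * star Y" for r
    by (intro commutes_mult commutes_geom)
  then have "Y * star (T * geom r T) = star (T * geom r T) * Y" for r
    by (metis star_simps(1,2))
  then show ?thesis unfolding fejer_def
    by (intro commutes_sum) (simp only: distrib_left distrib_right commutes_geom[OF Y(1)])
qed

text \<open>The weight at a root of unity \<open>z\<close> is the normalised kernel of \<open>cnj z T\<close>; the moments are those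
  of the Cesaro means, \<open>(1 - p / R) T\<^sup>p\<close>.\<close>

theorem contraction_approx_resolution:
  fixes T :: "'a::complex_hilbert bop"
  assumes T: "norm T \<le> 1"
  shows "\<exists>m z E. approx_resolution (sphere 0 1) T m z E"
proof -
  define m where "m R = 2 * Suc R" for R
  define E where "E R q = (1 / (real (m R) * real (Suc R))) *\<^sub>R fejer (Suc R) (sc (cnj (unity_root (m R) q)) * T)" for R q
  have mom: "(\<Sum>q<m R. sc (unity_root (m R) q ^ p) * E R q) = (real (Suc R - p) / real (Suc R)) *\<^sub>R T ^ p"
    if "p < Suc R" for p R
  proof -
    have "(\<Sum>q<m R. sc (unity_root (m R) q ^ p) * E R q)
       = (1 / (real (m R) * real (Suc R))) *\<^sub>R (\<Sum>q<m R. sc (unity_root (m R) q ^ p) * fejer (Suc R) (sc (cnj (unity_root (m R) q)) * T))"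
      by (simp add: E_def scaleR_sum_right)
    also have "\<dots> = (1 / (real (m R) * real (Suc R)) * real (m R * (Suc R - p))) *\<^sub>R T ^ p"
      unfolding m_def fejer_moment[OF that] scaleR_scaleR ..
    also have "1 / (real (m R) * real (Suc R)) * real (m R * (Suc R - p)) = real (Suc R - p) / real (Suc R)"
    proof -
      have "1 / (a * b) * (a * d) = d / b" if "a \<noteq> 0" for a b d :: real using that by simp
      then show ?thesis unfolding of_nat_mult by (simp add: m_def)
    qed
    finally show ?thesis .
  qed
  have "approx_resolution (sphere 0 1) T m (\<lambda>R. unity_root (m R)) E"
    unfolding approx_resolution_def
  proof (intro conjI allI impI)
    fix R q
    show "unity_root (m R) q \<in> sphere 0 1" by simp
    have "norm (sc (cnj (unity_root (m R) q)) * T) \<le> 1" using T by (simp add: norm_sc_mult)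
    then show "pos (E R q)" unfolding E_def by (intro pos_scaleR pos_fejer) auto
    fix Y assume Y: "Y * T = T * Y" "Y * star T = star T * Y"
    have 1: "Y * (sc c * A) = (sc c * A) * Y" if "Y * A = A * Y" for c A
      using that by (intro commutes_mult sc_commute)
    have "Y * fejer (Suc R) (sc c * T) = fejer (Suc R) (sc c * T) * Y" for c
    proof (rule commutes_fejer[OF 1[OF Y(1)]])
      show "Y * star (sc c * T) = star (sc c * T) * Y"
        using 1[OF Y(2), of "cnj c"] by (simp only: star_simps sc_commute)
    qed
    then show "Y * E R q = E R q * Y" unfolding E_def by simp
  next
    fix R
    show "(\<Sum>q<m R. E R q) = 1" using mom[of 0 R] by (simp add: sc_simps)
  next
    fix k
    have "(\<lambda>R. real (Suc R - k) / real (Suc R)) \<longlonglongrightarrow> 1"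
    proof (rule Lim_transform_eventually)
      have "(\<lambda>R. 1 - real k / real (Suc R)) \<longlonglongrightarrow> 1 - 0"
        by (intro tendsto_intros LIMSEQ_Suc lim_const_over_n)
      then show "(\<lambda>R. 1 - real k / real (Suc R)) \<longlonglongrightarrow> 1" by simp
      show "\<forall>\<^sub>F R in sequentially. 1 - real k / real (Suc R) = real (Suc R - k) / real (Suc R)"
        using eventually_ge_at_top[of k] by eventually_elim (simp add: field_simps of_nat_diff)
    qed
    then have "(\<lambda>R. (real (Suc R - k) / real (Suc R)) *\<^sub>R T ^ k) \<longlonglongrightarrow> 1 *\<^sub>R T ^ k"
      by (intro tendsto_intros)
    moreover have "\<forall>\<^sub>F R in sequentially. (real (Suc R - k) / real (Suc R)) *\<^sub>R T ^ k
        = (\<Sum>q<m R. sc (unity_root (m R) q ^ k) * E R q)"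
      using eventually_ge_at_top[of k] by eventually_elim (simp only: mom less_Suc_eq_le)
    ultimately show "(\<lambda>R. \<Sum>q<m R. sc (unity_root (m R) q ^ k) * E R q) \<longlonglongrightarrow> T ^ k"
      using Lim_transform_eventually by fastforce
  qed
  then show ?thesis by blast
qed

subsection \<open>Self-adjoint contractions: the Bernstein kernel\<close>

text \<open>\<open>binom_op B C m q\<close> is \<open>(m choose q) B\<^sup>q C\<^bsup>m-q\<^esup>\<close> for commuting \<open>B\<close> and \<open>C\<close>; the
  recursion replaces the binomial theorem. Below, \<open>B = (1 + T) / 2\<close> and \<open>C = (1 - T) / 2\<close>, so the
  points \<open>(2 q - m) / m\<close> are the normalised sums of \<open>m\<close> independent signs of mean \<open>T\<close>.\<close>

primrec binom_op :: "'a::complex_hilbert bop \<Rightarrow> 'a bop \<Rightarrow> nat \<Rightarrow> nat \<Rightarrow> 'a bop" where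
  "binom_op B C 0 = (\<lambda>q. if q = 0 then 1 else 0)"
| "binom_op B C (Suc m) = (\<lambda>q. (case q of 0 \<Rightarrow> 0 | Suc r \<Rightarrow> B * binom_op B C m r) + C * binom_op B C m q)"

lemma binom_op_eq_0: "q > m \<Longrightarrow> binom_op B C m q = 0"
  by (induction m arbitrary: q) (auto split: nat.split)

lemma commutes_binom_op:
  assumes "Y * B = B * Y" "Y * C = C * Y" shows "Y * binom_op B C m q = binom_op B C m q * Y"
proof (induction m arbitrary: q)
  case (Suc m)
  have "Y * (B * binom_op B C m r) = (B * binom_op B C m r) * Y" "Y * (C * binom_op B C m r) = (C * binom_op B C m r) * Y" for r
    using Suc assms by (intro commutes_mult; blast)+
  then show ?case by (cases q) (simp_all only: binom_op.simps nat.case distrib_left distrib_right mult_zero_left mult_zero_right)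
qed simp

lemma pos_binom_op:
  assumes "pos B" "pos C" "B * C = C * B" shows "pos (binom_op B C m q)"
proof (induction m arbitrary: q)
  case (Suc m)
  have "B * binom_op B C m r = binom_op B C m r * B" "C * binom_op B C m r = binom_op B C m r * C" for r
    using assms(3) by (intro commutes_binom_op; simp)+
  then show ?case using Suc assms(1,2) by (auto intro!: pos_add pos_mult_commuting split: nat.split)
qed simp

lemma binom_op_sum_Suc:
  "(\<Sum>q<Suc (Suc m). sc (g q) * binom_op B C (Suc m) q)
    = B * (\<Sum>q<Suc m. sc (g (Suc q)) * binom_op B C m q) + C * (\<Sum>q<Suc m. sc (g q) * binom_op B C m q)"
proof -
  have c: "sc a * (D * F) = D * (sc a * F)" for a and D F :: "'a bop" by (metis mult.assoc sc_commute)
  have "(\<Sum>q<Suc (Suc m). sc (g q) * binom_op B C (Suc m) q)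
     = (\<Sum>q<Suc (Suc m). sc (g q) * (case q of 0 \<Rightarrow> 0 | Suc r \<Rightarrow> B * binom_op B C m r))
       + (\<Sum>q<Suc (Suc m). sc (g q) * (C * binom_op B C m q))"
    by (simp only: binom_op.simps distrib_left sum.distrib)
  also have "(\<Sum>q<Suc (Suc m). sc (g q) * (case q of 0 \<Rightarrow> 0 | Suc r \<Rightarrow> B * binom_op B C m r))
     = (\<Sum>q<Suc m. B * (sc (g (Suc q)) * binom_op B C m q))"
    by (subst sum.lessThan_Suc_shift) (simp del: sum.lessThan_Suc add: c)
  also have "(\<Sum>q<Suc (Suc m). sc (g q) * (C * binom_op B C m q)) = (\<Sum>q<Suc m. C * (sc (g q) * binom_op B C m q))"
    by (simp add: binom_op_eq_0 c)
  finally show ?thesis by (simp only: sum_distrib_left)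
qed

lemma norm_bop_le_form:
  assumes "0 \<le> c" "\<And>x y. cmod (cinner (A \<cdot> x) y) \<le> c * norm x * norm y" shows "norm A \<le> c"
proof (rule norm_bop_bound[OF assms(1)])
  fix x
  have "norm (A \<cdot> x) * norm (A \<cdot> x) \<le> (c * norm x) * norm (A \<cdot> x)"
    using assms(2)[of x "A \<cdot> x"] by (simp add: cinner_self norm_mult power2_eq_square)
  then show "norm (A \<cdot> x) \<le> c * norm x"
    using assms(1) by (cases "A \<cdot> x = 0") (simp_all add: mult_le_cancel_right)
qed

context
  fixes T :: "'a::complex_hilbert bop"
  assumes T: "star T = T" "norm T \<le> 1"
begin

private definition "Bp = (1/2) *\<^sub>R (1 + T)"
private definition "Bm = (1/2) *\<^sub>R (1 - T)"
private definition "step m q = binom_op Bp Bm m q"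
private definition "walk m q = 2 * real q - real m"

private lemma Re_form_le: "\<bar>Re (cinner (T \<cdot> x) x)\<bar> \<le> (norm x)\<^sup>2"
proof -
  have "\<bar>Re (cinner (T \<cdot> x) x)\<bar> \<le> norm (T \<cdot> x) * norm x"
    using abs_Re_le_cmod norm_cinner_le order_trans by blast
  also have "\<dots> \<le> (1 * norm x) * norm x"
    by (intro mult_right_mono order_trans[OF norm_app_le] T) auto
  finally show ?thesis by (simp add: power2_eq_square)
qed

private lemma pos_Bp: "pos Bp" and pos_Bm: "pos Bm"
proof -
  show "pos Bp"
  proof (rule posI)
    fix x show "0 \<le> Re (cinner (Bp \<cdot> x) x)"
      using Re_form_le[of x] by (simp add: Bp_def cinner_simps Re_cinner_self)
  qed (simp add: Bp_def T)
  show "pos Bm"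
  proof (rule posI)
    fix x show "0 \<le> Re (cinner (Bm \<cdot> x) x)"
      using Re_form_le[of x] by (simp add: Bm_def cinner_simps Re_cinner_self)
  qed (simp add: Bm_def T)
qed

private lemma B_sum: "Bp + Bm = 1" "Bp - Bm = T"
  by (simp_all add: Bp_def Bm_def flip: scaleR_add_right scaleR_diff_right)

private lemma step_moments:
  "(\<Sum>q<Suc m. step m q) = 1"
  "(\<Sum>q<Suc m. sc (of_real (walk m q)) * step m q) = real m *\<^sub>R T"
  "(\<Sum>q<Suc m. sc (of_real ((walk m q)\<^sup>2)) * step m q) = real (m * (m - 1)) *\<^sub>R (T * T) + real m *\<^sub>R 1"
proof -
  define M where "M m g = (\<Sum>q<Suc m. sc (of_real (g q)) * step m q)" for m and g :: "nat \<Rightarrow> real"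
  have Mrec: "M (Suc m) g = Bp * M m (\<lambda>q. g (Suc q)) + Bm * M m g" for m g
    unfolding M_def step_def by (rule binom_op_sum_Suc)
  have Madd: "M m (\<lambda>q. g q + h q) = M m g + M m h" and Mscale: "M m (\<lambda>q. r * g q) = r *\<^sub>R M m g" for m g h r
    by (simp_all add: M_def sc_of_real sc_simps distrib_right sum.distrib scaleR_sum_right scaleR_add_right mult.commute)
  have Bs: "Bp * A + Bm * A = A" "Bp * A - Bm * A = T * A" for A
    by (simp_all add: B_sum flip: distrib_right left_diff_distrib)
  have M1: "M m (\<lambda>q. 1) = 1" for m
  proof (induction m)
    case 0 then show ?case by (simp add: M_def step_def sc_simps)
  next
    case (Suc m) then show ?case by (simp add: Mrec Bs B_sum)
  qed
  have w: "walk (Suc m) (Suc q) = walk m q + 1" "walk (Suc m) q = walk m q + (-1)" for m q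
    by (simp_all add: walk_def)
  have c1: "M m (\<lambda>q. r) = r *\<^sub>R 1" for m r using Mscale[of m r "\<lambda>_. 1"] by (simp add: M1)
  have Mw: "M m (walk m) = real m *\<^sub>R T" for m
  proof (induction m)
    case 0 then show ?case by (simp add: M_def step_def sc_simps walk_def)
  next
    case (Suc m)
    have "M (Suc m) (walk (Suc m)) = Bp * (M m (walk m) + 1) + Bm * (M m (walk m) + (-1) *\<^sub>R 1)"
      unfolding Mrec w(1) unfolding w(2) Madd c1 by simp
    also have "\<dots> = (Bp * M m (walk m) + Bm * M m (walk m)) + (Bp - Bm)" by (simp add: algebra_simps)
    also have "\<dots> = real m *\<^sub>R T + T" by (simp only: Bs B_sum Suc)
    finally show ?case by (simp add: algebra_simps)
  qed
  have w2: "(walk (Suc m) (Suc q))\<^sup>2 = (walk m q)\<^sup>2 + (2 * walk m q + 1)"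
    "(walk (Suc m) q)\<^sup>2 = (walk m q)\<^sup>2 + ((-2) * walk m q + 1)" for m q
    by (simp_all add: walk_def power2_eq_square algebra_simps)
  have Mw2: "M m (\<lambda>q. (walk m q)\<^sup>2) = real (m * (m - 1)) *\<^sub>R (T * T) + real m *\<^sub>R 1" for m
  proof (induction m)
    case 0 then show ?case by (simp add: M_def step_def sc_simps walk_def)
  next
    case (Suc m)
    let ?S = "M m (\<lambda>q. (walk m q)\<^sup>2)"
    have "M (Suc m) (\<lambda>q. (walk (Suc m) q)\<^sup>2)
       = Bp * (?S + (2 *\<^sub>R (real m *\<^sub>R T) + 1)) + Bm * (?S + ((-2) *\<^sub>R (real m *\<^sub>R T) + 1))"
      unfolding Mrec w2(1) unfolding w2(2) Madd Mscale Mw M1 ..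
    also have "\<dots> = (Bp * ?S + Bm * ?S) + (2 * real m) *\<^sub>R (Bp * T - Bm * T) + (Bp + Bm)"
      by (simp add: algebra_simps)
    also have "\<dots> = ?S + (2 * real m) *\<^sub>R (T * T) + 1" by (simp add: Bs B_sum)
    also have "\<dots> = (real (m * (m - 1)) + 2 * real m) *\<^sub>R (T * T) + (real m + 1) *\<^sub>R 1"
      unfolding Suc by (simp only: scaleR_add_left scaleR_one add_ac)
    also have "real (m * (m - 1)) + 2 * real m = real (Suc m * (Suc m - 1))"
      by (cases m) (simp_all add: algebra_simps)
    finally show ?case by simp
  qed
  show "(\<Sum>q<Suc m. step m q) = 1" using M1[of m] by (simp add: M_def sc_simps)
  show "(\<Sum>q<Suc m. sc (of_real (walk m q)) * step m q) = real m *\<^sub>R T" using Mw[of m] by (simp add: M_def)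
  show "(\<Sum>q<Suc m. sc (of_real ((walk m q)\<^sup>2)) * step m q) = real (m * (m - 1)) *\<^sub>R (T * T) + real m *\<^sub>R 1"
    using Mw2[of m] by (simp add: M_def)
qed


text \<open>Each weight \<open>E\<close> commutes with \<open>T\<close>, so passing from the moment of order \<open>k\<close> to that of order
  \<open>k + 1\<close> costs \<open>\<Sum> z\<^sup>k E (z - T)\<close>. By the Cauchy--Schwarz inequality its norm is at most the
  square root of the variance \<open>(1 - T\<^sup>2) / m\<close>.\<close>

theorem selfadjoint_approx_resolution:
  "\<exists>m z E. approx_resolution (complex_of_real ` {-1..1}) T m z E"
proof -
  define \<zeta> where "\<zeta> R q = walk (Suc R) q / real (Suc R)" for R q
  define E where "E R q = step (Suc R) q" for R q
  define M where "M R k = (\<Sum>q<Suc (Suc R). (\<zeta> R q ^ k) *\<^sub>R E R q)" for R k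
  have comm: "Y * E R q = E R q * Y" if "Y * T = T * Y" for Y R q
    unfolding E_def step_def using that
    by (intro commutes_binom_op) (simp_all add: Bp_def Bm_def algebra_simps)
  have posE: "pos (E R q)" for R q
    unfolding E_def step_def
    by (intro pos_binom_op pos_Bp pos_Bm) (simp add: Bp_def Bm_def algebra_simps)
  have M0: "M R 0 = 1" for R using step_moments(1)[of "Suc R"] by (simp add: M_def E_def)
  have M1: "M R 1 = T" for R
  proof -
    have "M R 1 = (1 / real (Suc R)) *\<^sub>R (\<Sum>q<Suc (Suc R). sc (of_real (walk (Suc R) q)) * step (Suc R) q)"
      by (simp only: M_def E_def \<zeta>_def scaleR_sum_right) (simp add: sc_of_real del: sum.lessThan_Suc)
    then show ?thesis unfolding step_moments by simp
  qed
  have M2: "M R 2 = T * T + (1 / real (Suc R)) *\<^sub>R (1 - T * T)" for R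
  proof -
    have "M R 2 = (1 / (real (Suc R))\<^sup>2) *\<^sub>R (\<Sum>q<Suc (Suc R). sc (of_real ((walk (Suc R) q)\<^sup>2)) * step (Suc R) q)"
      by (simp only: M_def E_def \<zeta>_def scaleR_sum_right) (simp add: sc_of_real power_divide del: sum.lessThan_Suc of_real_power)
    also have "\<dots> = (real (Suc R * R) / (real (Suc R))\<^sup>2) *\<^sub>R (T * T) + (real (Suc R) / (real (Suc R))\<^sup>2) *\<^sub>R 1"
      unfolding step_moments by (simp add: scaleR_add_right)
    also have "real (Suc R * R) / (real (Suc R))\<^sup>2 = 1 - 1 / real (Suc R)"
    proof -
      have *: "a * (a - 1) / a\<^sup>2 = 1 - 1 / a" if "a \<noteq> 0" for a :: real
        using that by (simp add: power2_eq_square field_simps)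
      have eq: "real (Suc R * R) = real (Suc R) * (real (Suc R) - 1)" by (simp add: algebra_simps)
      show ?thesis unfolding eq by (rule *) simp
    qed
    also have "real (Suc R) / (real (Suc R))\<^sup>2 = 1 / real (Suc R)" by (simp add: power2_eq_square)
    finally show ?thesis by (simp add: algebra_simps)
  qed
  have \<zeta>1: "\<bar>\<zeta> R q\<bar> \<le> 1" if "q < Suc (Suc R)" for R q
    using that by (simp add: \<zeta>_def walk_def abs_le_iff field_simps)
  define D where "D R q = \<zeta> R q *\<^sub>R 1 - T" for R q
  have DE: "D R q * E R q * D R q = (\<zeta> R q)\<^sup>2 *\<^sub>R E R q - (2 * \<zeta> R q) *\<^sub>R (T * E R q) + T * T * E R q" for R q
  proof -
    have "D R q * E R q * D R q = D R q * D R q * E R q"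
      using comm[of "D R q" R q] by (simp add: D_def mult.assoc algebra_simps)
    also have "\<dots> = (\<zeta> R q)\<^sup>2 *\<^sub>R E R q - (2 * \<zeta> R q) *\<^sub>R (T * E R q) + T * T * E R q"
    proof -
      have "(2 * \<zeta> R q) *\<^sub>R (T * E R q) = \<zeta> R q *\<^sub>R (T * E R q) + \<zeta> R q *\<^sub>R (T * E R q)"
        by (simp only: mult_2 scaleR_add_left)
      then show ?thesis by (simp add: D_def algebra_simps power2_eq_square)
    qed
    finally show ?thesis .
  qed
  (* The variance of the points around T, for the weights E. *)
  have var: "(\<Sum>q<Suc (Suc R). D R q * E R q * D R q) = (1 / real (Suc R)) *\<^sub>R (1 - T * T)" for R
  proof -
    have "(\<Sum>q<Suc (Suc R). D R q * E R q * D R q) = M R 2 - 2 *\<^sub>R (T * M R 1) + T * T * M R 0"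
      unfolding DE M_def sum.distrib sum_subtractf sum_distrib_left scaleR_sum_right by simp
    then show ?thesis unfolding M0 M1 M2 by (simp add: scaleR_2 del: sum.lessThan_Suc)
  qed
  have S: "norm (\<Sum>q<Suc (Suc R). (\<zeta> R q ^ k) *\<^sub>R (E R q * D R q)) \<le> 1 / sqrt (Suc R)" for R k
  proof (rule norm_bop_le_form)
    fix x y
    define u where "u q = D R q \<cdot> x" for q
    have starD: "star (D R q) = D R q" for q by (simp add: D_def T)
    have e0: "0 \<le> Re (cinner (E R q \<cdot> v) v)" for q v using posE[of R q] by (simp add: pos_def)
    have e1: "(\<Sum>q<Suc (Suc R). Re (cinner (E R q \<cdot> y) y)) = (norm y)\<^sup>2"
    proof -
      have "(\<Sum>q<Suc (Suc R). cinner (E R q \<cdot> y) y) = cinner (M R 0 \<cdot> y) y"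
        unfolding M_def app_sum cinner_sum_left by simp
      then show ?thesis using Re_cinner_self[of y] by (simp add: M0 flip: Re_sum del: sum.lessThan_Suc)
    qed
    have e2: "(\<Sum>q<Suc (Suc R). Re (cinner (E R q \<cdot> u q) (u q))) \<le> (norm x)\<^sup>2 / Suc R"
    proof -
      have "(\<Sum>q<Suc (Suc R). cinner (E R q \<cdot> u q) (u q)) = cinner ((\<Sum>q<Suc (Suc R). D R q * E R q * D R q) \<cdot> x) x"
        unfolding app_sum cinner_sum_left u_def
        by (rule sum.cong) (simp_all add: cinner_app_left[of "D R _"] starD)
      also have "\<dots> = of_real (1 / Suc R) * (cinner x x - cinner (T \<cdot> x) (T \<cdot> x))"
        unfolding var by (simp add: cinner_simps cinner_app_left[of T "T \<cdot> x"] T del: of_real_divide)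
      finally have "(\<Sum>q<Suc (Suc R). Re (cinner (E R q \<cdot> u q) (u q))) = (1 / Suc R) * ((norm x)\<^sup>2 - (norm (T \<cdot> x))\<^sup>2)"
        by (simp add: cinner_self flip: Re_sum of_real_power of_real_diff of_real_mult del: sum.lessThan_Suc of_real_divide)
      also have "\<dots> \<le> (1 / Suc R) * (norm x)\<^sup>2" by (intro mult_left_mono) auto
      finally show ?thesis by simp
    qed
    have "cmod (cinner ((\<Sum>q<Suc (Suc R). (\<zeta> R q ^ k) *\<^sub>R (E R q * D R q)) \<cdot> x) y)
      = cmod (\<Sum>q<Suc (Suc R). of_real (\<zeta> R q ^ k) * cinner (E R q \<cdot> u q) y)"
      unfolding app_sum cinner_sum_left by (simp add: cinner_scaleR_left u_def)
    also have "\<dots> \<le> (\<Sum>q<Suc (Suc R). \<bar>sqrt (Re (cinner (E R q \<cdot> u q) (u q)))\<bar> * \<bar>sqrt (Re (cinner (E R q \<cdot> y) y))\<bar>)"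
    proof (rule sum_norm_le)
      fix q assume "q \<in> {..<Suc (Suc R)}"
      then have "\<bar>\<zeta> R q ^ k\<bar> \<le> 1" using \<zeta>1[of q R] by (simp add: power_abs power_le_one)
      then have "cmod (of_real (\<zeta> R q ^ k) * cinner (E R q \<cdot> u q) y) \<le> cmod (cinner (E R q \<cdot> u q) y)"
        by (simp add: norm_mult mult_left_le_one_le norm_power power_abs)
      also have "\<dots> \<le> sqrt (Re (cinner (E R q \<cdot> u q) (u q)) * Re (cinner (E R q \<cdot> y) y))"
        by (rule real_le_rsqrt) (rule pos_cauchy_schwarz[OF posE])
      finally show "cmod (of_real (\<zeta> R q ^ k) * cinner (E R q \<cdot> u q) y)
        \<le> \<bar>sqrt (Re (cinner (E R q \<cdot> u q) (u q)))\<bar> * \<bar>sqrt (Re (cinner (E R q \<cdot> y) y))\<bar>"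
        by (simp add: real_sqrt_mult e0)
    qed
    also have "\<dots> \<le> L2_set (\<lambda>q. sqrt (Re (cinner (E R q \<cdot> u q) (u q)))) {..<Suc (Suc R)}
        * L2_set (\<lambda>q. sqrt (Re (cinner (E R q \<cdot> y) y))) {..<Suc (Suc R)}"
      by (rule L2_set_mult_ineq)
    also have "\<dots> = sqrt (\<Sum>q<Suc (Suc R). Re (cinner (E R q \<cdot> u q) (u q))) * norm y"
      unfolding L2_set_def by (simp only: real_sqrt_pow2[OF e0] e1 real_sqrt_abs abs_norm_cancel)
    also have "\<dots> \<le> sqrt ((norm x)\<^sup>2 / Suc R) * norm y"
      using e2 by (intro mult_right_mono real_sqrt_le_mono) auto
    finally show "cmod (cinner ((\<Sum>q<Suc (Suc R). (\<zeta> R q ^ k) *\<^sub>R (E R q * D R q)) \<cdot> x) y)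
      \<le> 1 / sqrt (Suc R) * norm x * norm y"
      by (simp add: real_sqrt_divide)
  qed simp
  have rec: "M R (Suc k) = M R k * T + (\<Sum>q<Suc (Suc R). (\<zeta> R q ^ k) *\<^sub>R (E R q * D R q))" for R k
    unfolding M_def sum_distrib_right sum.distrib[symmetric]
    by (rule sum.cong) (simp_all add: D_def algebra_simps)
  have bd: "norm (M R k - T ^ k) \<le> real k * (1 / sqrt (Suc R))" for R k
  proof (induction k)
    case (Suc k)
    have "M R (Suc k) - T ^ Suc k = (M R k - T ^ k) * T + (\<Sum>q<Suc (Suc R). (\<zeta> R q ^ k) *\<^sub>R (E R q * D R q))"
      unfolding rec power_Suc2 by (simp add: algebra_simps)
    also have "norm \<dots> \<le> norm ((M R k - T ^ k) * T) + 1 / sqrt (Suc R)"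
      by (rule order_trans[OF norm_triangle_ineq add_left_mono[OF S]])
    also have "norm ((M R k - T ^ k) * T) \<le> norm (M R k - T ^ k) * 1"
      by (rule order_trans[OF norm_mult_ineq]) (intro mult_left_mono T(2) norm_ge_zero)
    finally show ?case using Suc by (simp add: algebra_simps add_divide_distrib)
  qed (simp add: M0)
  have "approx_resolution (complex_of_real ` {-1..1}) T (\<lambda>R. Suc (Suc R)) (\<lambda>R q. of_real (\<zeta> R q)) E"
    unfolding approx_resolution_def
  proof (intro conjI allI impI)
    fix R q assume "q < Suc (Suc R)"
    then show "complex_of_real (\<zeta> R q) \<in> complex_of_real ` {-1..1}"
      using \<zeta>1[of q R] by (intro imageI) (simp add: abs_le_iff)
  next
    fix R show "(\<Sum>q<Suc (Suc R). E R q) = 1" using M0[of R] by (simp add: M_def)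
  next
    fix k
    have "(\<lambda>R. M R k - T ^ k) \<longlonglongrightarrow> 0"
    proof (rule Lim_null_comparison)
      show "\<forall>\<^sub>F R in sequentially. norm (M R k - T ^ k) \<le> real k * (1 / sqrt (Suc R))" using bd by simp
      have "(\<lambda>R. real k * sqrt (1 / real (Suc R))) \<longlonglongrightarrow> real k * sqrt 0"
        by (intro tendsto_intros LIMSEQ_Suc lim_const_over_n)
      then show "(\<lambda>R. real k * (1 / sqrt (real (Suc R)))) \<longlonglongrightarrow> 0" by (simp add: real_sqrt_divide)
    qed
    then have "(\<lambda>R. M R k) \<longlonglongrightarrow> T ^ k" by (simp add: LIM_zero_iff)
    then show "(\<lambda>R. \<Sum>q<Suc (Suc R). sc (complex_of_real (\<zeta> R q) ^ k) * E R q) \<longlonglongrightarrow> T ^ k"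
      unfolding M_def of_real_power[symmetric] sc_of_real by simp
  qed (use posE comm in auto)
  then show ?thesis by blast
qed

end

section \<open>Joint resolutions of commuting tuples\<close>

lemma prod_list_commute_insert:
  fixes f :: "nat \<Rightarrow> 'a::monoid_mult"
  assumes "\<And>i j. i \<in> S \<Longrightarrow> j \<in> S \<Longrightarrow> f i * f j = f j * f i" "set L \<subseteq> S" "distinct L" "j \<in> set L"
  shows "f j * prod_list (map (\<lambda>l. f l ^ c l) L) = prod_list (map (\<lambda>l. f l ^ (c l + (if l = j then 1 else 0))) L)"
  using assms(2-)
proof (induction L)
  case (Cons a L)
  show ?case
  proof (cases "a = j")
    case True
    then have eq: "map (\<lambda>l. f l ^ (c l + (if l = j then 1 else 0))) L = map (\<lambda>l. f l ^ c l) L"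
      using Cons.prems by auto
    show ?thesis unfolding list.map prod_list.Cons eq using True by (simp add: mult.assoc)
  next
    case False
    have "f j * f a = f a * f j" using Cons.prems by (intro assms(1)) auto
    then have "f j * f a ^ c a = f a ^ c a * f j" by (metis power_commuting_commutes)
    then show ?thesis using Cons False by (simp add: mult.assoc[symmetric]) (simp add: mult.assoc)
  qed
qed simp

lemma prod_list_word_eq_powers:
  fixes f :: "nat \<Rightarrow> 'a::monoid_mult"
  assumes comm: "\<And>i j. i \<in> {1..n} \<Longrightarrow> j \<in> {1..n} \<Longrightarrow> f i * f j = f j * f i" and "set js \<subseteq> {1..n}"
  shows "prod_list (map f js) = prod_list (map (\<lambda>l. f l ^ count_list js l) [1..<Suc n])"
  using assms(2)
proof (induction js)
  case Nil
  have "prod_list (map (\<lambda>l. 1 :: 'a) L) = 1" for L :: "nat list" by (induction L) auto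
  then show ?case by simp
next
  case (Cons j js)
  have "prod_list (map f (j # js)) = f j * prod_list (map (\<lambda>l. f l ^ count_list js l) [1..<Suc n])"
    using Cons by simp
  also have "\<dots> = prod_list (map (\<lambda>l. f l ^ (count_list js l + (if l = j then 1 else 0))) [1..<Suc n])"
    using Cons.prems by (intro prod_list_commute_insert[where S="{1..n}"] comm) auto
  also have "\<dots> = prod_list (map (\<lambda>l. f l ^ count_list (j # js) l) [1..<Suc n])"
    by (intro arg_cong[of _ _ prod_list] map_cong) auto
  finally show ?case .
qed

lemma sum_PiE_prod_list:
  fixes F :: "nat \<Rightarrow> nat \<Rightarrow> 'a::{ring, monoid_mult}"
  shows "(\<Sum>q\<in>PiE {1..n} (\<lambda>l. {..<m l}). prod_list (map (\<lambda>l. F l (q l)) [1..<Suc n]))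
    = prod_list (map (\<lambda>l. \<Sum>q<m l. F l q) [1..<Suc n])"
proof (induction n)
  case 0 then show ?case by simp
next
  case (Suc n)
  have ins: "{1..Suc n} = insert (Suc n) {1..n}" by auto
  let ?P = "PiE {1..n} (\<lambda>l. {..<m l})"
  have ni: "Suc n \<notin> {1..n}" by simp
  have "(\<Sum>q\<in>PiE {1..Suc n} (\<lambda>l. {..<m l}). prod_list (map (\<lambda>l. F l (q l)) [1..<Suc (Suc n)]))
      = (\<Sum>(y, g)\<in>{..<m (Suc n)} \<times> ?P. prod_list (map (\<lambda>l. F l ((g(Suc n := y)) l)) [1..<Suc (Suc n)]))"
    unfolding ins PiE_insert_eq
    by (subst sum.reindex[OF inj_combinator[OF ni]]) (rule sum.cong, auto)
  also have "\<dots> = (\<Sum>(y, g)\<in>{..<m (Suc n)} \<times> ?P. prod_list (map (\<lambda>l. F l (g l)) [1..<Suc n]) * F (Suc n) y)"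
  proof (rule sum.cong[OF refl], clarify)
    fix y g
    have eq: "map (\<lambda>l. F l ((g(Suc n := y)) l)) [1..<Suc n] = map (\<lambda>l. F l (g l)) [1..<Suc n]" by simp
    have split: "[1..<Suc (Suc n)] = [1..<Suc n] @ [Suc n]" by simp
    show "prod_list (map (\<lambda>l. F l ((g(Suc n := y)) l)) [1..<Suc (Suc n)])
      = prod_list (map (\<lambda>l. F l (g l)) [1..<Suc n]) * F (Suc n) y"
      unfolding split map_append prod_list.append eq by simp
  qed
  also have "\<dots> = (\<Sum>y<m (Suc n). \<Sum>g\<in>?P. prod_list (map (\<lambda>l. F l (g l)) [1..<Suc n]) * F (Suc n) y)"
    by (simp add: sum.cartesian_product)
  also have "\<dots> = (\<Sum>g\<in>?P. prod_list (map (\<lambda>l. F l (g l)) [1..<Suc n])) * (\<Sum>y<m (Suc n). F (Suc n) y)"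
    by (simp add: sum_distrib_left sum_distrib_right sum.swap[of _ ?P])
  also have "\<dots> = prod_list (map (\<lambda>l. \<Sum>q<m l. F l q) [1..<Suc (Suc n)])"
    unfolding Suc by simp
  finally show ?case .
qed

lemma tendsto_prod_list:
  fixes f :: "nat \<Rightarrow> 'b \<Rightarrow> 'a::{real_normed_algebra, monoid_mult}"
  assumes "\<And>l. l \<in> set L \<Longrightarrow> (f l \<longlongrightarrow> g l) F"
  shows "((\<lambda>x. prod_list (map (\<lambda>l. f l x) L)) \<longlongrightarrow> prod_list (map g L)) F"
  using assms by (induction L) (auto intro!: tendsto_mult)

lemma prod_list_sc_mult:
  "prod_list (map (\<lambda>l. sc (a l) * A l) L) = sc (prod_list (map a L)) * prod_list (map A L)"
proof (induction L)
  case (Cons l L)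
  have "sc (a l) * A l * (sc c * B) = sc (a l) * sc c * (A l * B)" for c and B
    by (metis mult.assoc sc_commute)
  then show ?case using Cons by (simp add: sc_simps)
qed (simp add: sc_simps)

lemma commutes_prod_list:
  "(\<And>l. l \<in> set L \<Longrightarrow> Y * A l = A l * Y) \<Longrightarrow> Y * prod_list (map A L) = prod_list (map A L) * (Y :: 'a::monoid_mult)"
proof (induction L)
  case (Cons l L) then show ?case by (simp only: list.map prod_list.Cons) (intro commutes_mult; simp)
qed simp

lemma pos_prod_list:
  assumes "\<And>l. l \<in> set L \<Longrightarrow> pos (A l)" "\<And>l k. l \<in> set L \<Longrightarrow> k \<in> set L \<Longrightarrow> A l * A k = A k * A l"
  shows "pos (prod_list (map A L))"
  using assms
proof (induction L)
  case (Cons l L)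
  have "A l * prod_list (map A L) = prod_list (map A L) * A l"
    using Cons.prems(2) by (intro commutes_prod_list) auto
  then show ?case using Cons by (auto intro!: pos_mult_commuting)
qed simp

text \<open>Moments are indexed by words rather than by exponents, because a dilation is specified by the
  compressions of arbitrary products.\<close>

definition joint_resolution ::
    "complex set \<Rightarrow> nat \<Rightarrow> (nat \<Rightarrow> 'a::complex_hilbert bop) \<Rightarrow> (nat \<Rightarrow> (nat \<Rightarrow> nat) set) \<Rightarrow>
      (nat \<Rightarrow> (nat \<Rightarrow> nat) \<Rightarrow> nat \<Rightarrow> complex) \<Rightarrow> (nat \<Rightarrow> (nat \<Rightarrow> nat) \<Rightarrow> 'a bop) \<Rightarrow> bool" where
  "joint_resolution \<Omega> n T Q \<zeta> E \<longleftrightarrow>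
     (\<forall>R. finite (Q R) \<and> (\<forall>q\<in>Q R. (\<forall>l\<in>{1..n}. \<zeta> R q l \<in> \<Omega>) \<and> pos (E R q)) \<and> (\<Sum>q\<in>Q R. E R q) = 1) \<and>
     (\<forall>js. set js \<subseteq> {1..n} \<longrightarrow>
        (\<lambda>R. \<Sum>q\<in>Q R. sc (prod_list (map (\<zeta> R q) js)) * E R q) \<longlonglongrightarrow> prod_list (map T js))"

text \<open>The weights are the products of the weights of the single operators over the grid of all
  tuples of points. As each factor lies in the bicommutant of \<open>T\<^sub>l\<close> and \<open>star T\<^sub>l\<close>, the factors
  commute and their product is positive.\<close>

theorem doubly_commuting_joint_resolution:
  fixes T :: "nat \<Rightarrow> 'a::complex_hilbert bop"
  assumes single: "\<And>l. l \<in> {1..n} \<Longrightarrow> \<exists>m z E. approx_resolution \<Omega> (T l) m z E"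
    and comm: "\<And>i j. i \<in> {1..n} \<Longrightarrow> j \<in> {1..n} \<Longrightarrow> T i * T j = T j * T i"
    and comm': "\<And>i j. i \<in> {1..n} \<Longrightarrow> j \<in> {1..n} \<Longrightarrow> star (T i) * T j = T j * star (T i)"
  shows "\<exists>Q \<zeta> E. joint_resolution \<Omega> n T Q \<zeta> E"
proof -
  obtain m z E where res: "\<And>l. l \<in> {1..n} \<Longrightarrow> approx_resolution \<Omega> (T l) (m l) (z l) (E l)"
    using single by metis
  have pt: "z l R q \<in> \<Omega>" "pos (E l R q)" if "l \<in> {1..n}" "q < m l R" for l R q
    using res[OF that(1)] that(2) unfolding approx_resolution_def by blast+
  have com: "Y * E l R q = E l R q * Y" if "l \<in> {1..n}" "q < m l R" "Y * T l = T l * Y" "Y * star (T l) = star (T l) * Y" for l R q Y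
    using res[OF that(1)] that(2-) unfolding approx_resolution_def by blast
  have sum1: "(\<Sum>q<m l R. E l R q) = 1" if "l \<in> {1..n}" for l R
    using res[OF that] unfolding approx_resolution_def by blast
  have mom: "(\<lambda>R. \<Sum>q<m l R. sc (z l R q ^ k) * E l R q) \<longlonglongrightarrow> T l ^ k" if "l \<in> {1..n}" for l k
    using res[OF that] unfolding approx_resolution_def by blast
  have EE: "E i R q * E j R r = E j R r * E i R q"
    if ij: "i \<in> {1..n}" "j \<in> {1..n}" "i \<noteq> j" and qr: "q < m i R" "r < m j R" for i j R q r
  proof -
    have ss: "star (T i) * star (T j) = star (T j) * star (T i)"
      using arg_cong[OF comm[OF ij(2,1)], of star] by simp
    have "T i * E j R r = E j R r * T i"
      by (rule com[OF ij(2) qr(2) comm[OF ij(1,2)]]) (rule comm'[OF ij(2,1), symmetric])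
    moreover have "star (T i) * E j R r = E j R r * star (T i)"
      by (rule com[OF ij(2) qr(2) comm'[OF ij(1,2)] ss])
    ultimately have "E j R r * E i R q = E i R q * E j R r"
      by (intro com[OF ij(1) qr(1)]) simp_all
    then show ?thesis by simp
  qed
  define Q where "Q R = PiE {1..n} (\<lambda>l. {..<m l R})" for R
  define \<zeta> where "\<zeta> R q l = z l R (q l)" for R and q :: "nat \<Rightarrow> nat" and l
  define F where "F R q = prod_list (map (\<lambda>l. E l R (q l)) [1..<Suc n])" for R and q :: "nat \<Rightarrow> nat"
  have Ql: "q l < m l R" if "q \<in> Q R" "l \<in> {1..n}" for q l R
    using that by (auto simp: Q_def dest!: PiE_mem)
  have moment: "(\<Sum>q\<in>Q R. sc (prod_list (map (\<lambda>l. \<zeta> R q l ^ c l) [1..<Suc n])) * F R q)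
      = prod_list (map (\<lambda>l. \<Sum>q<m l R. sc (z l R q ^ c l) * E l R q) [1..<Suc n])" for c R
    unfolding Q_def sum_PiE_prod_list[symmetric] F_def \<zeta>_def prod_list_sc_mult ..
  have "joint_resolution \<Omega> n T Q \<zeta> F"
    unfolding joint_resolution_def
  proof (intro conjI allI impI ballI)
    fix R show "finite (Q R)" unfolding Q_def by (intro finite_PiE) auto
    fix q l assume "q \<in> Q R" "l \<in> {1..n}"
    then show "\<zeta> R q l \<in> \<Omega>" using pt(1) Ql by (simp add: \<zeta>_def)
  next
    fix R q assume q: "q \<in> Q R"
    show "pos (F R q)" unfolding F_def
    proof (rule pos_prod_list)
      fix l assume "l \<in> set [1..<Suc n]"
      then have l: "l \<in> {1..n}" by auto
      then show "pos (E l R (q l))" using pt(2) Ql q by blast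
      fix k assume "k \<in> set [1..<Suc n]"
      then have k: "k \<in> {1..n}" by auto
      show "E l R (q l) * E k R (q k) = E k R (q k) * E l R (q l)"
        using EE[OF l k _ Ql[OF q l] Ql[OF q k]] by (cases "l = k") auto
    qed
  next
    fix R
    have one: "prod_list (map (\<lambda>l. 1 :: complex) L) = 1" "prod_list (map (\<lambda>l. 1 :: 'a bop) L) = 1" for L :: "nat list"
      by (induction L) auto
    have "(\<Sum>q\<in>Q R. F R q) = prod_list (map (\<lambda>l. \<Sum>q<m l R. E l R q) [1..<Suc n])"
      using moment[of R "\<lambda>_. 0"] by (simp only: power_0 one sc_simps mult_1_left)
    also have "\<dots> = prod_list (map (\<lambda>l. 1) [1..<Suc n])"
      using sum1 by (intro arg_cong[of _ _ prod_list] map_cong) auto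
    finally show "(\<Sum>q\<in>Q R. F R q) = 1" by (simp only: one)
  next
    fix js assume js: "set js \<subseteq> {1..n}"
    have "prod_list (map T js) = prod_list (map (\<lambda>l. T l ^ count_list js l) [1..<Suc n])"
      by (intro prod_list_word_eq_powers js comm)
    moreover have "prod_list (map (\<zeta> R q) js) = prod_list (map (\<lambda>l. \<zeta> R q l ^ count_list js l) [1..<Suc n])" for R q
      by (intro prod_list_word_eq_powers js) (simp add: mult.commute)
    moreover have "(\<lambda>R. prod_list (map (\<lambda>l. \<Sum>q<m l R. sc (z l R q ^ count_list js l) * E l R q) [1..<Suc n]))
        \<longlonglongrightarrow> prod_list (map (\<lambda>l. T l ^ count_list js l) [1..<Suc n])"
      by (intro tendsto_prod_list mom) auto
    ultimately show "(\<lambda>R. \<Sum>q\<in>Q R. sc (prod_list (map (\<zeta> R q) js)) * F R q) \<longlonglongrightarrow> prod_list (map T js)"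
      by (simp only: moment)
  qed
  then show ?thesis by blast
qed

corollary commuting_selfadjoint_joint_resolution:
  fixes T :: "nat \<Rightarrow> 'a::complex_hilbert bop"
  assumes "\<And>i j. i \<in> {1..n} \<Longrightarrow> j \<in> {1..n} \<Longrightarrow> T i * T j = T j * T i"
    and "\<And>l. l \<in> {1..n} \<Longrightarrow> star (T l) = T l \<and> norm (T l) \<le> 1"
  shows "\<exists>Q \<zeta> E. joint_resolution (complex_of_real ` {-1..1}) n T Q \<zeta> E"
  using assms by (intro doubly_commuting_joint_resolution selfadjoint_approx_resolution) auto

corollary commuting_normal_joint_resolution:
  fixes T :: "nat \<Rightarrow> 'a::complex_hilbert bop"
  assumes comm: "\<And>i j. i \<in> {1..n} \<Longrightarrow> j \<in> {1..n} \<Longrightarrow> T i * T j = T j * T i"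
    and T: "\<And>l. l \<in> {1..n} \<Longrightarrow> star (T l) * T l = T l * star (T l) \<and> norm (T l) \<le> 1"
  shows "\<exists>Q \<zeta> E. joint_resolution (sphere 0 1) n T Q \<zeta> E"
proof (rule doubly_commuting_joint_resolution)
  show "\<exists>m z E. approx_resolution (sphere 0 1) (T l) m z E" if "l \<in> {1..n}" for l
    using T[OF that] by (intro contraction_approx_resolution) simp
  show "star (T i) * T j = T j * star (T i)" if "i \<in> {1..n}" "j \<in> {1..n}" for i j
    by (rule fuglede) (use that T comm in auto)
qed (rule comm)

section \<open>Compression of a dilation\<close>

lemma isometry_cinner:
  fixes J :: "'h::complex_hilbert \<Rightarrow>\<^sub>L 'k::complex_hilbert"
  assumes J: "clinear_op J" "\<And>x. norm (J x) = norm x"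
  shows "cinner (J u) (J v) = cinner u v"
proof -
  have re: "Re (cinner (J u) (J v)) = Re (cinner u v)" for u v
  proof -
    have *: "2 * Re (cinner x y) = (norm (x + y))\<^sup>2 - (norm x)\<^sup>2 - (norm y)\<^sup>2" for x y :: "'b::complex_hilbert"
      using cinner_commute[of y x] by (simp add: cinner_simps flip: Re_cinner_self)
    have "2 * Re (cinner (J u) (J v)) = 2 * Re (cinner u v)"
      unfolding * blinfun.add_right[symmetric] J(2) ..
    then show ?thesis by simp
  qed
  have "J (\<i> *\<^sub>C u) = \<i> *\<^sub>C J u" using J(1) by (simp add: clinear_op_def)
  then have "Im (cinner (J u) (J v)) = Im (cinner u v)"
    using re[of "\<i> *\<^sub>C u" v] by (simp add: cinner_simps)
  then show ?thesis using re by (simp add: complex_eq_iff)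
qed

text \<open>The range of an isometry is the range of the projection \<open>J J\<^sup>*\<close>, which provides the point
  demanded by the definite description in \<^const>\<open>orth_proj\<close>.\<close>

lemma cinner_orth_proj_range:
  fixes J :: "'h::complex_hilbert \<Rightarrow>\<^sub>L 'k::complex_hilbert"
  assumes J: "clinear_op J" "\<And>x. norm (J x) = norm x"
  shows "cinner (orth_proj (range J) y) (J v) = cinner y (J v)"
proof -
  have lin: "J (a *\<^sub>C x) = a *\<^sub>C J x" for a x using J(1) by (simp add: clinear_op_def)
  have "\<exists>Z :: 'k \<Rightarrow>\<^sub>L 'h. clinear_op Z \<and> (\<forall>y. Z y \<in> closure UNIV) \<and> (\<forall>y. \<forall>x\<in>UNIV. cinner (J x) y = cinner x (Z y))"
  proof (rule sesquilinear_representation[where c=1])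
    fix y x show "cmod (cinner (J x) y) \<le> 1 * norm y * norm x"
      using norm_cinner_le[of "J x" y] by (simp add: J(2) mult.commute)
  qed (auto simp: csubspace_def lin blinfun.add_right cinner_simps)
  then obtain Z :: "'k \<Rightarrow>\<^sub>L 'h" where Z: "\<And>x y. cinner (J x) y = cinner x (Z y)" by auto
  define P where "P p \<longleftrightarrow> p \<in> range J \<and> (\<forall>s\<in>range J. cinner (y - p) s = 0)" for p
  have PZ: "P (J (Z y))" unfolding P_def
  proof (intro conjI ballI)
    fix s assume "s \<in> range J"
    then obtain v where v: "s = J v" by blast
    have "cinner (J v) (y - J (Z y)) = 0" by (simp add: cinner_simps Z[of v y] isometry_cinner[OF J])
    then show "cinner (y - J (Z y)) s = 0" unfolding v by (metis cinner_commute complex_cnj_zero)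
  qed simp
  moreover have "p = J (Z y)" if p: "P p" for p
  proof -
    obtain u where u: "p = J u" using p unfolding P_def by blast
    have "p - J (Z y) = J (u - Z y)" by (simp add: u blinfun.diff_right)
    then have m: "p - J (Z y) \<in> range J" by blast
    have "cinner (p - J (Z y)) (p - J (Z y)) = cinner (y - J (Z y)) (p - J (Z y)) - cinner (y - p) (p - J (Z y))"
      by (simp add: cinner_simps)
    also have "cinner (y - J (Z y)) (p - J (Z y)) = 0" using PZ m unfolding P_def by blast
    also have "cinner (y - p) (p - J (Z y)) = 0" using p m unfolding P_def by blast
    finally show ?thesis by (simp add: cinner_self)
  qed
  ultimately have "orth_proj (range J) y = J (Z y)"
    unfolding orth_proj_def P_def[symmetric] by (intro the_equality)
  moreover have "cinner (J v) (J (Z y)) = cinner (J v) y" by (simp add: Z[of v y] isometry_cinner[OF J])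
  ultimately show ?thesis by (metis cinner_commute)
qed

lemma compression_exists:
  fixes J :: "'h::complex_hilbert \<Rightarrow>\<^sub>L 'k::complex_hilbert"
  assumes J: "clinear_op J" "\<And>x. norm (J x) = norm x"
  shows "\<exists>comp :: 'k bop \<Rightarrow> 'h bop. \<forall>Y x y. cinner (comp Y \<cdot> x) y = cinner (Y \<cdot> J x) (J y)"
proof -
  have lin: "J (a *\<^sub>C x) = a *\<^sub>C J x" for a x using J(1) by (simp add: clinear_op_def)
  have "\<exists>C :: 'h bop. \<forall>x y. cinner (C \<cdot> x) y = cinner (Y \<cdot> J x) (J y)" for Y :: "'k bop"
  proof -
    have "\<exists>Z :: 'h \<Rightarrow>\<^sub>L 'h. clinear_op Z \<and> (\<forall>x. Z x \<in> closure UNIV) \<and> (\<forall>x. \<forall>y\<in>UNIV. cinner (J y) (Y \<cdot> J x) = cinner y (Z x))"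
    proof (rule sesquilinear_representation[where c="norm Y"])
      fix x y
      have "cmod (cinner (J y) (Y \<cdot> J x)) \<le> norm (J y) * norm (Y \<cdot> J x)" by (rule norm_cinner_le)
      also have "\<dots> \<le> norm y * (norm Y * norm x)"
        using norm_app_le[of Y "J x"] by (simp add: J(2) mult_left_mono)
      finally show "cmod (cinner (J y) (Y \<cdot> J x)) \<le> norm Y * norm x * norm y" by (simp add: mult_ac)
    qed (auto simp: csubspace_def lin blinfun.add_right cinner_simps)
    then obtain Z :: "'h \<Rightarrow>\<^sub>L 'h" where Z: "clinear_op Z" "\<And>x y. cinner (J y) (Y \<cdot> J x) = cinner y (Z x)" by auto
    have "cinner (Bop Z \<cdot> x) y = cinner (Y \<cdot> J x) (J y)" for x y
      using Z(2)[of y x] unfolding app.rep_eq blin_Bop[OF Z(1)] by (metis cinner_commute)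
    then show ?thesis by blast
  qed
  then show ?thesis by metis
qed

lemma joint_resolution_compression:
  fixes J :: "'h::complex_hilbert \<Rightarrow>\<^sub>L 'k::complex_hilbert" and X :: "nat \<Rightarrow> 'h bop" and U :: "nat \<Rightarrow> 'k bop"
  assumes J: "clinear_op J" "\<And>x. norm (J x) = norm x"
    and U: "joint_resolution \<Omega> n U Q \<zeta> E"
    and dil: "\<And>js x y. set js \<subseteq> {1..n} \<Longrightarrow>
      cinner (prod_list (map X js) \<cdot> x) y = cinner (prod_list (map U js) \<cdot> J x) (J y)"
  shows "\<exists>E'. joint_resolution \<Omega> n X Q \<zeta> E'"
proof -
  obtain comp :: "'k bop \<Rightarrow> 'h bop" where comp: "\<And>Y x y. cinner (comp Y \<cdot> x) y = cinner (Y \<cdot> J x) (J y)"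
    using compression_exists[OF J] by blast
  have add: "comp (Y + Z) = comp Y + comp Z" and scal: "comp (r *\<^sub>R Y) = r *\<^sub>R comp Y"
    and scm: "comp (sc a * Y) = sc a * comp Y" for Y Z r a
    by (rule bop_ext_cinner; simp add: comp cinner_simps)+
  have one: "comp 1 = 1" by (rule bop_ext_cinner) (simp add: comp isometry_cinner[OF J])
  have pr: "comp (prod_list (map U js)) = prod_list (map X js)" if "set js \<subseteq> {1..n}" for js
    by (rule bop_ext_cinner) (simp add: comp dil[OF that])
  have bl: "bounded_linear comp"
  proof (rule bounded_linear_intro[where K=1, OF add scal])
    fix Y
    have "norm (comp Y) \<le> norm Y"
    proof (rule norm_bop_le_form)
      fix x y
      have "cmod (cinner (comp Y \<cdot> x) y) \<le> norm (Y \<cdot> J x) * norm (J y)"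
        unfolding comp by (rule norm_cinner_le)
      also have "\<dots> \<le> norm Y * norm x * norm y"
        using norm_app_le[of Y "J x"] by (simp add: J(2) mult_right_mono)
      finally show "cmod (cinner (comp Y \<cdot> x) y) \<le> norm Y * norm x * norm y" .
    qed simp
    then show "norm (comp Y) \<le> norm Y * 1" by simp
  qed
  have sum: "comp (\<Sum>q\<in>A. f q) = (\<Sum>q\<in>A. comp (f q))" for A and f :: "(nat \<Rightarrow> nat) \<Rightarrow> 'k bop"
    by (rule linear_sum[OF bounded_linear.linear[OF bl]])
  have "joint_resolution \<Omega> n X Q \<zeta> (\<lambda>R q. comp (E R q))"
    unfolding joint_resolution_def
  proof (intro conjI allI impI ballI)
    fix R show "finite (Q R)" using U unfolding joint_resolution_def by blast
    show "(\<Sum>q\<in>Q R. comp (E R q)) = 1"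
      using U unfolding joint_resolution_def sum[symmetric] by (simp add: one)
    fix q assume q: "q \<in> Q R"
    then have "pos (E R q)" using U unfolding joint_resolution_def by blast
    then show "pos (comp (E R q))" by (simp add: pos_def comp)
    fix l assume "l \<in> {1..n}" then show "\<zeta> R q l \<in> \<Omega>" using U q unfolding joint_resolution_def by blast
  next
    fix js assume js: "set js \<subseteq> {1..n}"
    then have "(\<lambda>R. \<Sum>q\<in>Q R. sc (prod_list (map (\<zeta> R q) js)) * E R q) \<longlonglongrightarrow> prod_list (map U js)"
      using U unfolding joint_resolution_def by blast
    from bounded_linear.tendsto[OF bl this]
    show "(\<lambda>R. \<Sum>q\<in>Q R. sc (prod_list (map (\<zeta> R q) js)) * comp (E R q)) \<longlonglongrightarrow> prod_list (map X js)"
      by (simp only: sum scm pr[OF js])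
  qed
  then show ?thesis by blast
qed

section \<open>Traces on normed ideals\<close>

text \<open>\<open>W\<close> is \<open>I\<^bsup>1/2\<^esup>\<close>. The trace is cyclic only with respect to one factor in \<open>I\<close> and one bounded
  factor; the instance needed for two factors in \<open>W\<close> comes from the polar decomposition.\<close>

locale normed_trace_ideal =
  fixes I W :: "'h::complex_hilbert bop set" and N N2 :: "'h bop \<Rightarrow> real" and \<tau> :: "'h bop \<Rightarrow> complex"
  assumes I_0: "0 \<in> I" and I_add: "A \<in> I \<Longrightarrow> B \<in> I \<Longrightarrow> A + B \<in> I"
    and I_mult: "B \<in> I \<Longrightarrow> A * B * C \<in> I"
    and W: "W = {A. star A * A \<in> I}"
    and W_add: "A \<in> W \<Longrightarrow> B \<in> W \<Longrightarrow> A + B \<in> W"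
    and W_mult: "B \<in> W \<Longrightarrow> A * B * C \<in> W"
    and N_sc: "B \<in> I \<Longrightarrow> N (sc a * B) = cmod a * N B"
    and N_nonneg: "B \<in> I \<Longrightarrow> 0 \<le> N B"
    and N_zero: "N 0 = 0"
    and N_add: "A \<in> I \<Longrightarrow> B \<in> I \<Longrightarrow> N (A + B) \<le> N A + N B"
    and N_dom: "\<exists>K>0. \<forall>B\<in>I. norm B \<le> K * N B"
    and N_mult: "B \<in> I \<Longrightarrow> N (A * B * C) \<le> norm A * N B * norm C"
    and N2_nonneg: "B \<in> W \<Longrightarrow> 0 \<le> N2 B"
    and N2_mult: "B \<in> W \<Longrightarrow> N2 (A * B * C) \<le> norm A * N2 B * norm C"
    and hoelder: "S \<in> W \<Longrightarrow> T \<in> W \<Longrightarrow> N (S * T) \<le> N2 S * N2 T"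
    and tr_add: "A \<in> I \<Longrightarrow> B \<in> I \<Longrightarrow> \<tau> (A + B) = \<tau> A + \<tau> B"
    and tr_sc: "A \<in> I \<Longrightarrow> \<tau> (sc a * A) = a * \<tau> A"
    and tr_commute: "A \<in> I \<Longrightarrow> \<tau> (A * B) = \<tau> (B * A)"
    and tr_pos: "A \<in> I \<Longrightarrow> pos A \<Longrightarrow> \<tau> A \<in> \<real> \<and> 0 \<le> Re (\<tau> A)"
    and tr_bound: "\<exists>M>0. \<forall>A\<in>I. cmod (\<tau> A) \<le> M * N A"
begin

lemma I_left: "B \<in> I \<Longrightarrow> A * B \<in> I" and I_right: "B \<in> I \<Longrightarrow> B * A \<in> I"
  using I_mult[of B A 1] I_mult[of B 1 A] by simp_all

lemma W_left: "B \<in> W \<Longrightarrow> A * B \<in> W" and W_right: "B \<in> W \<Longrightarrow> B * A \<in> W"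
  using W_mult[of B A 1] W_mult[of B 1 A] by simp_all

lemma I_minus: "A \<in> I \<Longrightarrow> - A \<in> I"
  using I_left[of A "- 1"] by simp

lemma I_diff: "A \<in> I \<Longrightarrow> B \<in> I \<Longrightarrow> A - B \<in> I"
  using I_add[of A "- B"] I_minus[of B] by simp

lemma I_scaleR: "A \<in> I \<Longrightarrow> r *\<^sub>R A \<in> I"
  using I_left[of A "r *\<^sub>R 1"] by simp

lemma I_sum: "(\<And>i. i \<in> F \<Longrightarrow> f i \<in> I) \<Longrightarrow> (\<Sum>i\<in>F. f i) \<in> I"
  by (induction F rule: infinite_finite_induct) (auto simp: I_0 I_add)

lemma tr_0: "\<tau> 0 = 0"
  using tr_sc[OF I_0, of 0] by (simp add: sc_simps)

lemma tr_sum: "(\<And>i. i \<in> F \<Longrightarrow> f i \<in> I) \<Longrightarrow> \<tau> (\<Sum>i\<in>F. f i) = (\<Sum>i\<in>F. \<tau> (f i))"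
  by (induction F rule: infinite_finite_induct) (auto simp: tr_0 tr_add I_sum)

lemma tr_scaleR: "A \<in> I \<Longrightarrow> \<tau> (r *\<^sub>R A) = of_real r * \<tau> A"
  using tr_sc[of A "of_real r"] by (simp add: sc_of_real)

lemma tr_diff: "A \<in> I \<Longrightarrow> B \<in> I \<Longrightarrow> \<tau> (A - B) = \<tau> A - \<tau> B"
  using tr_add[of "A - B" B] by (simp add: I_diff)

lemma N_sum: "(\<And>i. i \<in> F \<Longrightarrow> f i \<in> I) \<Longrightarrow> N (\<Sum>i\<in>F. f i) \<le> (\<Sum>i\<in>F. N (f i))"
proof (induction F rule: infinite_finite_induct)
  case (insert x F)
  then have "N (f x + sum f F) \<le> N (f x) + N (sum f F)" by (intro N_add I_sum) auto
  then show ?case using insert by fastforce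
qed (simp_all add: N_zero)

lemma N_scaleR: "A \<in> I \<Longrightarrow> N (r *\<^sub>R A) = \<bar>r\<bar> * N A"
  using N_sc[of A "of_real r"] by (simp add: sc_of_real)

lemma W_star: "S \<in> W \<Longrightarrow> star S \<in> W"
proof -
  assume S: "S \<in> W"
  obtain Q Z where "Z * S = Q" "star S = Q * Z" using polar_decomposition by blast
  then show "star S \<in> W" using W_mult[OF S, of Z Z] by simp
qed

text \<open>Polarisation of \<open>T \<mapsto> star T * T\<close> gives \<open>star A * T \<in> I\<close>; apply it to \<open>A = star S\<close>.\<close>

lemma I_product:
  assumes "S \<in> W" "T \<in> W" shows "S * T \<in> I"
proof -
  have sym: "star A * B + star B * A \<in> I" if "A \<in> W" "B \<in> W" for A B
  proof -
    have "star (A + B) * (A + B) \<in> I" "star A * A \<in> I" "star B * B \<in> I"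
      using that W_add[of A B] by (simp_all add: W)
    then have "star (A + B) * (A + B) - star A * A - star B * B \<in> I" by (intro I_diff)
    then show ?thesis by (simp add: algebra_simps)
  qed
  let ?A = "star S"
  have A: "?A \<in> W" using assms W_star by blast
  have "sc \<i> * T \<in> W" using assms(2) by (rule W_left)
  from sym[OF A this] have "sc (-\<i>) * (star ?A * (sc \<i> * T) + star (sc \<i> * T) * ?A) \<in> I" by (rule I_left)
  moreover have "sc (-\<i>) * (star ?A * (sc \<i> * T) + star (sc \<i> * T) * ?A) = star ?A * T - star T * ?A"
    by (rule bop_eqI) (simp add: scaleC_add_right scaleC_scaleC scaleC_minus_one)
  ultimately have "(star ?A * T + star T * ?A) + (star ?A * T - star T * ?A) \<in> I"
    using sym[OF A assms(2)] I_add by metis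
  then have "2 *\<^sub>R (S * T) \<in> I" by (simp add: scaleR_2)
  from I_scaleR[OF this, of "1/2"] show ?thesis by simp
qed

text \<open>With \<open>Q = |S|\<close> and \<open>S = star Z * Q\<close>, the operator \<open>S * star S\<close> is \<open>star Z * Q\<^sup>2 * Z\<close>, in which
  \<open>Q\<^sup>2\<close> lies in \<open>I\<close> and \<open>Z\<close> is bounded, so that cyclicity applies.\<close>

lemma tr_abs_sq_star:
  assumes S: "S \<in> W" shows "\<tau> (S * star S) = \<tau> (star S * S)"
proof -
  obtain Q Z where Q: "star Q = Q" "Q * Q = star S * S" "Z * S = Q" "star S = Q * Z"
    using polar_decomposition by blast
  have QZZ: "Q * (Z * star Z) = Q"
  proof -
    have "Q * (Z * star Z) = star S * star Z" using Q(4) by (simp add: mult.assoc)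
    also have "\<dots> = Q" using arg_cong[OF Q(3), of star] Q(1) by simp
    finally show ?thesis .
  qed
  have QQ: "Q * Q \<in> I" using S Q(2) by (simp add: W)
  have "S = star Z * Q" using arg_cong[OF Q(4), of star] Q(1) by simp
  then have "\<tau> (S * star S) = \<tau> (star Z * (Q * Q * Z))" using Q(4) by (simp add: mult.assoc)
  also have "\<dots> = \<tau> (Q * Q * Z * star Z)" using I_right[OF QQ] by (rule tr_commute[symmetric])
  also have "Q * Q * Z * star Z = Q * Q" using QZZ by (simp add: mult.assoc)
  finally show ?thesis by (simp add: Q(2))
qed

lemma I_quad: "S \<in> W \<Longrightarrow> T \<in> W \<Longrightarrow> A * S * B * T \<in> I"
  by (intro I_product W_right W_left)

text \<open>Half of \<open>E = Q\<^sup>2\<close> is moved to the end, which turns the operator into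
  \<open>(Q S) F star (Q S)\<close>.\<close>

lemma tr_quad_pos:
  assumes "pos E" "pos F" "S \<in> W"
  shows "\<tau> (E * S * F * star S) \<in> \<real> \<and> 0 \<le> Re (\<tau> (E * S * F * star S))"
proof -
  obtain Q where Q: "star Q = Q" "Q * Q = E" using pos_sqrt[OF assms(1)] by blast
  have M: "Q * S * F * star S \<in> I" using assms(3) W_star by (intro I_quad)
  have "\<tau> (E * S * F * star S) = \<tau> (Q * (Q * S * F * star S))" by (simp add: Q(2)[symmetric] mult.assoc)
  also have "\<dots> = \<tau> (Q * S * F * star S * Q)" by (rule tr_commute[OF M, symmetric])
  also have "Q * S * F * star S * Q = (Q * S) * F * star (Q * S)" by (simp add: Q(1) mult.assoc)
  finally have eq: "\<tau> (E * S * F * star S) = \<tau> ((Q * S) * F * star (Q * S))" .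
  have "(Q * S) * F * star (Q * S) \<in> I"
    using I_right[OF M, of Q] by (simp add: Q(1) mult.assoc)
  then show ?thesis unfolding eq by (intro tr_pos pos_conj' assms(2))
qed

text \<open>This is the Cauchy--Schwarz inequality of the sesquilinear form
  \<open>(S, T) \<mapsto> \<tau> (E S F star T)\<close> on \<open>W\<close>, positive by the previous lemma.\<close>

lemma tr_cauchy_schwarz:
  assumes E: "pos E" and F: "pos F" and S: "S \<in> W" and T: "T \<in> W"
  shows "(cmod (\<tau> (E * S * F * star T)))\<^sup>2
    \<le> Re (\<tau> (E * S * F * star S)) * Re (\<tau> (E * T * F * star T))"
proof (rule positive_form_discriminant[where \<gamma>' = "\<tau> (E * T * F * star S)"])
  fix a
  have r: "of_real (Re (\<tau> (E * X * F * star X))) = \<tau> (E * X * F * star X)" if "X \<in> W" for X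
    using tr_quad_pos[OF E F that] by (simp add: of_real_Re)
  define X where "X = S + sc a * T"
  have X: "X \<in> W" unfolding X_def by (intro W_add S W_left T)
  have sW: "star S \<in> W" "star T \<in> W" using S T W_star by auto
  have i: "E * S * F * star S \<in> I" "E * S * F * star T \<in> I" "E * T * F * star S \<in> I" "E * T * F * star T \<in> I"
    using S T sW by (auto intro: I_quad)
  have eX: "E * X * F * star X = E * S * F * star S + sc (cnj a) * (E * S * F * star T)
      + sc a * (E * T * F * star S) + sc (a * cnj a) * (E * T * F * star T)"
    by (rule bop_eqI) (simp add: X_def scaleC_add_right scaleC_scaleC algebra_simps)
  have "\<tau> (E * X * F * star X) = \<tau> (E * S * F * star S) + cnj a * \<tau> (E * S * F * star T)
      + a * \<tau> (E * T * F * star S) + a * cnj a * \<tau> (E * T * F * star T)"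
    unfolding eX by (simp add: tr_add tr_sc i I_add I_left)
  then have "of_real (Re (\<tau> (E * S * F * star S))) + cnj a * \<tau> (E * S * F * star T) + a * \<tau> (E * T * F * star S)
      + of_real ((cmod a)\<^sup>2 * Re (\<tau> (E * T * F * star T))) = \<tau> (E * X * F * star X)"
    unfolding of_real_mult complex_norm_square r[OF S] r[OF T] by simp
  then show "of_real (Re (\<tau> (E * S * F * star S))) + cnj a * \<tau> (E * S * F * star T) + a * \<tau> (E * T * F * star S)
      + of_real ((cmod a)\<^sup>2 * Re (\<tau> (E * T * F * star T))) \<in> \<real> \<and>
      0 \<le> Re (of_real (Re (\<tau> (E * S * F * star S))) + cnj a * \<tau> (E * S * F * star T) + a * \<tau> (E * T * F * star S)
      + of_real ((cmod a)\<^sup>2 * Re (\<tau> (E * T * F * star T))))"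
    using tr_quad_pos[OF E F X] by simp
qed (use tr_quad_pos[OF E F T] in simp)

lemma N_quad_le:
  assumes "S \<in> W" "T \<in> W"
  shows "N (A * S * B * T * C) \<le> norm A * norm B * norm C * (N2 S * N2 T)"
proof -
  have ST: "S * (B * T) \<in> I" using assms by (intro I_product W_left)
  have "N (A * S * B * T * C) = N (A * (S * (B * T)) * C)" by (simp add: mult.assoc)
  also have "\<dots> \<le> norm A * N (S * (B * T)) * norm C" by (rule N_mult[OF ST])
  also have "N (S * (B * T)) \<le> N2 S * N2 (B * T * 1)"
    using hoelder[OF assms(1) W_left[OF assms(2)], of B] by simp
  also have "N2 (B * T * 1) \<le> norm B * N2 T * norm (1 :: 'h bop)" by (rule N2_mult[OF assms(2)])
  also have "norm B * N2 T * norm (1 :: 'h bop) \<le> norm B * N2 T * 1"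
    by (intro mult_left_mono norm_one_bop_le mult_nonneg_nonneg N2_nonneg assms norm_ge_zero)
  finally show ?thesis using N2_nonneg[OF assms(1)] by (simp add: mult_left_mono mult_right_mono mult_ac)
qed

lemma tendsto_tr_quad:
  assumes VW: "V \<in> W" "V' \<in> W" and A: "(\<lambda>R::nat. A R) \<longlonglongrightarrow> a" and B: "(\<lambda>R. B R) \<longlonglongrightarrow> b"
  shows "(\<lambda>R. \<tau> (A R * V * B R * V')) \<longlonglongrightarrow> \<tau> (a * V * b * V')"
proof -
  obtain M where M: "M > 0" "\<And>A. A \<in> I \<Longrightarrow> cmod (\<tau> A) \<le> M * N A" using tr_bound by blast
  have i: "X * V * Y * V' \<in> I" for X Y using VW by (rule I_quad)
  have "bounded_bilinear (\<lambda>X Y. \<tau> (X * V * Y * V'))"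
  proof (rule bounded_bilinear.intro)
    show "\<tau> ((X + X') * V * Y * V') = \<tau> (X * V * Y * V') + \<tau> (X' * V * Y * V')" for X X' Y
      by (simp add: distrib_right tr_add i)
    show "\<tau> (X * V * (Y + Y') * V') = \<tau> (X * V * Y * V') + \<tau> (X * V * Y' * V')" for X Y Y'
      by (simp add: distrib_right distrib_left tr_add i)
    show "\<tau> (r *\<^sub>R X * V * Y * V') = r *\<^sub>R \<tau> (X * V * Y * V')" for r X Y
      by (simp add: tr_scaleR i scaleR_conv_of_real)
    show "\<tau> (X * V * (r *\<^sub>R Y) * V') = r *\<^sub>R \<tau> (X * V * Y * V')" for r X Y
      by (simp add: tr_scaleR i scaleR_conv_of_real)
    show "\<exists>K. \<forall>X Y. norm (\<tau> (X * V * Y * V')) \<le> norm X * norm Y * K"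
    proof (intro exI[of _ "M * (N2 V * N2 V')"] allI)
      fix X Y
      have "N (X * V * Y * V' * 1) \<le> norm X * norm Y * norm (1 :: 'h bop) * (N2 V * N2 V')"
        by (rule N_quad_le[OF VW])
      also have "\<dots> \<le> norm X * norm Y * 1 * (N2 V * N2 V')"
        by (intro mult_right_mono mult_left_mono norm_one_bop_le mult_nonneg_nonneg N2_nonneg VW norm_ge_zero)
      finally have "M * N (X * V * Y * V') \<le> M * (norm X * norm Y * (N2 V * N2 V'))"
        using M(1) by simp
      with M(2)[OF i, of X Y] have "cmod (\<tau> (X * V * Y * V')) \<le> M * (norm X * norm Y * (N2 V * N2 V'))"
        by (rule order_trans)
      then show "norm (\<tau> (X * V * Y * V')) \<le> norm X * norm Y * (M * (N2 V * N2 V'))"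
        by (simp add: mult_ac)
    qed
  qed
  then show ?thesis by (rule bounded_bilinear.tendsto[OF _ A B])
qed

text \<open>The trace of a double operator polynomial is a limit of weighted sums
  \<open>\<Sum> \<phi>(\<lambda>, \<mu>) \<tau> (E\<^sub>\<lambda> V E\<^sub>\<mu> V')\<close>, and the total mass of the weights
  \<open>\<tau> (E\<^sub>\<lambda> V E\<^sub>\<mu> V')\<close> is at most \<open>\<parallel>V\<parallel>\<^sub>2 \<parallel>V'\<parallel>\<^sub>2\<close> by Cauchy--Schwarz, since the
  \<open>E\<^sub>\<lambda>\<close> sum to the identity.\<close>

theorem trace_double_sum_bound:
  fixes x :: "nat \<Rightarrow> 'h bop" and U :: "'u set"
  assumes res: "joint_resolution \<Omega> n x Q \<zeta> E"
    and VW: "V \<in> W" "V' \<in> W" and U: "finite U"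
    and words: "\<And>u. u \<in> U \<Longrightarrow> set (\<alpha> u) \<subseteq> {1..n} \<and> set (\<beta> u) \<subseteq> {1..n}"
    and C: "\<And>lam mu. (\<And>l. l \<in> {1..n} \<Longrightarrow> lam l \<in> \<Omega>) \<Longrightarrow> (\<And>l. l \<in> {1..n} \<Longrightarrow> mu l \<in> \<Omega>) \<Longrightarrow>
       cmod (\<Sum>u\<in>U. c u * (prod_list (map lam (\<alpha> u)) * prod_list (map mu (\<beta> u)))) \<le> C"
  shows "cmod (\<Sum>u\<in>U. c u * \<tau> (prod_list (map x (\<alpha> u)) * V * prod_list (map x (\<beta> u)) * V'))
    \<le> C * (sqrt (Re (\<tau> (star V * V))) * sqrt (Re (\<tau> (star V' * V'))))"
proof -
  have fin: "finite (Q R)" and posE: "\<And>q. q \<in> Q R \<Longrightarrow> pos (E R q)" and sum1: "(\<Sum>q\<in>Q R. E R q) = 1"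
    and pts: "\<And>q l. q \<in> Q R \<Longrightarrow> l \<in> {1..n} \<Longrightarrow> \<zeta> R q l \<in> \<Omega>" for R
    using res unfolding joint_resolution_def by blast+
  define m where "m R js = (\<Sum>q\<in>Q R. sc (prod_list (map (\<zeta> R q) js)) * E R q)" for R js
  have lim: "(\<lambda>R. m R js) \<longlonglongrightarrow> prod_list (map x js)" if "set js \<subseteq> {1..n}" for js
    using res that unfolding joint_resolution_def m_def by blast
  have sW: "star V \<in> W" "star V' \<in> W" using VW W_star by auto
  have i: "A * V * B * V' \<in> I" for A B using VW by (rule I_quad)
  define w where "w R q r = \<tau> (E R q * V * E R r * V')" for R q r
  have bound: "cmod (\<Sum>u\<in>U. c u * \<tau> (m R (\<alpha> u) * V * m R (\<beta> u) * V'))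
    \<le> C * (sqrt (Re (\<tau> (star V * V))) * sqrt (Re (\<tau> (star V' * V'))))" for R
  proof -
    let ?lam = "\<lambda>q. \<zeta> R q"
    have quad: "\<tau> (m R js * V * m R ks * V')
        = (\<Sum>q\<in>Q R. \<Sum>r\<in>Q R. prod_list (map (?lam q) js) * prod_list (map (?lam r) ks) * w R q r)" for js ks
    proof -
      have e: "(sc a * E1) * V * (sc b * E2) * V' = sc (a * b) * (E1 * V * E2 * V')" for a b E1 E2
        by (rule bop_eqI) (simp add: scaleC_scaleC mult.commute)
      have "m R js * V * m R ks * V' = (\<Sum>q\<in>Q R. \<Sum>r\<in>Q R.
          sc (prod_list (map (?lam q) js) * prod_list (map (?lam r) ks)) * (E R q * V * E R r * V'))"
        unfolding m_def sum_distrib_left sum_distrib_right e by (rule sum.swap)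
      then show ?thesis by (simp add: tr_sum tr_sc i I_left I_sum w_def)
    qed
    define \<phi> where "\<phi> q r = (\<Sum>u\<in>U. c u * (prod_list (map (?lam q) (\<alpha> u)) * prod_list (map (?lam r) (\<beta> u))))" for q r
    have \<phi>: "cmod (\<phi> q r) \<le> C" if "q \<in> Q R" "r \<in> Q R" for q r
      unfolding \<phi>_def using pts that by (intro C) auto
    define a where "a q r = Re (\<tau> (E R q * V * E R r * star V))" for q r
    define b where "b q r = Re (\<tau> (E R q * star V' * E R r * V'))" for q r
    have a0: "0 \<le> a q r" and b0: "0 \<le> b q r" if "q \<in> Q R" "r \<in> Q R" for q r
      using tr_quad_pos[OF posE[OF that(1)] posE[OF that(2)] VW(1)]
        tr_quad_pos[OF posE[OF that(1)] posE[OF that(2)] sW(2)] by (simp_all add: a_def b_def)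
    have wab: "cmod (w R q r) \<le> \<bar>sqrt (a q r)\<bar> * \<bar>sqrt (b q r)\<bar>" if "q \<in> Q R" "r \<in> Q R" for q r
    proof -
      have "cmod (w R q r) \<le> sqrt (a q r * b q r)"
        using tr_cauchy_schwarz[OF posE[OF that(1)] posE[OF that(2)] VW(1) sW(2)]
        by (intro real_le_rsqrt) (simp add: w_def a_def b_def)
      then show ?thesis using a0[OF that] b0[OF that] by (simp add: real_sqrt_mult)
    qed
    have total: "(\<Sum>q\<in>Q R. \<Sum>r\<in>Q R. Re (\<tau> (E R q * S * E R r * T))) = Re (\<tau> (S * T))"
      if ST: "S \<in> W" "T \<in> W" for S T
    proof -
      have "S * T = (\<Sum>q\<in>Q R. E R q) * S * (\<Sum>r\<in>Q R. E R r) * T" by (simp add: sum1)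
      also have "\<dots> = (\<Sum>q\<in>Q R. \<Sum>r\<in>Q R. E R q * S * E R r * T)"
        unfolding sum_distrib_left sum_distrib_right by (rule sum.swap)
      finally have "\<tau> (S * T) = (\<Sum>q\<in>Q R. \<Sum>r\<in>Q R. \<tau> (E R q * S * E R r * T))"
        using I_quad[OF ST] by (simp add: tr_sum I_sum)
      then show ?thesis by simp
    qed
    have "(\<Sum>u\<in>U. c u * \<tau> (m R (\<alpha> u) * V * m R (\<beta> u) * V')) = (\<Sum>q\<in>Q R. \<Sum>r\<in>Q R. \<phi> q r * w R q r)"
    proof -
      have "(\<Sum>u\<in>U. c u * \<tau> (m R (\<alpha> u) * V * m R (\<beta> u) * V'))
        = (\<Sum>u\<in>U. \<Sum>q\<in>Q R. \<Sum>r\<in>Q R. c u * (prod_list (map (?lam q) (\<alpha> u)) * prod_list (map (?lam r) (\<beta> u))) * w R q r)"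
        unfolding quad sum_distrib_left by (simp only: mult.assoc)
      also have "\<dots> = (\<Sum>q\<in>Q R. \<Sum>u\<in>U. \<Sum>r\<in>Q R. c u * (prod_list (map (?lam q) (\<alpha> u)) * prod_list (map (?lam r) (\<beta> u))) * w R q r)"
        by (rule sum.swap)
      also have "\<dots> = (\<Sum>q\<in>Q R. \<Sum>r\<in>Q R. \<Sum>u\<in>U. c u * (prod_list (map (?lam q) (\<alpha> u)) * prod_list (map (?lam r) (\<beta> u))) * w R q r)"
        by (intro sum.cong refl sum.swap)
      finally show ?thesis unfolding \<phi>_def sum_distrib_right .
    qed
    also have "\<dots> = (\<Sum>z\<in>Q R \<times> Q R. \<phi> (fst z) (snd z) * w R (fst z) (snd z))"
      by (simp add: sum.cartesian_product case_prod_beta)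
    also have "cmod \<dots> \<le> (\<Sum>z\<in>Q R \<times> Q R. C * (\<bar>sqrt (a (fst z) (snd z))\<bar> * \<bar>sqrt (b (fst z) (snd z))\<bar>))"
    proof (rule sum_norm_le)
      fix z assume "z \<in> Q R \<times> Q R"
      then have z: "fst z \<in> Q R" "snd z \<in> Q R" by auto
      show "norm (\<phi> (fst z) (snd z) * w R (fst z) (snd z)) \<le> C * (\<bar>sqrt (a (fst z) (snd z))\<bar> * \<bar>sqrt (b (fst z) (snd z))\<bar>)"
        unfolding norm_mult using \<phi>[OF z] wab[OF z] order_trans[OF norm_ge_zero \<phi>[OF z]]
        by (intro mult_mono) auto
    qed
    also have "\<dots> = C * (\<Sum>z\<in>Q R \<times> Q R. \<bar>sqrt (a (fst z) (snd z))\<bar> * \<bar>sqrt (b (fst z) (snd z))\<bar>)"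
      by (simp add: sum_distrib_left)
    also have "\<dots> \<le> C * (L2_set (\<lambda>z. sqrt (a (fst z) (snd z))) (Q R \<times> Q R) * L2_set (\<lambda>z. sqrt (b (fst z) (snd z))) (Q R \<times> Q R))"
    proof (cases "Q R = {}")
      case False
      then obtain q where "q \<in> Q R" by blast
      then have "0 \<le> C" using \<phi>[of q q] norm_ge_zero order_trans by blast
      then show ?thesis by (intro mult_left_mono L2_set_mult_ineq)
    qed simp
    also have "L2_set (\<lambda>z. sqrt (a (fst z) (snd z))) (Q R \<times> Q R) = sqrt (Re (\<tau> (star V * V)))"
    proof -
      have "(\<Sum>z\<in>Q R \<times> Q R. (sqrt (a (fst z) (snd z)))\<^sup>2) = (\<Sum>z\<in>Q R \<times> Q R. a (fst z) (snd z))"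
        by (rule sum.cong) (auto simp: a0)
      also have "\<dots> = (\<Sum>q\<in>Q R. \<Sum>r\<in>Q R. a q r)" by (simp add: sum.cartesian_product case_prod_beta)
      also have "\<dots> = Re (\<tau> (V * star V))" unfolding a_def by (rule total[OF VW(1) sW(1)])
      also have "\<dots> = Re (\<tau> (star V * V))" by (simp add: tr_abs_sq_star VW)
      finally show ?thesis by (simp add: L2_set_def)
    qed
    also have "L2_set (\<lambda>z. sqrt (b (fst z) (snd z))) (Q R \<times> Q R) = sqrt (Re (\<tau> (star V' * V')))"
    proof -
      have "(\<Sum>z\<in>Q R \<times> Q R. (sqrt (b (fst z) (snd z)))\<^sup>2) = (\<Sum>z\<in>Q R \<times> Q R. b (fst z) (snd z))"
        by (rule sum.cong) (auto simp: b0)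
      also have "\<dots> = (\<Sum>q\<in>Q R. \<Sum>r\<in>Q R. b q r)" by (simp add: sum.cartesian_product case_prod_beta)
      also have "\<dots> = Re (\<tau> (star V' * V'))" unfolding b_def by (rule total[OF sW(2) VW(2)])
      finally show ?thesis by (simp add: L2_set_def)
    qed
    finally show ?thesis .
  qed
  have "(\<lambda>R. \<Sum>u\<in>U. c u * \<tau> (m R (\<alpha> u) * V * m R (\<beta> u) * V'))
    \<longlonglongrightarrow> (\<Sum>u\<in>U. c u * \<tau> (prod_list (map x (\<alpha> u)) * V * prod_list (map x (\<beta> u)) * V'))"
    using words by (intro tendsto_intros tendsto_tr_quad VW lim) auto
  then show ?thesis using bound by (intro Lim_bounded[OF tendsto_norm]) auto
qed

end

section \<open>Divided differences\<close>

text \<open>The first divided difference \<open>(a\<^sup>k - b\<^sup>k) / (a - b)\<close> of \<open>z\<^sup>k\<close>, in a form that makes sense for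
  \<open>a = b\<close>.\<close>

definition dd :: "nat \<Rightarrow> complex \<Rightarrow> complex \<Rightarrow> complex" where
  "dd k a b = (\<Sum>p<k. a ^ p * b ^ (k - 1 - p))"

text \<open>Twice the second divided difference of \<open>z\<^sup>k\<close> at the nodes \<open>a, a, b\<close>.\<close>

definition dd2 :: "nat \<Rightarrow> complex \<Rightarrow> complex \<Rightarrow> complex" where
  "dd2 k a b = 2 * (\<Sum>p<k. a ^ p * dd (k - 1 - p) b a)"

lemma dd_diff: "(a - b) * dd k a b = a ^ k - b ^ k"
  unfolding dd_def power_diff_sumr2 by (simp add: mult.commute)

lemma dd_same: "dd k a a = of_nat k * a ^ (k - 1)"
proof -
  have "dd k a a = (\<Sum>p<k. a ^ (k - 1))" unfolding dd_def by (rule sum.cong) (auto simp flip: power_add)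
  then show ?thesis by simp
qed

lemma dd2_taylor: "(b - a)\<^sup>2 * dd2 k a b = 2 * (b ^ k - a ^ k - of_nat k * a ^ (k - 1) * (b - a))"
proof -
  have "(b - a) * (\<Sum>p<k. a ^ p * dd (k - 1 - p) b a) = (\<Sum>p<k. a ^ p * (b ^ (k - 1 - p) - a ^ (k - 1 - p)))"
    unfolding sum_distrib_left by (rule sum.cong) (simp_all add: dd_diff[symmetric])
  also have "\<dots> = dd k a b - dd k a a" by (simp add: dd_def right_diff_distrib sum_subtractf)
  finally have "(b - a) * (b - a) * (\<Sum>p<k. a ^ p * dd (k - 1 - p) b a) = (b - a) * (dd k a b - dd k a a)"
    by (simp only: mult.assoc)
  also have "\<dots> = - ((a - b) * dd k a b) - (b - a) * dd k a a" by (simp add: algebra_simps)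
  also have "\<dots> = b ^ k - a ^ k - of_nat k * a ^ (k - 1) * (b - a)"
    unfolding dd_diff dd_same by (simp add: algebra_simps)
  finally show ?thesis by (simp add: dd2_def power2_eq_square mult_ac)
qed

lemma dd2_same: "dd2 k a a = of_nat k * of_nat (k - 1) * a ^ (k - 2)"
proof -
  have "a ^ p * dd (k - 1 - p) a a = of_nat (k - 1 - p) * a ^ (k - 2)" if "p < k" for p
  proof (cases "k - 1 - p")
    case (Suc r)
    then have "k = Suc (Suc (p + r))" using that by simp
    then show ?thesis by (simp add: dd_same power_add mult_ac)
  qed (simp add: dd_same)
  then have "dd2 k a a = 2 * (\<Sum>p<k. of_nat (k - 1 - p)) * a ^ (k - 2)"
    by (simp add: dd2_def sum_distrib_right mult.assoc)
  also have "(\<Sum>p<k. of_nat (k - 1 - p) :: complex) = (\<Sum>p<k. of_nat p)"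
    by (rule sum.nat_diff_reindex[of "of_nat" k, simplified diff_Suc_eq_diff_pred])
  also have "2 * (\<Sum>p<k. of_nat p :: complex) = of_nat k * of_nat (k - 1)"
    by (induction k) (simp_all add: algebra_simps of_nat_diff split: nat_diff_split)
  finally show ?thesis .
qed

lemma dd_bound:
  assumes F: "finite F"
    and M: "\<And>w. w \<in> closed_segment a b \<Longrightarrow> cmod (\<Sum>k\<in>F. d k * (of_nat (m k) * w ^ (m k - 1))) \<le> M"
  shows "cmod (\<Sum>k\<in>F. d k * dd (m k) a b) \<le> M"
proof (cases "a = b")
  case True
  then show ?thesis using M[of a] by (simp add: dd_same)
next
  case False
  define f where "f w = (\<Sum>k\<in>F. d k * w ^ m k)" for w
  have "(f has_field_derivative (\<Sum>k\<in>F. d k * (of_nat (m k) * w ^ (m k - 1)))) (at w within S)" for w S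
    unfolding f_def by (auto intro!: derivative_eq_intros sum.cong)
  then have "cmod (f a - f b) \<le> M * cmod (a - b)"
    using M by (intro field_differentiable_bound[of "closed_segment a b"]) auto
  also have "f a - f b = (a - b) * (\<Sum>k\<in>F. d k * dd (m k) a b)"
    unfolding f_def sum_subtractf[symmetric] sum_distrib_left
    by (rule sum.cong) (simp_all add: dd_diff[symmetric] algebra_simps flip: right_diff_distrib)
  finally show ?thesis using False by (simp add: norm_mult mult.commute[of M])
qed

text \<open>The factor \<open>2\<close> in \<^const>\<open>dd2\<close> is cancelled by the \<open>1/2\<close> of the Taylor remainder. To keep that
  \<open>1/2\<close>, the mean value inequality is applied along the segment with the comparison function
  \<open>M |h|\<^sup>2 s\<^sup>2 / 2\<close>.\<close>

lemma dd2_bound: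
  assumes F: "finite F"
    and M: "\<And>w. w \<in> closed_segment a b \<Longrightarrow>
      cmod (\<Sum>k\<in>F. d k * (of_nat (m k) * of_nat (m k - 1) * w ^ (m k - 2))) \<le> M"
  shows "cmod (\<Sum>k\<in>F. d k * dd2 (m k) a b) \<le> M"
proof (cases "a = b")
  case True
  then show ?thesis using M[of a] by (simp add: dd2_same)
next
  case False
  define h where "h = b - a"
  define f where "f w = (\<Sum>k\<in>F. d k * w ^ m k)" for w
  define f1 where "f1 w = (\<Sum>k\<in>F. d k * (of_nat (m k) * w ^ (m k - 1)))" for w
  have d1: "(f has_field_derivative f1 w) (at w within S)" for w S
    unfolding f_def f1_def by (auto intro!: derivative_eq_intros sum.cong)
  have d2: "(f1 has_field_derivative (\<Sum>k\<in>F. d k * (of_nat (m k) * of_nat (m k - 1) * w ^ (m k - 2)))) (at w within S)" for w S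
  proof -
    show ?thesis unfolding f1_def
      by (auto intro!: derivative_eq_intros sum.cong simp: diff_diff_eq mult_ac numeral_2_eq_2)
  qed
  have seg: "a + of_real s * h \<in> closed_segment a b" if "0 \<le> s" "s \<le> 1" for s
    using that unfolding h_def closed_segment_def
    by (auto intro!: exI[of _ s] simp: scaleR_conv_of_real algebra_simps)
  have f1: "cmod (f1 (a + of_real s * h) - f1 a) \<le> M * (s * cmod h)" if "0 \<le> s" "s \<le> 1" for s
  proof -
    have "cmod (f1 (a + of_real s * h) - f1 a) \<le> M * cmod ((a + of_real s * h) - a)"
      using seg[OF that] M by (intro field_differentiable_bound[OF convex_closed_segment d2]) auto
    then show ?thesis using that by (simp add: norm_mult)
  qed
  define g where "g s = f (a + of_real s * h) - f a - of_real s * h * f1 a" for s :: real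
  have dg: "(g has_vector_derivative h * (f1 (a + of_real s * h) - f1 a)) (at s)" for s
  proof -
    have "((\<lambda>s. f (a + s * h) - f a - s * h * f1 a) has_field_derivative h * (f1 (a + of_real s * h) - f1 a)) (at (of_real s))"
      by (rule derivative_eq_intros DERIV_chain2[OF d1] refl | simp add: algebra_simps)+
    then show ?thesis unfolding g_def[abs_def] by (rule has_vector_derivative_real_field)
  qed
  have "norm (g 1 - g 0) \<le> M * (cmod h)\<^sup>2 * 1\<^sup>2 / 2 - M * (cmod h)\<^sup>2 * 0\<^sup>2 / 2"
  proof (rule differentiable_bound_general[where f=g and f'="\<lambda>s. h * (f1 (a + of_real s * h) - f1 a)"
        and \<phi>="\<lambda>s. M * (cmod h)\<^sup>2 * s\<^sup>2 / 2" and \<phi>'="\<lambda>s. M * (cmod h)\<^sup>2 * s"])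
    show "continuous_on {0..1} g"
      using dg by (intro continuous_at_imp_continuous_on ballI has_vector_derivative_continuous)
    show "(g has_vector_derivative h * (f1 (a + of_real x * h) - f1 a)) (at x)" for x by (rule dg)
    show "((\<lambda>s. M * (cmod h)\<^sup>2 * s\<^sup>2 / 2) has_vector_derivative M * (cmod h)\<^sup>2 * x) (at x)" for x
      unfolding has_real_derivative_iff_has_vector_derivative[symmetric]
      by (auto intro!: derivative_eq_intros)
    show "norm (h * (f1 (a + of_real x * h) - f1 a)) \<le> M * (cmod h)\<^sup>2 * x" if "0 < x" "x < 1" for x
      using mult_left_mono[OF f1[of x], of "cmod h"] that by (simp add: norm_mult power2_eq_square mult_ac)
  qed (auto intro!: continuous_intros)
  moreover have "g 1 - g 0 = h\<^sup>2 * (\<Sum>k\<in>F. d k * dd2 (m k) a b) / 2"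
  proof -
    have "h\<^sup>2 * (\<Sum>k\<in>F. d k * dd2 (m k) a b) = (\<Sum>k\<in>F. d k * (h\<^sup>2 * dd2 (m k) a b))"
      by (simp add: sum_distrib_left mult_ac)
    also have "\<dots> = 2 * (f b - f a - h * f1 a)"
      unfolding h_def dd2_taylor f_def f1_def sum_distrib_left sum_subtractf[symmetric]
      by (rule sum.cong) (simp_all add: algebra_simps)
    finally show ?thesis by (simp add: g_def h_def)
  qed
  then have "norm (g 1 - g 0) = (cmod h)\<^sup>2 * cmod (\<Sum>k\<in>F. d k * dd2 (m k) a b) / 2"
    by (simp only: norm_mult norm_divide norm_power) simp
  ultimately have "(cmod h)\<^sup>2 * cmod (\<Sum>k\<in>F. d k * dd2 (m k) a b) \<le> (cmod h)\<^sup>2 * M"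
    by (simp add: mult.commute)
  moreover have "(cmod h)\<^sup>2 > 0" using False by (simp add: h_def)
  ultimately show ?thesis by simp
qed

section \<open>Polynomials and power series in several variables\<close>

definition mon :: "nat \<Rightarrow> (nat \<Rightarrow> nat) \<Rightarrow> (nat \<Rightarrow> complex) \<Rightarrow> complex" where
  "mon n e z = (\<Prod>l\<in>{1..n}. z l ^ e l)"

definition dec :: "nat \<Rightarrow> (nat \<Rightarrow> nat) \<Rightarrow> nat \<Rightarrow> nat" where
  "dec j e = e(j := e j - 1)"

lemma mon_split: "j \<in> {1..n} \<Longrightarrow> mon n e z = z j ^ e j * (\<Prod>l\<in>{1..n}-{j}. z l ^ e l)"
  unfolding mon_def by (rule prod.remove) auto

lemma mon_upd: "j \<in> {1..n} \<Longrightarrow> mon n e (z(j := w)) = w ^ e j * (\<Prod>l\<in>{1..n}-{j}. z l ^ e l)"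
  by (simp add: mon_split)

lemma mon_dec: "j \<in> {1..n} \<Longrightarrow> mon n (dec j e) z = z j ^ (e j - 1) * (\<Prod>l\<in>{1..n}-{j}. z l ^ e l)"
  by (simp add: mon_split dec_def)

lemma norm_mon_le:
  assumes "\<And>l. l \<in> {1..n} \<Longrightarrow> cmod (z l) \<le> \<rho>" shows "cmod (mon n e z) \<le> \<rho> ^ (\<Sum>l\<in>{1..n}. e l)"
proof -
  have "cmod (mon n e z) = (\<Prod>l\<in>{1..n}. cmod (z l) ^ e l)" by (simp add: mon_def prod_norm[symmetric] norm_power)
  also have "\<dots> \<le> (\<Prod>l\<in>{1..n}. \<rho> ^ e l)" using assms by (intro prod_mono) (auto intro: power_mono)
  finally show ?thesis by (simp add: power_sum)
qed

text \<open>The variables are moved from the circle into the disc one at a time.\<close>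

lemma polynomial_max_modulus:
  assumes F: "finite F"
    and M: "\<And>z. (\<And>l. l \<in> {1..n} \<Longrightarrow> cmod (z l) = 1) \<Longrightarrow> cmod (\<Sum>k\<in>F. a k * mon n (e k) z) \<le> M"
    and z: "\<And>l. l \<in> {1..n} \<Longrightarrow> cmod (z l) \<le> 1"
  shows "cmod (\<Sum>k\<in>F. a k * mon n (e k) z) \<le> M"
proof -
  have "m \<le> n \<Longrightarrow> (\<And>l. l \<in> {1..m} \<Longrightarrow> cmod (z l) \<le> 1) \<Longrightarrow> (\<And>l. l \<in> {m<..n} \<Longrightarrow> cmod (z l) = 1) \<Longrightarrow>
    cmod (\<Sum>k\<in>F. a k * mon n (e k) z) \<le> M" for m z
  proof (induction m arbitrary: z)
    case 0
    then show ?case by (intro M) auto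
  next
    case (Suc m)
    let ?j = "Suc m"
    have j: "?j \<in> {1..n}" using Suc.prems(1) by auto
    define G where "G w = (\<Sum>k\<in>F. a k * mon n (e k) (z(?j := w)))" for w
    have hol: "G holomorphic_on A" for A
      unfolding G_def mon_upd[OF j] by (intro holomorphic_intros)
    have "norm (G (z ?j)) \<le> M"
    proof (rule maximum_modulus_frontier[of G "cball 0 1"])
      show "continuous_on (closure (cball 0 1)) G" using hol by (rule holomorphic_on_imp_continuous_on)
      fix w :: complex assume "w \<in> frontier (cball 0 1)"
      then have w: "cmod w = 1" by (simp add: frontier_cball)
      show "norm (G w) \<le> M" unfolding G_def
      proof (rule Suc.IH)
        fix l assume "l \<in> {m<..n}"
        then show "cmod ((z(?j := w)) l) = 1" using Suc.prems(3)[of l] w by (cases "l = ?j") auto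
      qed (use Suc.prems in auto)
    qed (use hol Suc.prems(2)[of ?j] in auto)
    then show ?case by (simp add: G_def)
  qed
  from this[of n z] z show ?thesis by auto
qed

text \<open>Power series are families of monomials \<open>a k z\<^bsup>e k\<^esup>\<close> over an arbitrary index set. Formal
  differentiation then keeps the index set and changes only \<open>a\<close> and \<open>e\<close>.\<close>

definition series_on :: "nat \<Rightarrow> real \<Rightarrow> 'k set \<Rightarrow> ('k \<Rightarrow> complex) \<Rightarrow> ('k \<Rightarrow> nat \<Rightarrow> nat) \<Rightarrow> bool" where
  "series_on n r K a e \<longleftrightarrow>
     (\<forall>\<rho>. 0 \<le> \<rho> \<longrightarrow> \<rho> < r \<longrightarrow> (\<lambda>k. cmod (a k) * \<rho> ^ (\<Sum>l\<in>{1..n}. e k l)) summable_on K)"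

definition series_sum :: "nat \<Rightarrow> 'k set \<Rightarrow> ('k \<Rightarrow> complex) \<Rightarrow> ('k \<Rightarrow> nat \<Rightarrow> nat) \<Rightarrow> (nat \<Rightarrow> complex) \<Rightarrow> complex" where
  "series_sum n K a e z = (\<Sum>\<^sub>\<infinity>k\<in>K. a k * mon n (e k) z)"

lemma bernoulli_power_le: "0 \<le> \<rho> \<Longrightarrow> \<rho> \<le> \<sigma> \<Longrightarrow> real s * \<rho> ^ (s - 1) * (\<sigma> - \<rho>) \<le> \<sigma> ^ s"
proof (induction s)
  case (Suc s)
  have "real (Suc s) * \<rho> ^ s * (\<sigma> - \<rho>) = \<rho> * (real s * \<rho> ^ (s - 1) * (\<sigma> - \<rho>)) + \<rho> ^ s * (\<sigma> - \<rho>)"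
    by (cases s) (simp_all add: algebra_simps)
  also have "\<dots> \<le> \<rho> * \<sigma> ^ s + \<sigma> ^ s * (\<sigma> - \<rho>)"
    using Suc by (intro add_mono mult_left_mono mult_right_mono power_mono) auto
  finally show ?case by (simp add: algebra_simps)
qed simp

text \<open>On a slightly larger polyradius \<open>\<sigma> > \<rho>\<close> the factor \<open>s\<close> produced by differentiation is absorbed:
  \<open>s \<rho>\<^bsup>s-1\<^esup> \<le> \<sigma>\<^sup>s / (\<sigma> - \<rho>)\<close>.\<close>

lemma series_on_deriv:
  assumes a: "series_on n r K a e" and j: "j \<in> {1..n}"
  shows "series_on n r K (\<lambda>k. a k * of_nat (e k j)) (\<lambda>k. dec j (e k))"
  unfolding series_on_def
proof (intro allI impI)
  fix \<rho> :: real assume \<rho>: "0 \<le> \<rho>" "\<rho> < r"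
  define \<sigma> where "\<sigma> = (\<rho> + r) / 2"
  have \<sigma>: "\<rho> < \<sigma>" "\<sigma> < r" using \<rho> by (auto simp: \<sigma>_def)
  have "(\<lambda>k. cmod (a k) * \<sigma> ^ (\<Sum>l\<in>{1..n}. e k l)) summable_on K"
    using a \<rho> \<sigma> unfolding series_on_def by auto
  then have "(\<lambda>k. (1 / (\<sigma> - \<rho>)) * (cmod (a k) * \<sigma> ^ (\<Sum>l\<in>{1..n}. e k l))) summable_on K"
    by (rule summable_on_cmult_right)
  then show "(\<lambda>k. cmod (a k * of_nat (e k j)) * \<rho> ^ (\<Sum>l\<in>{1..n}. dec j (e k) l)) summable_on K"
  proof (rule summable_on_comparison_test)
    fix k
    define s where "s = (\<Sum>l\<in>{1..n}. e k l)"
    have s: "s = e k j + (\<Sum>l\<in>{1..n}-{j}. e k l)" unfolding s_def by (rule sum.remove) (use j in auto)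
    have d: "(\<Sum>l\<in>{1..n}. dec j (e k) l) = e k j - 1 + (\<Sum>l\<in>{1..n}-{j}. e k l)"
      using sum.remove[of "{1..n}" j "dec j (e k)"] j by (simp add: dec_def)
    show "cmod (a k * of_nat (e k j)) * \<rho> ^ (\<Sum>l\<in>{1..n}. dec j (e k) l) \<le> (1 / (\<sigma> - \<rho>)) * (cmod (a k) * \<sigma> ^ (\<Sum>l\<in>{1..n}. e k l))"
    proof (cases "e k j")
      case 0
      then show ?thesis using \<rho> \<sigma> by simp
    next
      case (Suc i)
      then have ds: "(\<Sum>l\<in>{1..n}. dec j (e k) l) = s - 1" using d s by simp
      have "real (e k j) * \<rho> ^ (s - 1) * (\<sigma> - \<rho>) \<le> real s * \<rho> ^ (s - 1) * (\<sigma> - \<rho>)"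
        using s \<rho> \<sigma> by (intro mult_right_mono of_nat_mono) auto
      also have "\<dots> \<le> \<sigma> ^ s" using \<rho> \<sigma> by (intro bernoulli_power_le) auto
      finally have "real (e k j) * \<rho> ^ (s - 1) \<le> \<sigma> ^ s / (\<sigma> - \<rho>)" using \<sigma> by (simp add: field_simps)
      then have "cmod (a k) * (real (e k j) * \<rho> ^ (s - 1)) \<le> cmod (a k) * (\<sigma> ^ s / (\<sigma> - \<rho>))"
        by (rule mult_left_mono) simp
      then show ?thesis unfolding ds s_def[symmetric] by (simp add: norm_mult mult_ac)
    qed
  qed (use \<rho> in auto)
qed

lemma series_uniform_limit:
  assumes a: "series_on n r K a e" and \<rho>: "0 \<le> \<rho>" "\<rho> < r"
    and Y: "\<And>z l. z \<in> Y \<Longrightarrow> l \<in> {1..n} \<Longrightarrow> cmod (z l) \<le> \<rho>"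
  shows "uniform_limit Y (\<lambda>F z. \<Sum>k\<in>F. a k * mon n (e k) z) (series_sum n K a e) (finite_subsets_at_top K)"
proof -
  have "uniform_limit Y (\<lambda>F z. \<Sum>k\<in>F. a k * mon n (e k) z) (\<lambda>z. \<Sum>\<^sub>\<infinity>k\<in>K. a k * mon n (e k) z) (finite_subsets_at_top K)"
  proof (rule Weierstrass_m_test_general)
    show "(\<lambda>k. cmod (a k) * \<rho> ^ (\<Sum>l\<in>{1..n}. e k l)) summable_on K"
      using a \<rho> unfolding series_on_def by blast
    show "norm (a k * mon n (e k) z) \<le> cmod (a k) * \<rho> ^ (\<Sum>l\<in>{1..n}. e k l)" if "z \<in> Y" for k z
      unfolding norm_mult using Y[OF that] by (intro mult_left_mono norm_mon_le) auto
  qed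
  then show ?thesis by (simp add: series_sum_def[abs_def])
qed

lemma polydisc_radius:
  fixes z :: "nat \<Rightarrow> complex"
  assumes "0 < r" "\<And>l. l \<in> {1..n} \<Longrightarrow> cmod (z l) < r"
  obtains \<rho> where "0 \<le> \<rho>" "\<rho> < r" "\<And>l. l \<in> {1..n} \<Longrightarrow> cmod (z l) < \<rho>"
proof -
  define \<rho>0 where "\<rho>0 = Max (insert 0 ((\<lambda>l. cmod (z l)) ` {1..n}))"
  have "\<rho>0 < r" unfolding \<rho>0_def using assms by (subst Max_less_iff) auto
  moreover have "0 \<le> \<rho>0" "\<And>l. l \<in> {1..n} \<Longrightarrow> cmod (z l) \<le> \<rho>0"
    unfolding \<rho>0_def by (intro Max_ge; simp)+
  ultimately have "0 \<le> (\<rho>0 + r) / 2" "(\<rho>0 + r) / 2 < r" "\<And>l. l \<in> {1..n} \<Longrightarrow> cmod (z l) < (\<rho>0 + r) / 2"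
  proof -
    assume *: "\<rho>0 < r" "0 \<le> \<rho>0" "\<And>l. l \<in> {1..n} \<Longrightarrow> cmod (z l) \<le> \<rho>0"
    then show "0 \<le> (\<rho>0 + r) / 2" "(\<rho>0 + r) / 2 < r" by auto
    fix l assume "l \<in> {1..n}"
    then have "cmod (z l) \<le> \<rho>0" by (rule *)
    also have "\<rho>0 < (\<rho>0 + r) / 2" using * by simp
    finally show "cmod (z l) < (\<rho>0 + r) / 2" .
  qed
  then show ?thesis by (rule that)
qed

lemma series_has_field_derivative:
  assumes a: "series_on n r K a e" and j: "j \<in> {1..n}" and r: "0 < r"
    and z: "\<And>l. l \<in> {1..n} \<Longrightarrow> cmod (z l) < r"
  shows "((\<lambda>w. series_sum n K a e (z(j := w))) has_field_derivative
      series_sum n K (\<lambda>k. a k * of_nat (e k j)) (\<lambda>k. dec j (e k)) z) (at (z j))"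
proof -
  obtain \<rho> where \<rho>: "0 \<le> \<rho>" "\<rho> < r" "\<And>l. l \<in> {1..n} \<Longrightarrow> cmod (z l) < \<rho>"
    using polydisc_radius[OF r, of n z] z by blast
  define \<delta> where "\<delta> = \<rho> - cmod (z j)"
  have \<delta>: "\<delta> > 0" using \<rho> j by (simp add: \<delta>_def)
  let ?f = "\<lambda>F w. \<Sum>k\<in>F. a k * mon n (e k) (z(j := w))"
  let ?f' = "\<lambda>F w. \<Sum>k\<in>F. a k * of_nat (e k j) * mon n (dec j (e k)) (z(j := w))"
  have "uniform_limit ((\<lambda>w. z(j := w)) ` cball (z j) \<delta>) (\<lambda>F z. \<Sum>k\<in>F. a k * mon n (e k) z) (series_sum n K a e) (finite_subsets_at_top K)"
  proof (rule series_uniform_limit[OF a \<rho>(1,2)])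
    fix y l assume "y \<in> (\<lambda>w. z(j := w)) ` cball (z j) \<delta>" "l \<in> {1..n}"
    then obtain w where w: "y = z(j := w)" "dist (z j) w \<le> \<delta>" by auto
    have "cmod w \<le> cmod (z j) + dist (z j) w" by (metis dist_commute dist_norm norm_triangle_sub)
    then show "cmod (y l) \<le> \<rho>" using w \<rho>(3)[OF \<open>l \<in> {1..n}\<close>] by (simp add: \<delta>_def)
  qed
  then have ul: "uniform_limit (cball (z j) \<delta>) ?f (\<lambda>w. series_sum n K a e (z(j := w))) (finite_subsets_at_top K)"
    by (simp add: uniform_limit_iff)
  have der: "(?f F has_field_derivative ?f' F w) (at w)" for F w
  proof -
    have "((\<lambda>w. a k * mon n (e k) (z(j := w))) has_field_derivative a k * of_nat (e k j) * mon n (dec j (e k)) (z(j := w))) (at w)" for k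
    proof -
      have "mon n (dec j (e k)) (z(j := w)) = w ^ (e k j - 1) * (\<Prod>l\<in>{1..n}-{j}. z l ^ e k l)"
        using mon_dec[OF j, of "e k" "z(j := w)"] by simp
      then show ?thesis unfolding mon_upd[OF j] by (auto intro!: derivative_eq_intros)
    qed
    then show ?thesis by (intro DERIV_sum)
  qed
  then have "continuous_on A (?f F)" for A F
    by (intro continuous_at_imp_continuous_on ballI) (rule DERIV_isCont[OF der])
  then have ev: "\<forall>\<^sub>F F in finite_subsets_at_top K. continuous_on (cball (z j) \<delta>) (?f F) \<and>
      (\<forall>w\<in>ball (z j) \<delta>. (?f F has_field_derivative ?f' F w) (at w))"
    using der by (intro always_eventually allI conjI ballI)
  obtain g' where g': "\<And>w. w \<in> ball (z j) \<delta> \<Longrightarrow>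
      ((\<lambda>w. series_sum n K a e (z(j := w))) has_field_derivative g' w) (at w) \<and> ((\<lambda>F. ?f' F w) \<longlongrightarrow> g' w) (finite_subsets_at_top K)"
  proof (rule has_complex_derivative_uniform_limit[OF ev ul finite_subsets_at_top_neq_bot \<delta>])
    fix g' assume "\<And>w. w \<in> ball (z j) \<delta> \<Longrightarrow>
      ((\<lambda>w. series_sum n K a e (z(j := w))) has_field_derivative g' w) (at w) \<and> ((\<lambda>F. ?f' F w) \<longlongrightarrow> g' w) (finite_subsets_at_top K)"
    then show thesis by (rule that)
  qed
  have "((\<lambda>k. a k * of_nat (e k j) * mon n (dec j (e k)) z) has_sum g' (z j)) K"
    using g'[of "z j"] \<delta> by (simp add: has_sum_def)
  then have "series_sum n K (\<lambda>k. a k * of_nat (e k j)) (\<lambda>k. dec j (e k)) z = g' (z j)"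
    unfolding series_sum_def by (rule infsumI)
  then show ?thesis using g'[of "z j"] \<delta> by simp
qed

section \<open>Essential suprema of polynomials\<close>

text \<open>The product measures have full support, so an almost everywhere bound on a continuous
  function holds everywhere.\<close>

lemma AE_PiM_bound_everywhere:
  fixes M :: "'a::topological_space measure" and H :: "(nat \<Rightarrow> 'a) \<Rightarrow> real"
  assumes sf: "sigma_finite_measure M"
    and supp: "\<And>x U. x \<in> \<Omega> \<Longrightarrow> open U \<Longrightarrow> x \<in> U \<Longrightarrow> U \<inter> \<Omega> \<in> sets M \<and> 0 < emeasure M (U \<inter> \<Omega>)"
    and H: "continuous_on UNIV H"
    and AE: "AE x in PiM {1..n} (\<lambda>_. M). (\<forall>l\<in>{1..n}. x l \<in> \<Omega>) \<longrightarrow> H x \<le> C"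
    and x0: "x0 \<in> {1..n} \<rightarrow>\<^sub>E \<Omega>"
  shows "H x0 \<le> C"
proof (rule ccontr)
  assume "\<not> H x0 \<le> C"
  interpret product_sigma_finite "\<lambda>_. M" by (simp add: product_sigma_finite_def sf)
  have "open {x. C < H x}" using H by (intro open_Collect_less continuous_on_const)
  then have "openin (product_topology (\<lambda>_. euclidean) UNIV) {x. C < H x}"
    by (simp add: open_fun_def)
  from product_topology_open_contains_basis[OF this, of x0] \<open>\<not> H x0 \<le> C\<close>
  obtain X where X: "x0 \<in> (\<Pi>\<^sub>E i\<in>UNIV. X i)" "\<And>i. open (X i)" "(\<Pi>\<^sub>E i\<in>UNIV. X i) \<subseteq> {x. C < H x}"
    by auto
  define B where "B = (\<Pi>\<^sub>E l\<in>{1..n}. X l \<inter> \<Omega>)"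
  have sB: "X l \<inter> \<Omega> \<in> sets M" "0 < emeasure M (X l \<inter> \<Omega>)" if "l \<in> {1..n}" for l
    using supp[of "x0 l" "X l"] X(1,2) x0 that by (auto simp: PiE_iff)
  have Bs: "B \<in> sets (PiM {1..n} (\<lambda>_. M))" unfolding B_def by (intro sets_PiM_I_finite sB) auto
  have "emeasure (PiM {1..n} (\<lambda>_. M)) B = (\<Prod>l\<in>{1..n}. emeasure M (X l \<inter> \<Omega>))"
    unfolding B_def by (intro emeasure_PiM sB) auto
  then have B0: "emeasure (PiM {1..n} (\<lambda>_. M)) B \<noteq> 0"
    using sB(2) by (simp add: prod_zero_iff) (metis atLeastAtMost_iff less_irrefl)
  have "AE x in PiM {1..n} (\<lambda>_. M). x \<notin> B"
    using AE
  proof eventually_elim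
    case (elim x)
    show ?case
    proof
      assume xB: "x \<in> B"
      have "x \<in> (\<Pi>\<^sub>E i\<in>UNIV. X i)"
      proof (intro PiE_I)
        fix i show "x i \<in> X i"
        proof (cases "i \<in> {1..n}")
          case True then show ?thesis using xB by (auto simp: B_def PiE_iff)
        next
          case False
          then have "x i = x0 i" using xB x0 by (auto simp: B_def PiE_iff extensional_def)
          then show ?thesis using X(1) by (auto simp: PiE_iff)
        qed
      qed simp
      then have "C < H x" using X(3) by blast
      moreover have "\<forall>l\<in>{1..n}. x l \<in> \<Omega>" using xB by (auto simp: B_def PiE_iff)
      ultimately show False using elim by simp
    qed
  qed
  then have "emeasure (PiM {1..n} (\<lambda>_. M)) B = 0"
    using AE_iff_measurable[OF Bs, of "\<lambda>x. x \<notin> B"] sets.sets_into_space[OF Bs] by auto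
  then show False using B0 by simp
qed

lemma emeasure_lborel_open_Icc_pos:
  fixes V :: "real set"
  assumes "open V" "x \<in> V" "x \<in> {a..b}" "a < b"
  shows "0 < emeasure lborel (V \<inter> {a..b})"
proof -
  obtain d where d: "d > 0" "ball x d \<subseteq> V" using assms(1,2) openE by blast
  define c e where "c = max a (x - d / 2)" and "e = min b (x + d / 2)"
  have ce: "c < e" using assms d by (auto simp: c_def e_def)
  have "{c..e} \<subseteq> V \<inter> {a..b}"
  proof
    fix y assume y: "y \<in> {c..e}"
    then have "dist x y < d" using d by (auto simp: c_def e_def dist_real_def)
    then show "y \<in> V \<inter> {a..b}" using y d(2) by (auto simp: c_def e_def)
  qed
  then have "emeasure lborel {c..e} \<le> emeasure lborel (V \<inter> {a..b})"
    using assms(1) by (intro emeasure_mono) auto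
  moreover have "0 < emeasure lborel {c..e}" using ce by simp
  ultimately show ?thesis by (rule order_less_le_trans[rotated])
qed

lemma emeasure_circle:
  assumes A: "A \<in> sets borel"
  shows "emeasure circle_measure A = emeasure lborel ({0..2*pi} \<inter> cis -` A) / emeasure lborel {0..2*pi}"
proof -
  have cis: "cis \<in> borel_measurable borel"
    by (intro borel_measurable_continuous_onI continuous_on_cis continuous_on_id)
  have "cis -` A \<in> sets lborel" using measurable_sets[OF cis A] by simp
  moreover have "emeasure circle_measure A = emeasure (uniform_measure lborel {0..2*pi}) (cis -` A)"
    unfolding circle_measure_def using cis A by (subst emeasure_distr) auto
  ultimately show ?thesis by (simp add: emeasure_uniform_measure)
qed

lemma emeasure_circle_sphere: "emeasure circle_measure (sphere 0 1) = 1" "emeasure circle_measure UNIV = 1"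
proof -
  have "cis -` sphere 0 1 = UNIV" by auto
  then show "emeasure circle_measure (sphere 0 1) = 1" "emeasure circle_measure UNIV = 1"
    by (simp_all add: emeasure_circle divide_eq_1_ennreal)
qed

lemma sigma_finite_circle: "sigma_finite_measure circle_measure"
proof -
  have "finite_measure circle_measure"
    by (rule finite_measureI) (simp add: circle_measure_def[THEN arg_cong, of space] emeasure_circle_sphere)
  then show ?thesis by (rule finite_measure.axioms(1))
qed

lemma circle_measure_support:
  assumes x: "x \<in> sphere 0 1" "open U" "x \<in> U"
  shows "U \<inter> sphere 0 1 \<in> sets circle_measure \<and> 0 < emeasure circle_measure (U \<inter> sphere 0 1)"
proof -
  obtain \<theta> where \<theta>: "x = cis \<theta>" "0 \<le> \<theta>" "\<theta> < 2 * pi"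
  proof -
    have "x = cis (Arg2pi x)" using x(1) complex_norm_eq_1_exp[of x] by (simp add: cis_conv_exp Arg2pi_eq[symmetric] mult.commute)
    then show ?thesis using that[of "Arg2pi x"] Arg2pi_ge_0 Arg2pi_lt_2pi by blast
  qed
  have oV: "open (cis -` U)"
    using x(2) by (intro open_vimage continuous_on_cis continuous_on_id)
  have "emeasure circle_measure (U \<inter> sphere 0 1) = emeasure lborel ({0..2*pi} \<inter> cis -` (U \<inter> sphere 0 1)) / emeasure lborel {0..2*pi}"
    using x(2) by (intro emeasure_circle) auto
  also have "cis -` (U \<inter> sphere 0 1) = cis -` U" by auto
  also have "emeasure lborel ({0..2*pi} \<inter> cis -` U) / emeasure lborel {0..2*pi} > 0"
  proof -
    have "0 < emeasure lborel (cis -` U \<inter> {0..2*pi})"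
      using \<theta> x(3) oV by (intro emeasure_lborel_open_Icc_pos[of _ \<theta>]) auto
    then show ?thesis by (simp add: ennreal_zero_less_divide Int_commute)
  qed
  finally show ?thesis using x(2) by (auto simp: circle_measure_def)
qed

section \<open>Partial derivatives of power series\<close>

lemma cpartial_series:
  assumes g: "\<And>z. z \<in> {1..n} \<rightarrow>\<^sub>E ball 0 r \<Longrightarrow> g z = series_sum n K a e z"
    and a: "series_on n r K a e" and j: "j \<in> {1..n}" and r: "0 < r" and z: "z \<in> {1..n} \<rightarrow>\<^sub>E ball 0 r"
  shows "cpartial j g z = series_sum n K (\<lambda>k. a k * of_nat (e k j)) (\<lambda>k. dec j (e k)) z"
proof -
  have "((\<lambda>w. series_sum n K a e (z(j := w))) has_field_derivative
      series_sum n K (\<lambda>k. a k * of_nat (e k j)) (\<lambda>k. dec j (e k)) z) (at (z j))"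
    using z by (intro series_has_field_derivative[OF a j r]) (auto simp: PiE_iff)
  then have "((\<lambda>w. g (z(j := w))) has_field_derivative
      series_sum n K (\<lambda>k. a k * of_nat (e k j)) (\<lambda>k. dec j (e k)) z) (at (z j))"
  proof (rule has_field_derivative_transform_within_open[where S="ball 0 r"])
    show "z j \<in> ball 0 r" using z j by (auto simp: PiE_iff)
    fix w :: complex assume "w \<in> ball 0 r"
    then have "z(j := w) \<in> {1..n} \<rightarrow>\<^sub>E ball 0 r" using z j by (auto simp: PiE_iff extensional_def)
    then show "series_sum n K a e (z(j := w)) = g (z(j := w))" by (simp add: g)
  qed simp
  then show ?thesis unfolding cpartial_def by (rule DERIV_imp_deriv)
qed

lemma rpartial_series:
  assumes g: "\<And>x. x \<in> {1..n} \<rightarrow>\<^sub>E {-r<..<r} \<Longrightarrow> g x = series_sum n K a e (\<lambda>l. complex_of_real (x l))"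
    and a: "series_on n r K a e" and j: "j \<in> {1..n}" and r: "0 < r" and x: "x \<in> {1..n} \<rightarrow>\<^sub>E {-r<..<r}"
  shows "rpartial j g x = series_sum n K (\<lambda>k. a k * of_nat (e k j)) (\<lambda>k. dec j (e k)) (\<lambda>l. complex_of_real (x l))"
proof -
  let ?z = "\<lambda>l. complex_of_real (x l)"
  let ?D = "series_sum n K (\<lambda>k. a k * of_nat (e k j)) (\<lambda>k. dec j (e k)) ?z"
  have xl: "\<bar>x l\<bar> < r" if "l \<in> {1..n}" for l
  proof -
    have "x l \<in> {-r<..<r}" using x that by (rule PiE_mem)
    then show ?thesis by (simp add: abs_less_iff)
  qed
  have "((\<lambda>w. series_sum n K a e (?z(j := w))) has_field_derivative ?D) (at (?z j))"
    using xl by (intro series_has_field_derivative[OF a j r]) auto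
  then have "((\<lambda>s. series_sum n K a e (?z(j := complex_of_real s))) has_vector_derivative ?D) (at (x j))"
    by (rule has_vector_derivative_real_field)
  then have "((\<lambda>s. g (x(j := s))) has_vector_derivative ?D) (at (x j))"
  proof (rule has_vector_derivative_transform_within_open[where S="{-r<..<r}"])
    show "x j \<in> {-r<..<r}" using x j by (rule PiE_mem)
    fix s assume "s \<in> {-r<..<r}"
    then have "x(j := s) \<in> {1..n} \<rightarrow>\<^sub>E {-r<..<r}" using x j by (auto simp: PiE_iff extensional_def)
    moreover have "?z(j := complex_of_real s) = (\<lambda>l. complex_of_real ((x(j := s)) l))" by auto
    ultimately show "series_sum n K a e (?z(j := complex_of_real s)) = g (x(j := s))" by (simp add: g)
  qed simp
  then show ?thesis unfolding rpartial_def by (rule vector_derivative_at)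
qed

text \<open>\<open>hess_coeff c i j k\<close> times the monomial of exponent \<open>dec i (dec j k)\<close> is the derivative in the
  variables \<open>j\<close> and \<open>i\<close> of \<open>c k\<close> times the monomial of exponent \<open>k\<close>, for \<open>i = j\<close> as well; where the
  subtraction in \<^const>\<open>dec\<close> truncates, the coefficient is \<open>0\<close>.\<close>

definition hess_coeff :: "((nat \<Rightarrow> nat) \<Rightarrow> complex) \<Rightarrow> nat \<Rightarrow> nat \<Rightarrow> (nat \<Rightarrow> nat) \<Rightarrow> complex" where
  "hess_coeff c i j k = c k * of_nat (k j) * of_nat (dec j k i)"

lemma taylor_rep_series_sum:
  "taylor_rep_at n c z w \<Longrightarrow> w = series_sum n (multi_indices n) c (\<lambda>k. k) z"
  unfolding taylor_rep_at_def series_sum_def mon_def by (metis infsumI)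

lemma taylor_rep_series_on:
  assumes "\<And>\<rho>. 0 \<le> \<rho> \<Longrightarrow> \<rho> < r \<Longrightarrow> \<exists>z w. (\<forall>l\<in>{1..n}. z l = complex_of_real \<rho>) \<and> taylor_rep_at n c z w"
  shows "series_on n r (multi_indices n) c (\<lambda>k. k)"
  unfolding series_on_def
proof (intro allI impI)
  fix \<rho> :: real assume \<rho>: "0 \<le> \<rho>" "\<rho> < r"
  then obtain z w where zw: "\<forall>l\<in>{1..n}. z l = complex_of_real \<rho>" "taylor_rep_at n c z w" using assms by blast
  have "norm (c k * (\<Prod>j\<in>{1..n}. z j ^ k j)) = cmod (c k) * \<rho> ^ sum k {1..n}" for k
  proof -
    have "(\<Prod>j\<in>{1..n}. z j ^ k j) = (\<Prod>j\<in>{1..n}. complex_of_real \<rho> ^ k j)" using zw(1) by (intro prod.cong) auto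
    also have "\<dots> = complex_of_real \<rho> ^ sum k {1..n}" by (simp add: power_sum)
    finally show ?thesis using \<rho>(1) by (simp add: norm_mult norm_power)
  qed
  then show "(\<lambda>k. cmod (c k) * \<rho> ^ (\<Sum>l\<in>{1..n}. k l)) summable_on multi_indices n"
    using zw(2) unfolding taylor_rep_at_def by simp
qed

lemma polydisc_taylor_series_on:
  assumes "polydisc_taylor n r c f" shows "series_on n r (multi_indices n) c (\<lambda>k. k)"
proof (rule taylor_rep_series_on)
  fix \<rho> :: real assume "0 \<le> \<rho>" "\<rho> < r"
  then have "restrict (\<lambda>l. complex_of_real \<rho>) {1..n} \<in> {1..n} \<rightarrow>\<^sub>E ball 0 r" by auto
  then show "\<exists>z w. (\<forall>l\<in>{1..n}. z l = complex_of_real \<rho>) \<and> taylor_rep_at n c z w"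
    using assms unfolding polydisc_taylor_def by (metis restrict_apply')
qed

lemma cube_taylor_series_on:
  assumes "cube_taylor n r c f" shows "series_on n r (multi_indices n) c (\<lambda>k. k)"
proof (rule taylor_rep_series_on)
  fix \<rho> :: real assume "0 \<le> \<rho>" "\<rho> < r"
  then have "restrict (\<lambda>l. \<rho>) {1..n} \<in> {1..n} \<rightarrow>\<^sub>E {-r<..<r}" by auto
  then show "\<exists>z w. (\<forall>l\<in>{1..n}. z l = complex_of_real \<rho>) \<and> taylor_rep_at n c z w"
    using assms unfolding cube_taylor_def by (metis restrict_apply')
qed

lemma cpartial_cpartial:
  assumes f: "polydisc_taylor n r c f" and r: "0 < r" and ij: "i \<in> {1..n}" "j \<in> {1..n}"
    and z: "z \<in> {1..n} \<rightarrow>\<^sub>E ball 0 r"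
  shows "cpartial i (cpartial j f) z = series_sum n (multi_indices n) (hess_coeff c i j) (\<lambda>k. dec i (dec j k)) z"
proof -
  note a = polydisc_taylor_series_on[OF f]
  have "f y = series_sum n (multi_indices n) c (\<lambda>k. k) y" if "y \<in> {1..n} \<rightarrow>\<^sub>E ball 0 r" for y
    using f that unfolding polydisc_taylor_def by (intro taylor_rep_series_sum) auto
  from cpartial_series[OF cpartial_series[OF this a ij(2) r] series_on_deriv[OF a ij(2)] ij(1) r z]
  show ?thesis by (simp add: hess_coeff_def[abs_def])
qed

lemma rpartial_rpartial:
  assumes f: "cube_taylor n r c f" and r: "0 < r" and ij: "i \<in> {1..n}" "j \<in> {1..n}"
    and x: "x \<in> {1..n} \<rightarrow>\<^sub>E {-r<..<r}"
  shows "rpartial i (rpartial j f) x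
    = series_sum n (multi_indices n) (hess_coeff c i j) (\<lambda>k. dec i (dec j k)) (\<lambda>l. complex_of_real (x l))"
proof -
  note a = cube_taylor_series_on[OF f]
  have "f y = series_sum n (multi_indices n) c (\<lambda>k. k) (\<lambda>l. complex_of_real (y l))" if "y \<in> {1..n} \<rightarrow>\<^sub>E {-r<..<r}" for y
    using f that unfolding cube_taylor_def by (intro taylor_rep_series_sum) auto
  from rpartial_series[OF rpartial_series[OF this a ij(2) r] series_on_deriv[OF a ij(2)] ij(1) r x]
  show ?thesis by (simp add: hess_coeff_def[abs_def])
qed

lemma series_on_hess:
  assumes a: "series_on n r K c (\<lambda>k. k)" and ij: "i \<in> {1..n}" "j \<in> {1..n}"
  shows "series_on n r K (hess_coeff c i j) (\<lambda>k. dec i (dec j k))"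
  using series_on_deriv[OF series_on_deriv[OF a ij(2)] ij(1)] by (simp add: hess_coeff_def[abs_def])

lemma summable_hess_coeff:
  assumes a: "series_on n r K c (\<lambda>k. k)" and ij: "i \<in> {1..n}" "j \<in> {1..n}" and r: "1 < r"
  shows "(\<lambda>k. cmod (hess_coeff c i j k)) summable_on K"
  using series_on_hess[OF a ij] r unfolding series_on_def by (auto dest!: spec[of _ 1])

section \<open>Essential bounds of the second derivative\<close>

text \<open>The partial sums of the second derivative inherit the essential bound \<open>C\<close> up to \<open>\<eta>\<close>, at
  every point; \<open>\<iota>\<close> embeds the factor carrying the measure into the plane.\<close>

lemma essential_bound_partial_sums:
  fixes M :: "'a::topological_space measure" and \<iota> :: "'a \<Rightarrow> complex" and g :: "(nat \<Rightarrow> 'a) \<Rightarrow> complex"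
  assumes sf: "sigma_finite_measure M"
    and supp: "\<And>x U. x \<in> \<Omega> \<Longrightarrow> open U \<Longrightarrow> x \<in> U \<Longrightarrow> U \<inter> \<Omega> \<in> sets M \<and> 0 < emeasure M (U \<inter> \<Omega>)"
    and \<iota>: "continuous_on UNIV \<iota>" "\<And>x. x \<in> \<Omega> \<Longrightarrow> cmod (\<iota> x) \<le> 1"
    and a: "series_on n r K a e" and r: "1 < r"
    and g: "\<And>x. x \<in> {1..n} \<rightarrow>\<^sub>E \<Omega> \<Longrightarrow> g x = series_sum n K a e (\<lambda>l. \<iota> (x l))"
    and AE: "AE x in PiM {1..n} (\<lambda>_. M). cmod (g x) \<le> C" and \<eta>: "0 < \<eta>"
  shows "\<forall>\<^sub>F F in finite_subsets_at_top K. \<forall>z. (\<forall>l\<in>{1..n}. z l \<in> \<iota> ` \<Omega>) \<longrightarrow>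
    cmod (\<Sum>k\<in>F. a k * mon n (e k) z) \<le> C + \<eta>"
proof -
  define Y where "Y = {z. \<forall>l\<in>{1..n}. cmod (z l) \<le> 1}"
  have "uniform_limit Y (\<lambda>F z. \<Sum>k\<in>F. a k * mon n (e k) z) (series_sum n K a e) (finite_subsets_at_top K)"
    by (rule series_uniform_limit[OF a, of 1]) (use r in \<open>auto simp: Y_def\<close>)
  then have "\<forall>\<^sub>F F in finite_subsets_at_top K. \<forall>z\<in>Y. dist (\<Sum>k\<in>F. a k * mon n (e k) z) (series_sum n K a e z) < \<eta>"
    using \<eta> by (rule uniform_limitD)
  then show ?thesis
  proof eventually_elim
    case (elim F)
    define H where "H x = cmod (\<Sum>k\<in>F. a k * mon n (e k) (\<lambda>l. \<iota> (x l)))" for x :: "nat \<Rightarrow> 'a"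
    have contH: "continuous_on UNIV H"
      unfolding H_def mon_def
      by (intro continuous_intros continuous_on_compose2[OF \<iota>(1)] continuous_on_product_coordinates) auto
    have AEH: "AE x in PiM {1..n} (\<lambda>_. M). (\<forall>l\<in>{1..n}. x l \<in> \<Omega>) \<longrightarrow> H x \<le> C + \<eta>"
      using AE AE_space
    proof eventually_elim
      case (elim x)
      show ?case
      proof
        assume x: "\<forall>l\<in>{1..n}. x l \<in> \<Omega>"
        have "x \<in> extensional {1..n}" using elim(2) by (simp add: space_PiM PiE_iff)
        then have xP: "x \<in> {1..n} \<rightarrow>\<^sub>E \<Omega>" using x by (auto simp: PiE_iff)
        have "(\<lambda>l. \<iota> (x l)) \<in> Y" using x \<iota>(2) by (auto simp: Y_def)
        then have "dist (\<Sum>k\<in>F. a k * mon n (e k) (\<lambda>l. \<iota> (x l))) (g x) < \<eta>"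
          using \<open>\<forall>z\<in>Y. _\<close> by (auto simp: g[OF xP])
        then have "H x \<le> cmod (g x) + \<eta>"
          unfolding H_def dist_norm using norm_triangle_sub[of "\<Sum>k\<in>F. a k * mon n (e k) (\<lambda>l. \<iota> (x l))" "g x"] by linarith
        then show "H x \<le> C + \<eta>" using elim(1) by linarith
      qed
    qed
    show ?case
    proof (intro allI impI)
      fix z assume z: "\<forall>l\<in>{1..n}. z l \<in> \<iota> ` \<Omega>"
      then have "\<forall>l\<in>{1..n}. \<exists>y. y \<in> \<Omega> \<and> z l = \<iota> y" by blast
      then obtain y where y: "\<And>l. l \<in> {1..n} \<Longrightarrow> y l \<in> \<Omega> \<and> z l = \<iota> (y l)" by (metis (lifting))
      have "H (restrict y {1..n}) \<le> C + \<eta>"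
        using y by (intro AE_PiM_bound_everywhere[OF sf supp contH AEH]) auto
      moreover have "mon n e' (\<lambda>l. \<iota> (restrict y {1..n} l)) = mon n e' z" for e'
        unfolding mon_def using y by (intro prod.cong) auto
      ultimately show "cmod (\<Sum>k\<in>F. a k * mon n (e k) z) \<le> C + \<eta>" by (simp add: H_def)
    qed
  qed
qed

text \<open>The bound \<open>C0\<close> makes the set of essential bounds nonempty, so that its infimum is
  meaningful.\<close>

lemma Linf_norm_greatest:
  assumes ne: "0 \<le> C0" "AE x in M. cmod (g x) \<le> C0" and s: "0 \<le> s"
    and le: "\<And>C. 0 \<le> C \<Longrightarrow> AE x in M. cmod (g x) \<le> C \<Longrightarrow> P \<le> s * C"
  shows "P \<le> s * Linf_norm M g"
proof (cases "s = 0")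
  case True
  then show ?thesis using le[OF ne] by simp
next
  case False
  then have s: "s > 0" using s by simp
  have "P / s \<le> Linf_norm M g" unfolding Linf_norm_def
  proof (rule cInf_greatest)
    show "{C. 0 \<le> C \<and> (AE x in M. cmod (g x) \<le> C)} \<noteq> {}" using ne by blast
    fix C assume "C \<in> {C. 0 \<le> C \<and> (AE x in M. cmod (g x) \<le> C)}"
    then show "P / s \<le> C" using le[of C] s by (simp add: field_simps)
  qed
  then show ?thesis using s by (simp add: field_simps)
qed

lemma series_sum_bounded:
  assumes a: "series_on n r K a e" and r: "1 < r" and z: "\<And>l. l \<in> {1..n} \<Longrightarrow> cmod (z l) \<le> 1"
  shows "cmod (series_sum n K a e z) \<le> (\<Sum>\<^sub>\<infinity>k\<in>K. cmod (a k))"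
proof -
  have s: "(\<lambda>k. cmod (a k)) summable_on K" using a r unfolding series_on_def by (auto dest!: spec[of _ 1])
  have le: "norm (a k * mon n (e k) z) \<le> cmod (a k)" for k
  proof -
    have "cmod (mon n (e k) z) \<le> 1" using norm_mon_le[of n z 1 "e k"] z by simp
    then show ?thesis by (simp add: norm_mult mult_left_le)
  qed
  have s2: "(\<lambda>k. norm (a k * mon n (e k) z)) summable_on K"
    using s le by (intro summable_on_comparison_test[OF s]) auto
  have "cmod (series_sum n K a e z) \<le> (\<Sum>\<^sub>\<infinity>k\<in>K. norm (a k * mon n (e k) z))"
    unfolding series_sum_def by (rule norm_infsum_bound[OF s2])
  also have "\<dots> \<le> (\<Sum>\<^sub>\<infinity>k\<in>K. cmod (a k))" using le by (intro infsum_mono s s2) auto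
  finally show ?thesis .
qed

lemma AE_torus: "AE x in torus_measure n. x \<in> {1..n} \<rightarrow>\<^sub>E sphere 0 1"
proof -
  interpret product_sigma_finite "\<lambda>_::nat. circle_measure" by (simp add: product_sigma_finite_def sigma_finite_circle)
  let ?M = "PiM {1..n} (\<lambda>_. circle_measure)"
  have S: "sphere 0 1 \<in> sets circle_measure" by (simp add: circle_measure_def)
  have sp: "space circle_measure = UNIV" by (simp add: circle_measure_def)
  have B: "({1..n} \<rightarrow>\<^sub>E sphere 0 1) \<in> sets ?M" using S by (intro sets_PiM_I_finite) auto
  have e1: "emeasure ?M ({1..n} \<rightarrow>\<^sub>E sphere 0 1) = 1"
    using S by (subst emeasure_PiM) (auto simp: emeasure_circle_sphere)
  have "emeasure ?M ({1..n} \<rightarrow>\<^sub>E UNIV) = 1"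
    using sets.top[of circle_measure] by (subst emeasure_PiM) (auto simp: emeasure_circle_sphere sp)
  then have e2: "emeasure ?M (space ?M) = 1" by (simp add: space_PiM sp)
  have "emeasure ?M (space ?M - ({1..n} \<rightarrow>\<^sub>E sphere 0 1)) = emeasure ?M (space ?M) - emeasure ?M ({1..n} \<rightarrow>\<^sub>E sphere 0 1)"
    by (rule emeasure_compl[OF B]) (unfold e1, simp)
  then have "emeasure ?M (space ?M - ({1..n} \<rightarrow>\<^sub>E sphere 0 1)) = 0" unfolding e1 e2 by simp
  then show ?thesis unfolding torus_measure_def
    using B by (intro AE_I[where N="space ?M - ({1..n} \<rightarrow>\<^sub>E sphere 0 1)"]) auto
qed

lemma AE_cube: "AE x in cube_measure n. x \<in> {1..n} \<rightarrow>\<^sub>E {-1..1}"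
  by (rule AE_I2) (simp add: cube_measure_def space_PiM space_restrict_space)

lemma cube_support:
  assumes "x \<in> {-1..1::real}" "open U" "x \<in> U"
  shows "U \<inter> {-1..1} \<in> sets (restrict_space lborel {-1..1}) \<and> 0 < emeasure (restrict_space lborel {-1..1}) (U \<inter> {-1..1})"
proof -
  have "U \<inter> {-1..1} \<in> sets (restrict_space lborel {-1..1})"
    unfolding sets_restrict_space using assms(2) by (intro image_eqI[of _ _ U]) auto
  moreover have "emeasure (restrict_space lborel {-1..1}) (U \<inter> {-1..1}) = emeasure lborel (U \<inter> {-1..1})"
    by (rule emeasure_restrict_space) auto
  ultimately show ?thesis using emeasure_lborel_open_Icc_pos[OF assms(2,3,1)] by simp
qed

lemma sigma_finite_cube: "sigma_finite_measure (restrict_space lborel {-1..1::real})"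
  by (rule sigma_finite_measure_restrict_space) (auto simp: lborel.sigma_finite_measure_axioms)

text \<open>On the torus the maximum principle extends the bound to the closed polydisc.\<close>

lemma torus_bound_partial_sums:
  assumes f: "polydisc_taylor n r c f" and r: "1 < r" and ij: "i \<in> {1..n}" "j \<in> {1..n}"
    and AE: "AE x in torus_measure n. cmod (cpartial i (cpartial j f) x) \<le> C" and \<eta>: "0 < \<eta>"
  shows "\<forall>\<^sub>F F in finite_subsets_at_top (multi_indices n). \<forall>z. (\<forall>l\<in>{1..n}. z l \<in> cball 0 1) \<longrightarrow>
    cmod (\<Sum>k\<in>F. hess_coeff c i j k * mon n (dec i (dec j k)) z) \<le> C + \<eta>"
proof -
  have a: "series_on n r (multi_indices n) (hess_coeff c i j) (\<lambda>k. dec i (dec j k))"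
    by (rule series_on_hess[OF polydisc_taylor_series_on[OF f] ij])
  have "\<forall>\<^sub>F F in finite_subsets_at_top (multi_indices n). \<forall>z. (\<forall>l\<in>{1..n}. z l \<in> (\<lambda>x. x) ` sphere 0 1) \<longrightarrow>
    cmod (\<Sum>k\<in>F. hess_coeff c i j k * mon n (dec i (dec j k)) z) \<le> C + \<eta>"
  proof (rule essential_bound_partial_sums[OF sigma_finite_circle circle_measure_support _ _ a r _ _ \<eta>])
    show "AE x in PiM {1..n} (\<lambda>_. circle_measure). cmod (cpartial i (cpartial j f) x) \<le> C"
      using AE unfolding torus_measure_def .
    fix x :: "nat \<Rightarrow> complex" assume x: "x \<in> {1..n} \<rightarrow>\<^sub>E sphere 0 1"
    then have "x \<in> {1..n} \<rightarrow>\<^sub>E ball 0 r" using r by (auto simp: PiE_iff)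
    then show "cpartial i (cpartial j f) x = series_sum n (multi_indices n) (hess_coeff c i j) (\<lambda>k. dec i (dec j k)) (\<lambda>l. x l)"
      using cpartial_cpartial[OF f _ ij] r by simp
  qed auto
  moreover have "\<forall>\<^sub>F F in finite_subsets_at_top (multi_indices n). finite F"
    by (rule eventually_finite_subsets_at_top_weakI)
  ultimately show ?thesis
  proof eventually_elim
    case (elim F)
    show ?case
    proof (intro allI impI)
      fix z assume z: "\<forall>l\<in>{1..n}. z l \<in> cball (0::complex) 1"
      show "cmod (\<Sum>k\<in>F. hess_coeff c i j k * mon n (dec i (dec j k)) z) \<le> C + \<eta>"
      proof (rule polynomial_max_modulus[OF elim(2)])
        fix y :: "nat \<Rightarrow> complex" assume "\<And>l. l \<in> {1..n} \<Longrightarrow> cmod (y l) = 1"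
        then have "\<forall>l\<in>{1..n}. y l \<in> (\<lambda>x. x) ` sphere 0 1" by simp
        with elim(1) show "cmod (\<Sum>k\<in>F. hess_coeff c i j k * mon n (dec i (dec j k)) y) \<le> C + \<eta>" by blast
      next
        fix l assume "l \<in> {1..n}"
        then show "cmod (z l) \<le> 1" using z by simp
      qed
    qed
  qed
qed

lemma cube_bound_partial_sums:
  assumes f: "cube_taylor n r c f" and r: "1 < r" and ij: "i \<in> {1..n}" "j \<in> {1..n}"
    and AE: "AE x in cube_measure n. cmod (rpartial i (rpartial j f) x) \<le> C" and \<eta>: "0 < \<eta>"
  shows "\<forall>\<^sub>F F in finite_subsets_at_top (multi_indices n). \<forall>z. (\<forall>l\<in>{1..n}. z l \<in> complex_of_real ` {-1..1}) \<longrightarrow>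
    cmod (\<Sum>k\<in>F. hess_coeff c i j k * mon n (dec i (dec j k)) z) \<le> C + \<eta>"
proof -
  have a: "series_on n r (multi_indices n) (hess_coeff c i j) (\<lambda>k. dec i (dec j k))"
    by (rule series_on_hess[OF cube_taylor_series_on[OF f] ij])
  show ?thesis
  proof (rule essential_bound_partial_sums[OF sigma_finite_cube cube_support _ _ a r _ _ \<eta>])
    show "AE x in PiM {1..n} (\<lambda>_. restrict_space lborel {-1..1}). cmod (rpartial i (rpartial j f) x) \<le> C"
      using AE unfolding cube_measure_def .
    fix x :: "nat \<Rightarrow> real" assume x: "x \<in> {1..n} \<rightarrow>\<^sub>E {-1..1}"
    have "x l \<in> {-r<..<r}" if "l \<in> {1..n}" for l using PiE_mem[OF x that] r by auto
    then have "x \<in> {1..n} \<rightarrow>\<^sub>E {-r<..<r}" using x by (auto simp: PiE_iff)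
    then show "rpartial i (rpartial j f) x = series_sum n (multi_indices n) (hess_coeff c i j) (\<lambda>k. dec i (dec j k)) (\<lambda>l. complex_of_real (x l))"
      using rpartial_rpartial[OF f _ ij] r by simp
  qed (auto intro!: continuous_intros simp: abs_le_iff)
qed

section \<open>Second-order derivatives of operator polynomials\<close>

text \<open>First and second derivative of \<open>s \<mapsto> (x + s v)\<^sup>k\<close> at \<open>0\<close>.\<close>

definition pd1 :: "'a::complex_hilbert bop \<Rightarrow> 'a bop \<Rightarrow> nat \<Rightarrow> 'a bop" where
  "pd1 x v k = (\<Sum>p<k. x ^ p * v * x ^ (k - 1 - p))"

definition pd2 :: "'a::complex_hilbert bop \<Rightarrow> 'a bop \<Rightarrow> nat \<Rightarrow> 'a bop" where
  "pd2 x v k = 2 *\<^sub>R (\<Sum>p<k. x ^ p * v * pd1 x v (k - 1 - p))"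

lemma pd1_Suc: "pd1 x v (Suc k) = v * x ^ k + x * pd1 x v k"
  unfolding pd1_def by (subst sum.lessThan_Suc_shift) (simp add: sum_distrib_left mult.assoc)

lemma pd2_Suc: "pd2 x v (Suc k) = 2 *\<^sub>R (v * pd1 x v k) + x * pd2 x v k"
  unfolding pd2_def by (subst sum.lessThan_Suc_shift) (simp add: sum_distrib_left mult.assoc scaleR_add_right)

lemma affine_has_vector_derivative:
  "((\<lambda>s. a + s *\<^sub>R v) has_vector_derivative v) (at s within S)"
  by (auto intro!: derivative_eq_intros)

lemma power_has_vector_derivative:
  "((\<lambda>s. (a + s *\<^sub>R v) ^ k) has_vector_derivative pd1 (a + s *\<^sub>R v) v k) (at s within S)"
proof (induction k)
  case (Suc k)
  from bounded_bilinear.has_vector_derivative[OF bounded_bilinear_mult affine_has_vector_derivative Suc]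
  show ?case by (simp add: pd1_Suc add.commute)
qed (simp add: pd1_def)

lemma pd1_has_vector_derivative:
  "((\<lambda>s. pd1 (a + s *\<^sub>R v) v k) has_vector_derivative pd2 (a + s *\<^sub>R v) v k) (at s within S)"
proof (induction k)
  case (Suc k)
  let ?x = "\<lambda>s. a + s *\<^sub>R v"
  have "((\<lambda>s. v * ?x s ^ k + ?x s * pd1 (?x s) v k) has_vector_derivative
      (v * pd1 (?x s) v k + (?x s * pd2 (?x s) v k + v * pd1 (?x s) v k))) (at s within S)"
    by (intro has_vector_derivative_add bounded_bilinear.has_vector_derivative[OF bounded_bilinear_mult]
        bounded_linear.has_vector_derivative[OF bounded_linear_mult_right]
        affine_has_vector_derivative power_has_vector_derivative Suc)
  then show ?case by (simp add: pd1_Suc pd2_Suc scaleR_2 add_ac)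
qed (simp add: pd1_def pd2_def)

lemma op_deriv_eqI:
  assumes t: "t \<in> {0..1}" and eq: "\<And>s. s \<in> {0..1} \<Longrightarrow> Y s = blin (Z s)"
    and Z: "(Z has_vector_derivative D) (at t within {0..1})"
  shows "op_deriv Y t = blin D"
proof -
  have 1: "((\<lambda>s. blin (Z s)) has_vector_derivative blin D) (at t within {0..1})"
    by (rule bounded_linear.has_vector_derivative[OF bounded_linear_blin Z])
  have "(Y has_vector_derivative blin D) (at t within {0..1})"
    by (rule has_vector_derivative_transform[OF t eq 1])
  then have "vector_derivative Y (at t within cbox 0 1) = blin D"
    using t by (intro vector_derivative_within_cbox) auto
  then show ?thesis by (simp add: op_deriv_def)
qed

lemma op_pow_blin: "op_pow (blin a) k = blin (a ^ k)"
  by (induction k) (simp_all add: op_pow_def blin_simps)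

lemma op_prod_blin: "op_prod (map (\<lambda>l. blin (f l)) L) = blin (prod_list (map f L))"
  by (induction L) (simp_all add: op_prod_def blin_simps)

text \<open>The operators \<open>D_term\<close> of the ring, with the derivatives evaluated.\<close>

definition d_term :: "nat \<Rightarrow> (nat \<Rightarrow> 'a::complex_hilbert bop) \<Rightarrow> (nat \<Rightarrow> 'a bop) \<Rightarrow> nat \<Rightarrow> nat \<Rightarrow> (nat \<Rightarrow> nat) \<Rightarrow> 'a bop" where
  "d_term n x v i j k = prod_list (map (\<lambda>l.
      if l = i \<and> l = j then pd2 (x l) (v l) (k l)
      else if l = i \<or> l = j then pd1 (x l) (v l) (k l)
      else x l ^ k l) [1..<Suc n])"

lemma D_term_blin:
  assumes X: "\<And>l s. l \<in> {1..n} \<Longrightarrow> s \<in> {0..1} \<Longrightarrow> X l s = blin (a l + s *\<^sub>R v l)" and t: "t \<in> {0..1}"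
  shows "D_term n X i j t k = blin (d_term n (\<lambda>l. a l + t *\<^sub>R v l) v i j k)"
proof -
  have pw: "op_pow (X l s) m = blin ((a l + s *\<^sub>R v l) ^ m)" if "l \<in> {1..n}" "s \<in> {0..1}" for l s m
    using X[OF that] by (simp add: op_pow_blin)
  have d1: "op_deriv (\<lambda>s. op_pow (X l s) m) s = blin (pd1 (a l + s *\<^sub>R v l) (v l) m)" if "l \<in> {1..n}" "s \<in> {0..1}" for l s m
    by (rule op_deriv_eqI[OF that(2) pw[OF that(1)] power_has_vector_derivative])
  have d2: "op_deriv (op_deriv (\<lambda>s. op_pow (X l s) m)) t = blin (pd2 (a l + t *\<^sub>R v l) (v l) m)" if "l \<in> {1..n}" for l m
    by (rule op_deriv_eqI[OF t d1[OF that] pd1_has_vector_derivative])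
  show ?thesis
    unfolding D_term_def d_term_def op_prod_blin[symmetric]
    by (intro arg_cong[of _ _ op_prod] map_cong) (auto simp: d2 d1[OF _ t] pw[OF _ t])
qed

text \<open>Expanding the derivatives, the term of index \<open>k\<close> is \<open>dt_mult\<close> times the sum over
  \<open>dt_index\<close> of the operators \<open>pre v\<^sub>i mid v\<^sub>j post\<close>, where \<open>pre\<close>, \<open>mid\<close> and \<open>post\<close>
  are the products of \<open>x\<close> along the following words.\<close>

definition powers_word :: "(nat \<Rightarrow> nat) \<Rightarrow> nat list \<Rightarrow> nat list" where
  "powers_word k L = concat (map (\<lambda>l. replicate (k l) l) L)"

definition dt_index :: "nat \<Rightarrow> nat \<Rightarrow> (nat \<Rightarrow> nat) \<Rightarrow> (nat \<times> nat) set" where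
  "dt_index i j k = (if i < j then {..<k i} \<times> {..<k j} else (SIGMA p:{..<k j}. {..<k j - 1 - p}))"

definition dt_mult :: "nat \<Rightarrow> nat \<Rightarrow> real" where
  "dt_mult i j = (if i < j then 1 else 2)"

definition dt_pre :: "nat \<Rightarrow> (nat \<Rightarrow> nat) \<Rightarrow> nat \<times> nat \<Rightarrow> nat list" where
  "dt_pre i k u = powers_word k [1..<i] @ replicate (fst u) i"

definition dt_mid :: "nat \<Rightarrow> nat \<Rightarrow> (nat \<Rightarrow> nat) \<Rightarrow> nat \<times> nat \<Rightarrow> nat list" where
  "dt_mid i j k u = (if i < j then replicate (k i - 1 - fst u) i @ powers_word k [Suc i..<j] else []) @ replicate (snd u) j"

definition dt_post :: "nat \<Rightarrow> nat \<Rightarrow> nat \<Rightarrow> (nat \<Rightarrow> nat) \<Rightarrow> nat \<times> nat \<Rightarrow> nat list" where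
  "dt_post n i j k u = replicate (if i < j then k j - 1 - snd u else k j - 1 - fst u - 1 - snd u) j @ powers_word k [Suc j..<Suc n]"

lemma finite_dt_index [simp]: "finite (dt_index i j k)"
  by (auto simp: dt_index_def)

lemma card_dt_index_le:
  assumes "i \<le> j" shows "card (dt_index i j k) \<le> k j * dec j k i"
proof (cases "i < j")
  case True
  then show ?thesis by (simp add: dt_index_def dec_def)
next
  case False
  have "card (SIGMA p:{..<k j}. {..<k j - 1 - p}) = (\<Sum>p<k j. k j - 1 - p)" by simp
  also have "\<dots> \<le> (\<Sum>p<k j. k j - 1)" by (intro sum_mono) auto
  finally show ?thesis using False assms by (simp add: dt_index_def dec_def)
qed

lemma prod_list_powers_word: "prod_list (map f (powers_word k L)) = prod_list (map (\<lambda>l. f l ^ k l) L)"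
  by (induction L) (simp_all add: powers_word_def prod_list_replicate)

lemma set_powers_word: "set (powers_word k L) \<subseteq> set L"
  by (auto simp: powers_word_def)

lemma dt_words_subset:
  assumes "1 \<le> i" "i \<le> j" "j \<le> n"
  shows "set (dt_pre i k u) \<subseteq> {1..n}" "set (dt_mid i j k u) \<subseteq> {1..n}" "set (dt_post n i j k u) \<subseteq> {1..n}"
  using assms set_powers_word[of k "[1..<i]"] set_powers_word[of k "[Suc i..<j]"] set_powers_word[of k "[Suc j..<Suc n]"]
  by (auto simp: dt_pre_def dt_mid_def dt_post_def split: if_splits)

lemma upt_split: "i \<le> j \<Longrightarrow> j \<le> k \<Longrightarrow> [i..<k] = [i..<j] @ [j..<k]"
  by (metis le_add_diff_inverse upt_add_eq_append)

lemma d_term_expansion: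
  assumes "1 \<le> i" "i \<le> j" "j \<le> n"
  shows "d_term n x v i j k = dt_mult i j *\<^sub>R (\<Sum>u\<in>dt_index i j k.
    prod_list (map x (dt_pre i k u)) * v i * prod_list (map x (dt_mid i j k u)) * v j * prod_list (map x (dt_post n i j k u)))"
proof -
  let ?P = "\<lambda>L. prod_list (map (\<lambda>l. x l ^ k l) L)"
  let ?f = "\<lambda>l. if l = i \<and> l = j then pd2 (x l) (v l) (k l)
      else if l = i \<or> l = j then pd1 (x l) (v l) (k l) else x l ^ k l"
  have plain: "map ?f L = map (\<lambda>l. x l ^ k l) L" if "i \<notin> set L" "j \<notin> set L" for L
    using that by auto
  show ?thesis
  proof (cases "i < j")
    case True
    have "[1..<Suc n] = [1..<i] @ i # [Suc i..<j] @ j # [Suc j..<Suc n]"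
    proof -
      have "[1..<Suc n] = [1..<i] @ [i..<Suc n]" using upt_split[of 1 i "Suc n"] assms by simp
      also have "[i..<Suc n] = i # [Suc i..<Suc n]" using assms by (intro upt_conv_Cons) simp
      also have "[Suc i..<Suc n] = [Suc i..<j] @ [j..<Suc n]" using upt_split[of "Suc i" j "Suc n"] True assms by simp
      also have "[j..<Suc n] = j # [Suc j..<Suc n]" using assms by (intro upt_conv_Cons) simp
      finally show ?thesis .
    qed
    then have "d_term n x v i j k = ?P [1..<i] * (pd1 (x i) (v i) (k i) * (?P [Suc i..<j] * (pd1 (x j) (v j) (k j) * ?P [Suc j..<Suc n])))"
      unfolding d_term_def using True by (simp add: plain del: upt_Suc)
    also have "\<dots> = (\<Sum>p<k i. \<Sum>q<k j. ?P [1..<i] * ((x i ^ p * v i * x i ^ (k i - 1 - p)) * (?P [Suc i..<j] * ((x j ^ q * v j * x j ^ (k j - 1 - q)) * ?P [Suc j..<Suc n]))))"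
      unfolding pd1_def sum_distrib_left sum_distrib_right by (rule sum.swap)
    also have "\<dots> = (\<Sum>u\<in>{..<k i} \<times> {..<k j}. ?P [1..<i] * ((x i ^ fst u * v i * x i ^ (k i - 1 - fst u)) * (?P [Suc i..<j] * ((x j ^ snd u * v j * x j ^ (k j - 1 - snd u)) * ?P [Suc j..<Suc n]))))"
      by (simp add: sum.cartesian_product case_prod_beta)
    finally show ?thesis using True
      by (simp add: dt_mult_def dt_index_def dt_pre_def dt_mid_def dt_post_def prod_list_powers_word prod_list_replicate mult.assoc del: upt_Suc)
  next
    case False
    then have ij: "i = j" using assms by simp
    have spl: "[1..<Suc n] = [1..<j] @ j # [Suc j..<Suc n]"
    proof -
      have "[1..<Suc n] = [1..<j] @ [j..<Suc n]" using upt_split[of 1 j "Suc n"] assms by simp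
      also have "[j..<Suc n] = j # [Suc j..<Suc n]" using assms by (intro upt_conv_Cons) simp
      finally show ?thesis .
    qed
    have p1: "map ?f [1..<j] = map (\<lambda>l. x l ^ k l) [1..<j]" and p2: "map ?f [Suc j..<Suc n] = map (\<lambda>l. x l ^ k l) [Suc j..<Suc n]"
      using ij by (intro plain; simp)+
    have fj: "?f j = pd2 (x j) (v j) (k j)" using ij by simp
    have "d_term n x v i j k = ?P [1..<j] * (pd2 (x j) (v j) (k j) * ?P [Suc j..<Suc n])"
      unfolding d_term_def spl map_append list.map p1 p2 fj by simp
    also have "\<dots> = 2 *\<^sub>R (\<Sum>p<k j. \<Sum>q<k j - 1 - p. ?P [1..<j] * ((x j ^ p * v j * (x j ^ q * v j * x j ^ (k j - 1 - p - 1 - q))) * ?P [Suc j..<Suc n]))"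
      unfolding pd2_def pd1_def by (simp add: sum_distrib_left sum_distrib_right)
    also have "\<dots> = 2 *\<^sub>R (\<Sum>u\<in>(SIGMA p:{..<k j}. {..<k j - 1 - p}). ?P [1..<j] * ((x j ^ fst u * v j * (x j ^ snd u * v j * x j ^ (k j - 1 - fst u - 1 - snd u))) * ?P [Suc j..<Suc n]))"
      by (simp add: sum.Sigma case_prod_beta)
    finally show ?thesis using ij
      by (simp add: dt_mult_def dt_index_def dt_pre_def dt_mid_def dt_post_def prod_list_powers_word prod_list_replicate mult.assoc del: upt_Suc)
  qed
qed

section \<open>The symbol of the second-order derivative\<close>

lemma prod_list_upt: "prod_list (map f [a..<b]) = (\<Prod>l\<in>{a..<b}. f l :: complex)"
  by (simp add: prod.distinct_set_conv_list[symmetric])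

text \<open>The symbol is the mixed divided difference of the polynomial in the variables \<open>i\<close> and \<open>j\<close>
  at \<open>lam\<close> and \<open>mu\<close> (for \<open>i = j\<close>: twice the second divided difference at
  \<open>lam\<^sub>j, lam\<^sub>j, mu\<^sub>j\<close>), hence an average of the second derivative over a convex hull.\<close>

lemma symbol_bound:
  assumes ij: "1 \<le> i" "i \<le> j" "j \<le> n" and F: "finite F" and B: "convex B"
    and M: "\<And>z. (\<And>l. l \<in> {1..n} \<Longrightarrow> z l \<in> B) \<Longrightarrow> cmod (\<Sum>k\<in>F. hess_coeff c i j k * mon n (dec i (dec j k)) z) \<le> M"
    and lam: "\<And>l. l \<in> {1..n} \<Longrightarrow> lam l \<in> B" and mu: "\<And>l. l \<in> {1..n} \<Longrightarrow> mu l \<in> B"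
  shows "cmod (\<Sum>k\<in>F. \<Sum>u\<in>dt_index i j k. (c k * of_real (dt_mult i j)) *
      (prod_list (map lam (dt_post n i j k u @ dt_pre i k u)) * prod_list (map mu (dt_mid i j k u)))) \<le> M"
proof (cases "i < j")
  case True
  define \<nu> where "\<nu> l = (if i < l \<and> l < j then mu l else lam l)" for l
  have \<nu>: "\<nu> l \<in> B" if "l \<in> {1..n}" for l using lam mu that by (simp add: \<nu>_def)
  define Rk where "Rk k = (\<Prod>l\<in>{1..n}-{i}-{j}. \<nu> l ^ k l)" for k :: "nat \<Rightarrow> nat"
  have Rk: "Rk k = (\<Prod>l\<in>{1..<i}. lam l ^ k l) * (\<Prod>l\<in>{Suc i..<j}. mu l ^ k l) * (\<Prod>l\<in>{Suc j..<Suc n}. lam l ^ k l)" for k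
  proof -
    have "{1..n} - {i} - {j} = ({1..<i} \<union> {Suc i..<j}) \<union> {Suc j..<Suc n}" using True ij by auto
    then have "Rk k = (\<Prod>l\<in>{1..<i}. \<nu> l ^ k l) * (\<Prod>l\<in>{Suc i..<j}. \<nu> l ^ k l) * (\<Prod>l\<in>{Suc j..<Suc n}. \<nu> l ^ k l)"
    proof -
      have d1: "({1..<i} \<union> {Suc i..<j}) \<inter> {Suc j..<Suc n} = {}" and d2: "{1..<i} \<inter> {Suc i..<j} = {}"
        using True by auto
      assume eq: "{1..n} - {i} - {j} = ({1..<i} \<union> {Suc i..<j}) \<union> {Suc j..<Suc n}"
      show ?thesis unfolding Rk_def eq
        by (simp only: prod.union_disjoint[OF _ _ d1] prod.union_disjoint[OF _ _ d2] finite_Un finite_atLeastLessThan)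
    qed
    also have "\<dots> = (\<Prod>l\<in>{1..<i}. lam l ^ k l) * (\<Prod>l\<in>{Suc i..<j}. mu l ^ k l) * (\<Prod>l\<in>{Suc j..<Suc n}. lam l ^ k l)"
      using True by (intro arg_cong2[of _ _ _ _ "(*)"] prod.cong) (auto simp: \<nu>_def)
    finally show ?thesis .
  qed
  have sym: "(\<Sum>u\<in>dt_index i j k. (c k * of_real (dt_mult i j)) *
      (prod_list (map lam (dt_post n i j k u @ dt_pre i k u)) * prod_list (map mu (dt_mid i j k u))))
      = c k * Rk k * dd (k i) (lam i) (mu i) * dd (k j) (mu j) (lam j)" for k
  proof -
    have "(\<Sum>u\<in>dt_index i j k. (c k * of_real (dt_mult i j)) *
      (prod_list (map lam (dt_post n i j k u @ dt_pre i k u)) * prod_list (map mu (dt_mid i j k u))))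
      = (\<Sum>u\<in>{..<k i} \<times> {..<k j}. c k * Rk k * (lam i ^ fst u * mu i ^ (k i - 1 - fst u)) * (mu j ^ snd u * lam j ^ (k j - 1 - snd u)))"
      using True unfolding Rk
      by (intro sum.cong) (auto simp: dt_index_def dt_mult_def dt_pre_def dt_mid_def dt_post_def
          prod_list_powers_word prod_list_replicate prod_list_upt mult_ac simp del: upt_Suc)
    also have "\<dots> = c k * Rk k * dd (k i) (lam i) (mu i) * dd (k j) (mu j) (lam j)"
      unfolding dd_def mult.assoc sum_product by (simp add: sum_distrib_left sum.cartesian_product case_prod_beta mult_ac)
    finally show ?thesis .
  qed
  have hess: "hess_coeff c i j k * mon n (dec i (dec j k)) (\<nu>(i := w1, j := w2))
      = (c k * Rk k * (of_nat (k j) * w2 ^ (k j - 1))) * (of_nat (k i) * w1 ^ (k i - 1))" for k w1 w2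
  proof -
    have i: "i \<in> {1..n}" and j: "j \<in> {1..n} - {i}" using True ij by auto
    have "mon n (dec i (dec j k)) (\<nu>(i := w1, j := w2)) = w1 ^ (k i - 1) * (\<Prod>l\<in>{1..n}-{i}. (\<nu>(i := w1, j := w2)) l ^ dec i (dec j k) l)"
      using True by (simp add: mon_split[OF i]) (simp add: dec_def)
    also have "(\<Prod>l\<in>{1..n}-{i}. (\<nu>(i := w1, j := w2)) l ^ dec i (dec j k) l)
      = w2 ^ (k j - 1) * (\<Prod>l\<in>{1..n}-{i}-{j}. (\<nu>(i := w1, j := w2)) l ^ dec i (dec j k) l)"
      using True by (subst prod.remove[OF _ j]) (auto simp: dec_def)
    also have "(\<Prod>l\<in>{1..n}-{i}-{j}. (\<nu>(i := w1, j := w2)) l ^ dec i (dec j k) l) = Rk k"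
      unfolding Rk_def by (rule prod.cong) (auto simp: dec_def)
    finally have m: "mon n (dec i (dec j k)) (\<nu>(i := w1, j := w2)) = w1 ^ (k i - 1) * (w2 ^ (k j - 1) * Rk k)" .
    show ?thesis unfolding hess_coeff_def m using True by (simp add: dec_def mult_ac)
  qed
  have i: "i \<in> {1..n}" and j: "j \<in> {1..n}" using ij by auto
  have segB: "w \<in> B" if "w \<in> closed_segment a b" "a \<in> B" "b \<in> B" for w a b
    using that B convex_contains_segment by blast
  have "cmod (\<Sum>k\<in>F. (c k * Rk k * dd (k i) (lam i) (mu i)) * dd (k j) (mu j) (lam j)) \<le> M"
  proof (rule dd_bound[OF F])
    fix w2 assume w2: "w2 \<in> closed_segment (mu j) (lam j)"
    have "cmod (\<Sum>k\<in>F. (c k * Rk k * (of_nat (k j) * w2 ^ (k j - 1))) * dd (k i) (lam i) (mu i)) \<le> M"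
    proof (rule dd_bound[OF F])
      fix w1 assume w1: "w1 \<in> closed_segment (lam i) (mu i)"
      have "(\<nu>(i := w1, j := w2)) l \<in> B" if "l \<in> {1..n}" for l
        using segB[OF w1 lam[OF i] mu[OF i]] segB[OF w2 mu[OF j] lam[OF j]] \<nu>[OF that] by simp
      then show "cmod (\<Sum>k\<in>F. (c k * Rk k * (of_nat (k j) * w2 ^ (k j - 1))) * (of_nat (k i) * w1 ^ (k i - 1))) \<le> M"
        unfolding hess[symmetric] by (rule M)
    qed
    then show "cmod (\<Sum>k\<in>F. (c k * Rk k * dd (k i) (lam i) (mu i)) * (of_nat (k j) * w2 ^ (k j - 1))) \<le> M"
      by (simp only: mult_ac)
  qed
  then show ?thesis by (simp only: sym)
next
  case False
  then have eq: "i = j" using ij by simp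
  have j: "j \<in> {1..n}" using ij by auto
  define Rk where "Rk k = (\<Prod>l\<in>{1..n}-{j}. lam l ^ k l)" for k :: "nat \<Rightarrow> nat"
  have Rk: "Rk k = (\<Prod>l\<in>{1..<j}. lam l ^ k l) * (\<Prod>l\<in>{Suc j..<Suc n}. lam l ^ k l)" for k
  proof -
    have "{1..n} - {j} = {1..<j} \<union> {Suc j..<Suc n}" using ij by auto
    moreover have "{1..<j} \<inter> {Suc j..<Suc n} = {}" by auto
    ultimately show ?thesis unfolding Rk_def by (simp only: prod.union_disjoint finite_atLeastLessThan)
  qed
  have sym: "(\<Sum>u\<in>dt_index i j k. (c k * of_real (dt_mult i j)) *
      (prod_list (map lam (dt_post n i j k u @ dt_pre i k u)) * prod_list (map mu (dt_mid i j k u))))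
      = c k * Rk k * dd2 (k j) (lam j) (mu j)" for k
  proof -
    have "(\<Sum>u\<in>dt_index i j k. (c k * of_real (dt_mult i j)) *
      (prod_list (map lam (dt_post n i j k u @ dt_pre i k u)) * prod_list (map mu (dt_mid i j k u))))
      = (\<Sum>u\<in>(SIGMA p:{..<k j}. {..<k j - 1 - p}). c k * Rk k * (2 * (lam j ^ fst u * (mu j ^ snd u * lam j ^ (k j - 1 - fst u - 1 - snd u)))))"
      using eq unfolding Rk
      by (intro sum.cong) (auto simp: dt_index_def dt_mult_def dt_pre_def dt_mid_def dt_post_def
          prod_list_powers_word prod_list_replicate prod_list_upt mult_ac simp del: upt_Suc)
    also have "\<dots> = (\<Sum>p<k j. \<Sum>q<k j - 1 - p. c k * Rk k * (2 * (lam j ^ p * (mu j ^ q * lam j ^ (k j - 1 - p - 1 - q)))))"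
      by (simp add: sum.Sigma case_prod_beta)
    finally show ?thesis unfolding dd2_def dd_def sum_distrib_left .
  qed
  have hess: "hess_coeff c i j k * mon n (dec i (dec j k)) (lam(j := w))
      = (c k * Rk k) * (of_nat (k j) * of_nat (k j - 1) * w ^ (k j - 2))" for k w
  proof -
    have "mon n (dec i (dec j k)) (lam(j := w)) = w ^ (k j - 2) * (\<Prod>l\<in>{1..n}-{j}. lam l ^ dec i (dec j k) l)"
      using eq by (simp add: mon_upd[OF j]) (simp add: dec_def numeral_2_eq_2)
    also have "(\<Prod>l\<in>{1..n}-{j}. lam l ^ dec i (dec j k) l) = Rk k"
      unfolding Rk_def eq by (rule prod.cong) (auto simp: dec_def)
    finally have m: "mon n (dec i (dec j k)) (lam(j := w)) = w ^ (k j - 2) * Rk k" .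
    show ?thesis unfolding hess_coeff_def m using eq by (simp add: dec_def mult_ac)
  qed
  have "cmod (\<Sum>k\<in>F. (c k * Rk k) * dd2 (k j) (lam j) (mu j)) \<le> M"
  proof (rule dd2_bound[OF F])
    fix w assume w: "w \<in> closed_segment (lam j) (mu j)"
    then have "w \<in> B" using B lam[OF j] mu[OF j] convex_contains_segment by blast
    then have "(lam(j := w)) l \<in> B" if "l \<in> {1..n}" for l using lam[OF that] by simp
    then show "cmod (\<Sum>k\<in>F. (c k * Rk k) * (of_nat (k j) * of_nat (k j - 1) * w ^ (k j - 2))) \<le> M"
      unfolding hess[symmetric] by (rule M)
  qed
  then show ?thesis by (simp only: sym)
qed

section \<open>The trace of the second-order derivative\<close>

lemma norm_word_le:
  fixes x :: "nat \<Rightarrow> 'a::complex_hilbert bop"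
  assumes x: "\<And>l. l \<in> {1..n} \<Longrightarrow> norm (x l) \<le> 1" and "set js \<subseteq> {1..n}"
  shows "norm (prod_list (map x js)) \<le> 1"
  using assms(2)
proof (induction js)
  case Nil then show ?case by (simp add: norm_one_bop_le)
next
  case (Cons j js)
  have "norm (x j * prod_list (map x js)) \<le> norm (x j) * norm (prod_list (map x js))" by (rule norm_mult_ineq)
  also have "\<dots> \<le> 1 * 1" using Cons x[of j] by (intro mult_mono) auto
  finally show ?case by simp
qed

context normed_trace_ideal
begin

context
  fixes n i j :: nat and x v :: "nat \<Rightarrow> 'h bop"
  assumes ij: "1 \<le> i" "i \<le> j" "j \<le> n"
    and v: "v i \<in> W" "v j \<in> W"
begin

lemma quad_in_I: "A * v i * B * v j * C \<in> I"
  by (rule I_right[OF I_quad[OF v]])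

lemma d_term_in_I: "d_term n x v i j k \<in> I"
  unfolding d_term_expansion[OF ij] by (rule I_scaleR[OF I_sum[OF quad_in_I]])

text \<open>Cyclicity moves \<open>post\<close> to the front, where it joins \<open>pre\<close> in a single word.\<close>

lemma tr_d_term:
  "\<tau> (d_term n x v i j k) = (\<Sum>u\<in>dt_index i j k. of_real (dt_mult i j) *
     \<tau> (prod_list (map x (dt_post n i j k u @ dt_pre i k u)) * v i * prod_list (map x (dt_mid i j k u)) * v j))"
proof -
  have rot: "\<tau> (A * v i * B * v j * C) = \<tau> (C * A * v i * B * v j)" for A B C
    using tr_commute[OF I_quad[OF v, of A B], of C] by (simp add: mult.assoc)
  show ?thesis
    unfolding d_term_expansion[OF ij] tr_scaleR[OF I_sum[OF quad_in_I]] tr_sum[OF quad_in_I]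
    by (simp add: rot sum_distrib_left)
qed

lemma N_d_term_le:
  assumes x: "\<And>l. l \<in> {1..n} \<Longrightarrow> norm (x l) \<le> 1"
  shows "N (d_term n x v i j k) \<le> 2 * (N2 (v i) * N2 (v j)) * real (k j * dec j k i)"
proof -
  let ?T = "\<lambda>u. prod_list (map x (dt_pre i k u)) * v i * prod_list (map x (dt_mid i j k u)) * v j * prod_list (map x (dt_post n i j k u))"
  have nn: "0 \<le> N2 (v i) * N2 (v j)" using N2_nonneg v by simp
  have T: "?T u \<in> I" for u by (rule quad_in_I)
  have NT: "N (?T u) \<le> N2 (v i) * N2 (v j)" for u
  proof -
    have "N (?T u) \<le> norm (prod_list (map x (dt_pre i k u))) * norm (prod_list (map x (dt_mid i j k u)))
        * norm (prod_list (map x (dt_post n i j k u))) * (N2 (v i) * N2 (v j))"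
      by (rule N_quad_le[OF v])
    also have "\<dots> \<le> 1 * 1 * 1 * (N2 (v i) * N2 (v j))"
    proof (rule mult_right_mono[OF _ nn])
      note w = norm_word_le[OF x]
      show "norm (prod_list (map x (dt_pre i k u))) * norm (prod_list (map x (dt_mid i j k u)))
        * norm (prod_list (map x (dt_post n i j k u))) \<le> 1 * 1 * 1"
        using w[OF _ dt_words_subset(1)[OF ij]] w[OF _ dt_words_subset(2)[OF ij]] w[OF _ dt_words_subset(3)[OF ij]]
        by (intro mult_mono) auto
    qed
    finally show ?thesis by simp
  qed
  have "N (d_term n x v i j k) = dt_mult i j * N (\<Sum>u\<in>dt_index i j k. ?T u)"
    unfolding d_term_expansion[OF ij] N_scaleR[OF I_sum[OF T]] by (simp add: dt_mult_def)
  also have "\<dots> \<le> 2 * (\<Sum>u\<in>dt_index i j k. N (?T u))"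
    by (rule mult_mono[OF _ N_sum[OF T] _ N_nonneg[OF I_sum[OF T]]]) (simp_all add: dt_mult_def)
  also have "\<dots> \<le> 2 * (real (card (dt_index i j k)) * (N2 (v i) * N2 (v j)))"
    using NT by (intro mult_left_mono sum_bounded_above) auto
  also have "\<dots> \<le> 2 * (real (k j * dec j k i) * (N2 (v i) * N2 (v j)))"
    using card_dt_index_le[OF ij(2)] nn by (intro mult_left_mono mult_right_mono of_nat_mono) auto
  finally show ?thesis by (simp add: mult_ac)
qed

text \<open>Each partial sum is a finite double sum, whose symbol is bounded by \<open>C + \<eta>\<close> once the partial
  sum of \<open>\<partial>\<^sub>i \<partial>\<^sub>j f\<close> is; the trace is continuous for the convergence in \<open>N\<close>.\<close>

theorem trace_second_derivative_bound:
  assumes res: "joint_resolution \<Omega> n x Q \<zeta> E" and B: "\<Omega> \<subseteq> B" "convex B"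
    and bd: "\<And>\<eta>. 0 < \<eta> \<Longrightarrow> \<forall>\<^sub>F F in finite_subsets_at_top K. \<forall>z. (\<forall>l\<in>{1..n}. z l \<in> B) \<longrightarrow>
       cmod (\<Sum>k\<in>F. hess_coeff c i j k * mon n (dec i (dec j k)) z) \<le> C + \<eta>"
    and S: "S \<in> I" and lim: "((\<lambda>F. N ((\<Sum>k\<in>F. sc (c k) * d_term n x v i j k) - S)) \<longlongrightarrow> 0) (finite_subsets_at_top K)"
  shows "cmod (\<tau> S) \<le> sqrt (Re (\<tau> (star (v i) * v i))) * sqrt (Re (\<tau> (star (v j) * v j))) * C"
proof -
  define s where "s = sqrt (Re (\<tau> (star (v i) * v i))) * sqrt (Re (\<tau> (star (v j) * v j)))"
  have s0: "0 \<le> s"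
  proof -
    have "star (v i) * v i \<in> I" "star (v j) * v j \<in> I" using v W by auto
    then have "0 \<le> Re (\<tau> (star (v i) * v i))" "0 \<le> Re (\<tau> (star (v j) * v j))"
      using tr_pos pos_star_mult by blast+
    then show ?thesis unfolding s_def by simp
  qed
  define P where "P F = (\<Sum>k\<in>F. sc (c k) * d_term n x v i j k)" for F
  have PI: "P F \<in> I" for F unfolding P_def by (rule I_sum[OF I_left[OF d_term_in_I]])
  have "((\<lambda>F. \<tau> (P F) - \<tau> S) \<longlongrightarrow> 0) (finite_subsets_at_top K)"
  proof -
    obtain M where M: "M > 0" "\<And>A. A \<in> I \<Longrightarrow> cmod (\<tau> A) \<le> M * N A" using tr_bound by blast
    have g: "((\<lambda>F. M * N (P F - S)) \<longlongrightarrow> 0) (finite_subsets_at_top K)"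
      using tendsto_mult_left[OF lim, of M] by (simp add: P_def)
    have "norm (\<tau> (P F) - \<tau> S) \<le> M * N (P F - S)" for F
      using M(2)[OF I_diff[OF PI S], of F] unfolding tr_diff[OF PI S] .
    then show ?thesis by (intro Lim_null_comparison[OF _ g] always_eventually allI)
  qed
  then have tend: "((\<lambda>F. \<tau> (P F)) \<longlongrightarrow> \<tau> S) (finite_subsets_at_top K)" by (simp add: LIM_zero_iff)
  have fin: "\<forall>\<^sub>F F in finite_subsets_at_top K. finite F"
    by (rule eventually_finite_subsets_at_top_weakI)
  have step: "cmod (\<tau> S) \<le> s * C + s * \<eta>" if \<eta>: "0 < \<eta>" for \<eta>
  proof (rule tendsto_upperbound[OF tendsto_norm[OF tend]])
    show "\<forall>\<^sub>F F in finite_subsets_at_top K. cmod (\<tau> (P F)) \<le> s * C + s * \<eta>"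
      using bd[OF \<eta>] fin
    proof eventually_elim
      case (elim F)
      let ?U = "Sigma F (dt_index i j)"
      let ?t = "\<lambda>k u. \<tau> (prod_list (map x (dt_post n i j k u @ dt_pre i k u)) * v i * prod_list (map x (dt_mid i j k u)) * v j)"
      have "\<tau> (P F) = (\<Sum>k\<in>F. c k * \<tau> (d_term n x v i j k))"
        unfolding P_def by (simp add: tr_sum tr_sc d_term_in_I I_left)
      also have "\<dots> = (\<Sum>k\<in>F. \<Sum>u\<in>dt_index i j k. c k * of_real (dt_mult i j) * ?t k u)"
        unfolding tr_d_term sum_distrib_left by (simp only: mult.assoc)
      also have "\<dots> = (\<Sum>z\<in>?U. c (fst z) * of_real (dt_mult i j) * ?t (fst z) (snd z))"
        using elim(2) by (simp add: sum.Sigma case_prod_beta)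
      also have "cmod \<dots> \<le> (C + \<eta>) * s"
        unfolding s_def
      proof (rule trace_double_sum_bound[OF res v, where c="\<lambda>z. c (fst z) * of_real (dt_mult i j)"
            and \<alpha>="\<lambda>z. dt_post n i j (fst z) (snd z) @ dt_pre i (fst z) (snd z)" and \<beta>="\<lambda>z. dt_mid i j (fst z) (snd z)"])
        show "finite ?U" using elim(2) by auto
        fix z show "set (dt_post n i j (fst z) (snd z) @ dt_pre i (fst z) (snd z)) \<subseteq> {1..n} \<and> set (dt_mid i j (fst z) (snd z)) \<subseteq> {1..n}"
          using dt_words_subset[OF ij] by simp
      next
        fix lam mu assume lm: "\<And>l. l \<in> {1..n} \<Longrightarrow> lam l \<in> \<Omega>" "\<And>l. l \<in> {1..n} \<Longrightarrow> mu l \<in> \<Omega>"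
        have "cmod (\<Sum>k\<in>F. \<Sum>u\<in>dt_index i j k. c k * of_real (dt_mult i j) *
            (prod_list (map lam (dt_post n i j k u @ dt_pre i k u)) * prod_list (map mu (dt_mid i j k u)))) \<le> C + \<eta>"
          using elim B lm by (intro symbol_bound[OF ij _ B(2)]) auto
        then show "cmod (\<Sum>z\<in>?U. c (fst z) * of_real (dt_mult i j) *
            (prod_list (map lam (dt_post n i j (fst z) (snd z) @ dt_pre i (fst z) (snd z))) * prod_list (map mu (dt_mid i j (fst z) (snd z))))) \<le> C + \<eta>"
          using elim(2) by (simp add: sum.Sigma case_prod_beta)
      qed
      finally show ?case by (simp add: algebra_simps)
    qed
  qed simp
  have "cmod (\<tau> S) \<le> s * C + e" if "0 < e" for e
  proof -
    have "cmod (\<tau> S) \<le> s * C + s * (e / (s + 1))" using that s0 by (intro step) simp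
    also have "s * (e / (s + 1)) \<le> e" using that s0 by (simp add: field_simps)
    finally show ?thesis by simp
  qed
  then have "cmod (\<tau> S) \<le> s * C" by (rule field_le_epsilon)
  then show ?thesis by (simp add: s_def)
qed

end

text \<open>Completeness concerns sequences, the sum the net of all finite sets of indices: the limit is
  taken along sets \<open>A p\<close> outside of which the remaining terms sum to less than \<open>1 / (p + 1)\<close>.\<close>

lemma complete_abs_summable:
  assumes complete: "\<And>T :: nat \<Rightarrow> 'h bop. range T \<subseteq> I \<Longrightarrow> (\<forall>e>0. \<exists>m. \<forall>p\<ge>m. \<forall>q\<ge>m. N (T p - T q) < e) \<Longrightarrow>
      \<exists>S\<in>I. (\<lambda>p. N (T p - S)) \<longlonglongrightarrow> 0"
    and T: "\<And>k. k \<in> K \<Longrightarrow> T k \<in> I" and sm: "(\<lambda>k. N (T k)) summable_on K"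
  shows "\<exists>S\<in>I. ((\<lambda>F. N ((\<Sum>k\<in>F. T k) - S)) \<longlongrightarrow> 0) (finite_subsets_at_top K)"
proof -
  let ?g = "\<lambda>k. N (T k)"
  define \<Sigma> where "\<Sigma> F = (\<Sum>k\<in>F. T k)" for F
  have \<Sigma>I: "\<Sigma> F \<in> I" if "F \<subseteq> K" for F unfolding \<Sigma>_def using that T by (intro I_sum) auto
  have g0: "0 \<le> ?g k" if "k \<in> K" for k using N_nonneg[OF T[OF that]] .
  define s where "s = infsum ?g K"
  have le_s: "sum ?g F \<le> s" if "finite F" "F \<subseteq> K" for F
    unfolding s_def using that sm g0 by (intro finite_sum_le_infsum) auto
  have "\<exists>F. finite F \<and> F \<subseteq> K \<and> s - 1 / real (Suc p) < sum ?g F" for p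
  proof -
    have "(sum ?g \<longlongrightarrow> s) (finite_subsets_at_top K)"
      unfolding s_def using has_sum_infsum[OF sm] by (simp add: has_sum_def)
    then have "\<forall>\<^sub>F F in finite_subsets_at_top K. s - 1 / real (Suc p) < sum ?g F"
      by (rule order_tendstoD) simp
    then show ?thesis unfolding eventually_finite_subsets_at_top by blast
  qed
  then obtain A where A: "\<And>p. finite (A p)" "\<And>p. A p \<subseteq> K" "\<And>p. s - 1 / real (Suc p) < sum ?g (A p)" by metis
  have tail: "sum ?g G < 1 / real (Suc p)" if "finite G" "G \<subseteq> K" "G \<inter> A p = {}" for G p
  proof -
    have "sum ?g (G \<union> A p) = sum ?g G + sum ?g (A p)" using that A(1) by (intro sum.union_disjoint) auto
    moreover have "sum ?g (G \<union> A p) \<le> s" using that A by (intro le_s) auto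
    ultimately show ?thesis using A(3)[of p] by simp
  qed
  have Nsum: "N (\<Sigma> G) \<le> sum ?g G" if "G \<subseteq> K" for G
    unfolding \<Sigma>_def using that T by (intro N_sum) auto
  have dec: "\<Sigma> F - \<Sigma> G = \<Sigma> (F - G) - \<Sigma> (G - F)" if "finite F" "finite G" for F G
  proof -
    have "\<Sigma> F = \<Sigma> (F \<inter> G) + \<Sigma> (F - G)" "\<Sigma> G = \<Sigma> (G \<inter> F) + \<Sigma> (G - F)"
      unfolding \<Sigma>_def using that by (simp_all add: sum.Int_Diff[of F T G] sum.Int_Diff[of G T F])
    then show ?thesis by (simp add: Int_commute)
  qed
  have Ndiff: "N (X - Y) \<le> N X + N Y" if "X \<in> I" "Y \<in> I" for X Y
    using N_add[OF that(1) I_minus[OF that(2)]] N_scaleR[OF that(2), of "-1"] by simp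
  have Cauchy: "N (\<Sigma> (A p) - \<Sigma> (A q)) < 1 / real (Suc p) + 1 / real (Suc q)" for p q
  proof -
    have "N (\<Sigma> (A p) - \<Sigma> (A q)) \<le> N (\<Sigma> (A p - A q)) + N (\<Sigma> (A q - A p))"
      unfolding dec[OF A(1) A(1)] using A(2) by (intro Ndiff \<Sigma>I) auto
    also have "\<dots> \<le> sum ?g (A p - A q) + sum ?g (A q - A p)"
      using A(2) by (intro add_mono Nsum) auto
    also have "\<dots> < 1 / real (Suc q) + 1 / real (Suc p)"
      using A by (intro add_strict_mono tail) auto
    finally show ?thesis by simp
  qed
  have small: "\<exists>m. \<forall>p\<ge>m. 1 / real (Suc p) < e" if "0 < e" for e :: real
  proof -
    obtain m where m: "1 / real (Suc m) < e" using \<open>0 < e\<close> by (rule nat_approx_posE)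
    have "1 / real (Suc p) < e" if "p \<ge> m" for p
    proof -
      have "1 / real (Suc p) \<le> 1 / real (Suc m)" using that by (intro frac_le) auto
      then show ?thesis using m by simp
    qed
    then show ?thesis by blast
  qed
  have "\<exists>S\<in>I. (\<lambda>p. N (\<Sigma> (A p) - S)) \<longlonglongrightarrow> 0"
  proof (rule complete)
    show "range (\<lambda>p. \<Sigma> (A p)) \<subseteq> I" using \<Sigma>I A(2) by auto
    show "\<forall>e>0. \<exists>m. \<forall>p\<ge>m. \<forall>q\<ge>m. N (\<Sigma> (A p) - \<Sigma> (A q)) < e"
    proof (intro allI impI)
      fix e :: real assume "0 < e"
      then obtain m where m: "\<forall>p\<ge>m. 1 / real (Suc p) < e / 2" using small[of "e / 2"] by auto
      have "N (\<Sigma> (A p) - \<Sigma> (A q)) < e" if "p \<ge> m" "q \<ge> m" for p q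
      proof -
        have "1 / real (Suc p) + 1 / real (Suc q) < e / 2 + e / 2" using m that by (intro add_strict_mono) auto
        then show ?thesis using Cauchy[of p q] by simp
      qed
      then show "\<exists>m. \<forall>p\<ge>m. \<forall>q\<ge>m. N (\<Sigma> (A p) - \<Sigma> (A q)) < e" by blast
    qed
  qed
  then obtain S where S: "S \<in> I" "(\<lambda>p. N (\<Sigma> (A p) - S)) \<longlonglongrightarrow> 0" by blast
  have "((\<lambda>F. N (\<Sigma> F - S)) \<longlongrightarrow> 0) (finite_subsets_at_top K)"
  proof (rule tendstoI)
    fix e :: real assume e: "0 < e"
    obtain m where m: "\<forall>p\<ge>m. 1 / real (Suc p) < e / 2" using small[of "e / 2"] e by auto
    have "\<forall>\<^sub>F p in sequentially. N (\<Sigma> (A p) - S) < e / 2" using S(2) by (rule order_tendstoD) (use e in simp)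
    then have "\<forall>\<^sub>F p in sequentially. p \<ge> m \<and> N (\<Sigma> (A p) - S) < e / 2"
      using eventually_ge_at_top[of m] by eventually_elim simp
    then obtain p where p: "p \<ge> m" "N (\<Sigma> (A p) - S) < e / 2"
      using eventually_happens'[OF sequentially_bot] by blast
    have "dist (N (\<Sigma> F - S)) 0 < e" if F: "finite F" "A p \<subseteq> F" "F \<subseteq> K" for F
    proof -
      have "\<Sigma> F - S = \<Sigma> (F - A p) + (\<Sigma> (A p) - S)"
        using sum.subset_diff[OF F(2,1), of T] by (simp add: \<Sigma>_def)
      then have "N (\<Sigma> F - S) \<le> N (\<Sigma> (F - A p)) + N (\<Sigma> (A p) - S)"
      proof -
        have "\<Sigma> (F - A p) \<in> I" "\<Sigma> (A p) - S \<in> I"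
          using F A(2)[of p] S(1) by (auto intro!: \<Sigma>I I_diff)
        then show "\<Sigma> F - S = \<Sigma> (F - A p) + (\<Sigma> (A p) - S) \<Longrightarrow> ?thesis" by (simp only: N_add)
      qed
      also have "N (\<Sigma> (F - A p)) \<le> sum ?g (F - A p)" using F by (intro Nsum) auto
      also have "\<dots> < 1 / real (Suc p)" using F by (intro tail) auto
      finally have "N (\<Sigma> F - S) < e" using m p by force
      moreover have "0 \<le> N (\<Sigma> F - S)" by (rule N_nonneg[OF I_diff[OF \<Sigma>I[OF F(3)] S(1)]])
      ultimately show ?thesis by (simp add: dist_real_def)
    qed
    then show "\<forall>\<^sub>F F in finite_subsets_at_top K. dist (N (\<Sigma> F - S)) 0 < e"
      unfolding eventually_finite_subsets_at_top
      by (intro exI[of _ "A p"] conjI A allI impI) (elim conjE)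
  qed
  then show ?thesis using S(1) unfolding \<Sigma>_def by blast
qed

lemma N_limit_imp_has_sum:
  assumes T: "\<And>k. k \<in> K \<Longrightarrow> T k \<in> I" and S: "S \<in> I"
    and lim: "((\<lambda>F. N ((\<Sum>k\<in>F. T k) - S)) \<longlongrightarrow> 0) (finite_subsets_at_top K)"
  shows "(T has_sum S) K"
proof -
  obtain C where C: "C > 0" "\<And>B. B \<in> I \<Longrightarrow> norm B \<le> C * N B" using N_dom by blast
  have "((\<lambda>F. C * N ((\<Sum>k\<in>F. T k) - S)) \<longlongrightarrow> C * 0) (finite_subsets_at_top K)"
    by (rule tendsto_mult_left[OF lim])
  then have l: "((\<lambda>F. C * N ((\<Sum>k\<in>F. T k) - S)) \<longlongrightarrow> 0) (finite_subsets_at_top K)" by simp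
  have "((\<lambda>F. (\<Sum>k\<in>F. T k) - S) \<longlongrightarrow> 0) (finite_subsets_at_top K)"
  proof (rule Lim_null_comparison[OF _ l])
    show "\<forall>\<^sub>F F in finite_subsets_at_top K. norm ((\<Sum>k\<in>F. T k) - S) \<le> C * N ((\<Sum>k\<in>F. T k) - S)"
      using T S by (intro eventually_finite_subsets_at_top_weakI C I_diff I_sum) auto
  qed
  then show ?thesis unfolding has_sum_def by (simp add: LIM_zero_iff)
qed

end

section \<open>The trace bound for commuting tuples\<close>

lemma normed_trace_ideal_blin:
  assumes ideal: "normed_ideal I N" and trace: "positive_trace I \<tau>" "trace_bounded I N \<tau>"
    and sqrt_ideal: "normed_ideal (ideal_sqrt I) N2"
    and hoelder: "\<forall>S\<in>ideal_sqrt I. \<forall>T\<in>ideal_sqrt I. N (S o\<^sub>L T) \<le> N2 S * N2 T"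
  shows "normed_trace_ideal {a. blin a \<in> I} {a. blin a \<in> ideal_sqrt I} (\<lambda>a. N (blin a)) (\<lambda>a. N2 (blin a)) (\<lambda>a. \<tau> (blin a))"
proof -
  have op: "op_ideal I" "op_ideal (ideal_sqrt I)" using ideal sqrt_ideal by (simp_all add: normed_ideal_def)
  have tr: "ideal_trace I \<tau>" using trace(1) by (simp add: positive_trace_def)
  have cl: "\<And>B. B \<in> I \<Longrightarrow> clinear_op B" using op(1) by (simp add: op_ideal_def)
  have star_abs: "abs_sq (blin A) = blin (star A * A)" for A :: "'a bop"
    by (simp add: abs_sq_def blin_simps star.rep_eq)
  show ?thesis
  proof (unfold_locales, goal_cases)
    case 1 then show ?case using op(1) by (simp add: op_ideal_def blin_simps)
  next
    case (2 A B) then show ?case using op(1) by (simp add: op_ideal_def blin_simps)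
  next
    case (3 B A C) then show ?case using op(1) by (simp add: op_ideal_def blin_simps)
  next
    case 4 then show ?case by (simp add: ideal_sqrt_def star_abs)
  next
    case (5 A B) then show ?case using op(2) by (simp add: op_ideal_def blin_simps)
  next
    case (6 B A C) then show ?case using op(2) by (simp add: op_ideal_def blin_simps)
  next
    case (7 B a) then show ?case using ideal by (simp add: normed_ideal_def blin_sc_mult)
  next
    case (8 B) then show ?case using ideal by (simp add: normed_ideal_def)
  next
    case 9 then show ?case using ideal op(1) by (simp add: normed_ideal_def op_ideal_def blin_simps)
  next
    case (10 A B) then show ?case using ideal by (simp add: normed_ideal_def blin_simps)
  next
    case 11
    have "\<exists>K>0. \<forall>B\<in>I. norm B \<le> K * N B" using ideal unfolding normed_ideal_def by (elim conjE)
    then obtain K where K: "K > 0" "\<And>B. B \<in> I \<Longrightarrow> norm B \<le> K * N B" by blast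
    have "norm B \<le> K * N (blin B)" if "blin B \<in> I" for B
      using K(2)[OF that] by (simp add: blin_simps)
    then show ?case using K(1) by (intro exI[of _ K] conjI ballI) simp_all
  next
    case (12 B A C)
    then have "N (blin A o\<^sub>L blin B o\<^sub>L blin C) \<le> norm (blin A) * N (blin B) * norm (blin C)"
      using ideal unfolding normed_ideal_def by simp
    then show ?case by (simp only: blin_simps)
  next
    case (13 B) then show ?case using sqrt_ideal by (simp add: normed_ideal_def)
  next
    case (14 B A C)
    then have "N2 (blin A o\<^sub>L blin B o\<^sub>L blin C) \<le> norm (blin A) * N2 (blin B) * norm (blin C)"
      using sqrt_ideal unfolding normed_ideal_def by simp
    then show ?case by (simp only: blin_simps)
  next
    case (15 S T) then show ?case using hoelder by (simp add: blin_simps)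
  next
    case (16 A B) then show ?case using tr by (simp add: ideal_trace_def blin_simps)
  next
    case (17 A a) then show ?case using tr by (simp add: ideal_trace_def blin_sc_mult)
  next
    case (18 A B)
    then have "\<tau> (blin A o\<^sub>L blin B) = \<tau> (blin B o\<^sub>L blin A)"
      using tr clinear_blin[of B] unfolding ideal_trace_def by blast
    then show ?case by (simp only: blin_simps)
  next
    case (19 A) then show ?case using trace(1) by (simp add: positive_trace_def pos_iff_positive_op)
  next
    case 20 then show ?case using trace(2) unfolding trace_bounded_def by blast
  qed
qed

lemma normal_dilation_joint_resolution:
  fixes X :: "nat \<Rightarrow> 'h::complex_hilbert \<Rightarrow>\<^sub>L 'h" and x :: "nat \<Rightarrow> 'h bop"
  assumes dil: "has_normal_dilation TYPE('k::complex_hilbert) n X"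
    and X: "\<And>l. l \<in> {1..n} \<Longrightarrow> X l = blin (x l)"
  shows "\<exists>Q \<zeta> E. joint_resolution (sphere 0 1) n x Q \<zeta> E"
proof -
  obtain J :: "'h \<Rightarrow>\<^sub>L 'k" and U where J: "clinear_op J" "\<And>x. norm (J x) = norm x"
    and U: "commuting_contractions n U" "\<And>j. j \<in> {1..n} \<Longrightarrow> normal_op (U j)"
    and d: "\<And>js x. set js \<subseteq> {1..n} \<Longrightarrow>
       J (op_prod (map X js) x) = orth_proj (range J) (op_prod (map U js) (J x))"
    using dil unfolding has_normal_dilation_def by blast
  define u where "u l = Bop (U l)" for l
  have Ul: "U l = blin (u l)" if "l \<in> {1..n}" for l
    using U(2)[OF that] by (simp add: u_def normal_op_def blin_Bop)
  have inj: "a = b" if "blin a = blin b" for a b :: "'k bop" using that by (simp add: blin_inject)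
  have "\<exists>Q \<zeta> E. joint_resolution (sphere 0 1) n u Q \<zeta> E"
  proof (rule commuting_normal_joint_resolution)
    fix i j assume "i \<in> {1..n}" "j \<in> {1..n}"
    then show "u i * u j = u j * u i"
      using U(1) Ul by (intro inj) (simp add: commuting_contractions_def blin_simps)
  next
    fix l assume l: "l \<in> {1..n}"
    then have "norm (U l) \<le> 1" using U(1) by (simp add: commuting_contractions_def contraction_def)
    then have "norm (u l) \<le> 1" using Ul[OF l] by (simp add: blin_simps)
    moreover have "star (u l) * u l = u l * star (u l)"
      using U(2)[OF l] Ul[OF l] by (intro inj) (simp add: normal_op_def blin_simps star.rep_eq)
    ultimately show "star (u l) * u l = u l * star (u l) \<and> norm (u l) \<le> 1" by simp
  qed
  then obtain Q \<zeta> E where res: "joint_resolution (sphere 0 1) n u Q \<zeta> E" by blast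
  have "\<exists>E'. joint_resolution (sphere 0 1) n x Q \<zeta> E'"
  proof (rule joint_resolution_compression[OF J res])
    fix js y z assume js: "set js \<subseteq> {1..n}"
    have m: "map X js = map (\<lambda>l. blin (x l)) js" "map U js = map (\<lambda>l. blin (u l)) js"
      using js X Ul by auto
    have e: "op_prod (map X js) = blin (prod_list (map x js))" "op_prod (map U js) = blin (prod_list (map u js))"
      by (simp_all only: m op_prod_blin)
    have "cinner (prod_list (map x js) \<cdot> y) z = cinner (J (prod_list (map x js) \<cdot> y)) (J z)"
      by (simp add: isometry_cinner[OF J])
    also have "J (prod_list (map x js) \<cdot> y) = orth_proj (range J) (prod_list (map u js) \<cdot> J y)"
      using d[OF js, of y] unfolding e app.rep_eq .
    also have "cinner (orth_proj (range J) (prod_list (map u js) \<cdot> J y)) (J z) = cinner (prod_list (map u js) \<cdot> J y) (J z)"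
      by (rule cinner_orth_proj_range[OF J])
    finally show "cinner (prod_list (map x js) \<cdot> y) z = cinner (prod_list (map u js) \<cdot> J y) (J z)" .
  qed
  then show ?thesis by blast
qed

theorem theorem4p6:
  fixes I :: "('h::complex_hilbert \<Rightarrow>\<^sub>L 'h) set"
    and N N2 :: "('h \<Rightarrow>\<^sub>L 'h) \<Rightarrow> real"
    and \<tau> :: "('h \<Rightarrow>\<^sub>L 'h) \<Rightarrow> complex"
    and A B V :: "nat \<Rightarrow> 'h \<Rightarrow>\<^sub>L 'h"
    and X :: "nat \<Rightarrow> real \<Rightarrow> 'h \<Rightarrow>\<^sub>L 'h"
    and n :: nat and t :: real
  assumes separable: "\<exists>S :: 'h set. countable S \<and> closure S = UNIV"
    and ideal: "normed_ideal I N"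
    and trace: "positive_trace I \<tau>" "trace_bounded I N \<tau>"
    and sqrt_ideal: "normed_ideal (ideal_sqrt I) N2"
    and hoelder: "\<forall>S\<in>ideal_sqrt I. \<forall>T\<in>ideal_sqrt I. N (S o\<^sub>L T) \<le> N2 S * N2 T"
    and A: "commuting_contractions n A"
    and B: "commuting_contractions n B"
    and V: "\<forall>j\<in>{1..n}. V j = B j - A j \<and> V j \<in> ideal_sqrt I"
    and X: "\<forall>j\<in>{1..n}. \<forall>s\<in>{0..1}. X j s = A j + s *\<^sub>R V j"
    and t: "t \<in> {0..1}"
    and Xt: "commuting_contractions n (\<lambda>j. X j t)"
    and dilation: "has_normal_dilation TYPE('k::complex_hilbert) n (\<lambda>j. X j t)"
  shows
    "(\<forall>\<epsilon>>0. \<forall>c f. polydisc_taylor n (1 + \<epsilon>) c f \<longrightarrow>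
        (\<forall>i j. 1 \<le> i \<and> i \<le> j \<and> j \<le> n \<longrightarrow> D_op_traceable I N n c X i j t \<longrightarrow>
           D_op n c X i j t \<in> I \<and>
           cmod (\<tau> (D_op n c X i j t))
             \<le> sqrt (Re (\<tau> (abs_sq (V i)))) * sqrt (Re (\<tau> (abs_sq (V j))))
                * Linf_norm (torus_measure n) (cpartial i (cpartial j f))))
     \<and>
     ((\<forall>j\<in>{1..n}. self_adjoint_op (X j t)) \<longrightarrow>
      (\<forall>\<epsilon>>0. \<forall>c f. cube_taylor n (1 + \<epsilon>) c f \<longrightarrow>
        (\<forall>i j. 1 \<le> i \<and> i \<le> j \<and> j \<le> n \<longrightarrow> D_op_traceable I N n c X i j t \<longrightarrow>
           D_op n c X i j t \<in> I \<and>
           cmod (\<tau> (D_op n c X i j t))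
             \<le> sqrt (Re (\<tau> (abs_sq (V i)))) * sqrt (Re (\<tau> (abs_sq (V j))))
                * Linf_norm (cube_measure n) (rpartial i (rpartial j f)))))"
proof -
  define I' where "I' = {a. blin a \<in> I}"
  define N' where "N' a = N (blin a)" for a
  define \<tau>' where "\<tau>' a = \<tau> (blin a)" for a
  define a where "a l = Bop (A l)" for l
  define v where "v l = Bop (V l)" for l
  define x where "x l = a l + t *\<^sub>R v l" for l
  interpret normed_trace_ideal I' "{a. blin a \<in> ideal_sqrt I}" N' "\<lambda>a. N2 (blin a)" \<tau>'
    unfolding I'_def N'_def[abs_def] \<tau>'_def[abs_def]
    by (rule normed_trace_ideal_blin[OF ideal trace sqrt_ideal hoelder])
  have al: "A l = blin (a l)" if "l \<in> {1..n}" for l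
    using A that by (simp add: a_def commuting_contractions_def contraction_def blin_Bop)
  have vl: "V l = blin (v l)" if "l \<in> {1..n}" for l
  proof -
    have "V l \<in> ideal_sqrt I" using V that by blast
    then have "clinear_op (V l)" by (simp add: ideal_sqrt_def)
    then show ?thesis by (simp only: v_def blin_Bop)
  qed
  have vW: "v l \<in> {a. blin a \<in> ideal_sqrt I}" if "l \<in> {1..n}" for l
  proof -
    have "V l \<in> ideal_sqrt I" using V that by blast
    then show ?thesis unfolding vl[OF that] by simp
  qed
  have Xs: "X l s = blin (a l + s *\<^sub>R v l)" if "l \<in> {1..n}" "s \<in> {0..1}" for l s
    using X that al vl by (simp add: blin_simps)
  have Xx: "X l t = blin (x l)" if "l \<in> {1..n}" for l using Xs[OF that t] by (simp add: x_def)
  have nx: "norm (x l) \<le> 1" if "l \<in> {1..n}" for l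
  proof -
    have "norm (X l t) \<le> 1" using Xt that by (simp add: commuting_contractions_def contraction_def)
    then show ?thesis using Xx[OF that] by (simp add: blin_simps)
  qed
  have absv: "\<tau> (abs_sq (V l)) = \<tau>' (star (v l) * v l)" if "l \<in> {1..n}" for l
    by (simp add: vl[OF that] abs_sq_def \<tau>'_def blin_simps star.rep_eq)
  have blin_term: "op_scaleC (c k) (D_term n X i j t k) = blin (sc (c k) * d_term n x v i j k)" for c k i j
    using D_term_blin[where X=X and a=a and v=v and n=n, OF Xs t] by (simp add: blin_sc_mult x_def[abs_def])
  (* Convergence in N is a hypothesis unless the ideal is complete; in that case it follows from
     absolute convergence, the terms being bounded by the coefficients of the second derivative. *)
  have conv: "\<exists>S\<in>I'. D_op n c X i j t = blin S \<and>
      ((\<lambda>F. N' ((\<Sum>k\<in>F. sc (c k) * d_term n x v i j k) - S)) \<longlongrightarrow> 0) (finite_subsets_at_top (multi_indices n))"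
    if c: "series_on n r (multi_indices n) c (\<lambda>k. k)" and r: "1 < r" and ij: "1 \<le> i" "i \<le> j" "j \<le> n"
      and dt: "D_op_traceable I N n c X i j t" for c r i j
  proof -
    have i: "i \<in> {1..n}" and j: "j \<in> {1..n}" using ij by auto
    let ?T = "\<lambda>k. sc (c k) * d_term n x v i j k"
    have sumb: "(\<Sum>k\<in>F. op_scaleC (c k) (D_term n X i j t k)) = blin (\<Sum>k\<in>F. ?T k)" for F
      unfolding blin_term by (rule linear_sum[OF bounded_linear.linear[OF bounded_linear_blin], symmetric])
    have TI: "?T k \<in> I'" for k by (intro I_left d_term_in_I[OF ij] vW i j)
    show ?thesis
    proof (cases "ideal_complete I N")
      case False
      then have hs: "has_sum_in_ideal I N (\<lambda>k. op_scaleC (c k) (D_term n X i j t k)) (multi_indices n) (D_op n c X i j t)"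
        using dt by (simp add: D_op_traceable_def)
      then have DI: "D_op n c X i j t \<in> I" by (simp add: has_sum_in_ideal_def)
      then have "clinear_op (D_op n c X i j t)" using ideal by (simp add: normed_ideal_def op_ideal_def)
      then have D: "D_op n c X i j t = blin (Bop (D_op n c X i j t))" by (simp add: blin_Bop)
      have "((\<lambda>F. N' ((\<Sum>k\<in>F. ?T k) - Bop (D_op n c X i j t))) \<longlongrightarrow> 0) (finite_subsets_at_top (multi_indices n))"
        using hs unfolding has_sum_in_ideal_def N'_def blin_simps sumb D[symmetric] by blast
      then show ?thesis using DI D by (intro bexI[of _ "Bop (D_op n c X i j t)"]) (simp_all add: I'_def)
    next
      case True
      have "\<exists>S\<in>I'. ((\<lambda>F. N' ((\<Sum>k\<in>F. ?T k) - S)) \<longlongrightarrow> 0) (finite_subsets_at_top (multi_indices n))"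
      proof (rule complete_abs_summable)
        fix T :: "nat \<Rightarrow> 'h bop"
        assume T: "range T \<subseteq> I'" "\<forall>e>0. \<exists>m. \<forall>p\<ge>m. \<forall>q\<ge>m. N' (T p - T q) < e"
        have "range (\<lambda>p. blin (T p)) \<subseteq> I" using T(1) by (auto simp: I'_def)
        moreover have "\<forall>e>0. \<exists>m. \<forall>p\<ge>m. \<forall>q\<ge>m. N (blin (T p) - blin (T q)) < e"
          using T(2) unfolding N'_def blin_simps .
        ultimately have "\<exists>S\<in>I. (\<lambda>p. N (blin (T p) - S)) \<longlonglongrightarrow> 0"
          using True unfolding ideal_complete_def by blast
        then obtain S where S: "S \<in> I" "(\<lambda>p. N (blin (T p) - S)) \<longlonglongrightarrow> 0" by blast
        then have "clinear_op S" using ideal by (simp add: normed_ideal_def op_ideal_def)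
        then have bS: "blin (Bop S) = S" by (rule blin_Bop)
        show "\<exists>S\<in>I'. (\<lambda>p. N' (T p - S)) \<longlonglongrightarrow> 0"
          using S by (intro bexI[of _ "Bop S"]) (simp_all add: I'_def N'_def blin_simps bS)
      next
        have "(\<lambda>k. 2 * (N2 (blin (v i)) * N2 (blin (v j))) * cmod (hess_coeff c i j k)) summable_on multi_indices n"
          by (intro summable_on_cmult_right summable_hess_coeff[OF c i j r])
        then show "(\<lambda>k. N' (?T k)) summable_on multi_indices n"
        proof (rule summable_on_comparison_test)
          fix k
          show "0 \<le> N' (?T k)" by (rule N_nonneg[OF TI])
          have "N' (?T k) = cmod (c k) * N' (d_term n x v i j k)"
            by (intro N_sc d_term_in_I[OF ij] vW i j)
          also have "\<dots> \<le> cmod (c k) * (2 * (N2 (blin (v i)) * N2 (blin (v j))) * real (k j * dec j k i))"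
            by (intro mult_left_mono N_d_term_le[OF ij vW[OF i] vW[OF j] nx] norm_ge_zero)
          also have "\<dots> = 2 * (N2 (blin (v i)) * N2 (blin (v j))) * cmod (hess_coeff c i j k)"
            by (simp add: hess_coeff_def norm_mult)
          finally show "N' (?T k) \<le> 2 * (N2 (blin (v i)) * N2 (blin (v j))) * cmod (hess_coeff c i j k)" .
        qed
      qed (rule TI)
      then obtain S where S: "S \<in> I'" "((\<lambda>F. N' ((\<Sum>k\<in>F. ?T k) - S)) \<longlongrightarrow> 0) (finite_subsets_at_top (multi_indices n))" by blast
      have "(?T has_sum S) (multi_indices n)" by (rule N_limit_imp_has_sum[OF TI S])
      then have "((\<lambda>F. blin (\<Sum>k\<in>F. ?T k)) \<longlongrightarrow> blin S) (finite_subsets_at_top (multi_indices n))"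
        unfolding has_sum_def by (rule bounded_linear.tendsto[OF bounded_linear_blin])
      then have "((\<lambda>k. op_scaleC (c k) (D_term n X i j t k)) has_sum blin S) (multi_indices n)"
        unfolding has_sum_def sumb .
      then have "D_op n c X i j t = blin S" unfolding D_op_def by (rule infsumI)
      then show ?thesis using S by blast
    qed
  qed
  have main: "D_op n c X i j t \<in> I \<and> cmod (\<tau> (D_op n c X i j t))
      \<le> sqrt (Re (\<tau> (abs_sq (V i)))) * sqrt (Re (\<tau> (abs_sq (V j)))) * Linf_norm M g"
    if c: "series_on n r (multi_indices n) c (\<lambda>k. k)" and r: "1 < r" and ij: "1 \<le> i" "i \<le> j" "j \<le> n"
      and dt: "D_op_traceable I N n c X i j t"
      and res: "joint_resolution \<Omega> n x Q \<zeta> E" and Bo: "\<Omega> \<subseteq> Bo" "convex Bo"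
      and ne: "0 \<le> C0" "AE y in M. cmod (g y) \<le> C0"
      and bd: "\<And>C \<eta>. AE y in M. cmod (g y) \<le> C \<Longrightarrow> 0 < \<eta> \<Longrightarrow> \<forall>\<^sub>F F in finite_subsets_at_top (multi_indices n).
         \<forall>z. (\<forall>l\<in>{1..n}. z l \<in> Bo) \<longrightarrow> cmod (\<Sum>k\<in>F. hess_coeff c i j k * mon n (dec i (dec j k)) z) \<le> C + \<eta>"
    for c r i j \<Omega> Q \<zeta> E Bo C0 and M :: "(nat \<Rightarrow> 'm) measure" and g
  proof -
    have i: "i \<in> {1..n}" and j: "j \<in> {1..n}" using ij by auto
    obtain S where S: "S \<in> I'" "D_op n c X i j t = blin S"
      "((\<lambda>F. N' ((\<Sum>k\<in>F. sc (c k) * d_term n x v i j k) - S)) \<longlongrightarrow> 0) (finite_subsets_at_top (multi_indices n))"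
      using conv[OF c r ij dt] by blast
    have st: "star (v l) * v l \<in> I'" if "l \<in> {1..n}" for l using vW[OF that] W by auto
    have "cmod (\<tau>' S) \<le> (sqrt (Re (\<tau>' (star (v i) * v i))) * sqrt (Re (\<tau>' (star (v j) * v j)))) * Linf_norm M g"
    proof (rule Linf_norm_greatest[OF ne])
      show "0 \<le> sqrt (Re (\<tau>' (star (v i) * v i))) * sqrt (Re (\<tau>' (star (v j) * v j)))"
        using tr_pos[OF st[OF i] pos_star_mult] tr_pos[OF st[OF j] pos_star_mult] by simp
      fix C assume "AE y in M. cmod (g y) \<le> C"
      then show "cmod (\<tau>' S) \<le> (sqrt (Re (\<tau>' (star (v i) * v i))) * sqrt (Re (\<tau>' (star (v j) * v j)))) * C"
        using bd by (intro trace_second_derivative_bound[OF ij vW[OF i] vW[OF j] res Bo _ S(1,3)]) auto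
    qed
    then show ?thesis
      using S(1,2) unfolding absv[OF i] absv[OF j] by (simp add: I'_def \<tau>'_def)
  qed
  show ?thesis
  proof (intro conjI[of "\<forall>\<epsilon>>0. _ \<epsilon>"] allI impI, goal_cases)
    case (1 \<epsilon> c f i j)
    then have ij: "1 \<le> i" "i \<le> j" "j \<le> n" and i: "i \<in> {1..n}" and j: "j \<in> {1..n}" and r: "1 < 1 + \<epsilon>" by auto
    note f = \<open>polydisc_taylor n (1 + \<epsilon>) c f\<close>
    note c = polydisc_taylor_series_on[OF f]
    obtain Q \<zeta> E where res: "joint_resolution (sphere 0 1) n x Q \<zeta> E"
      using normal_dilation_joint_resolution[OF dilation] Xx by blast
    show ?case
    proof (rule main[OF c r ij _ res, of "cball 0 1"])
      show "D_op_traceable I N n c X i j t" by fact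
      show "0 \<le> (\<Sum>\<^sub>\<infinity>k\<in>multi_indices n. cmod (hess_coeff c i j k))" by (simp add: infsum_nonneg)
      show "AE y in torus_measure n. cmod (cpartial i (cpartial j f) y) \<le> (\<Sum>\<^sub>\<infinity>k\<in>multi_indices n. cmod (hess_coeff c i j k))"
        using AE_torus
      proof eventually_elim
        case (elim y)
        then have y: "cmod (y l) = 1" if "l \<in> {1..n}" for l using PiE_mem[OF elim that] by simp
        have "y \<in> {1..n} \<rightarrow>\<^sub>E ball 0 (1 + \<epsilon>)" using elim r by (auto simp: PiE_iff)
        then have "cpartial i (cpartial j f) y = series_sum n (multi_indices n) (hess_coeff c i j) (\<lambda>k. dec i (dec j k)) y"
          using r by (intro cpartial_cpartial[OF f _ i j]) auto
        then show ?case using series_sum_bounded[OF series_on_hess[OF c i j] r, of y] y by simp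
      qed
      fix C \<eta> assume "AE y in torus_measure n. cmod (cpartial i (cpartial j f) y) \<le> C" "0 < (\<eta>::real)"
      then show "\<forall>\<^sub>F F in finite_subsets_at_top (multi_indices n). \<forall>z. (\<forall>l\<in>{1..n}. z l \<in> cball 0 1) \<longrightarrow>
          cmod (\<Sum>k\<in>F. hess_coeff c i j k * mon n (dec i (dec j k)) z) \<le> C + \<eta>"
        by (rule torus_bound_partial_sums[OF f r i j])
    qed auto
  next
    case (2 \<epsilon> c f i j)
    then have ij: "1 \<le> i" "i \<le> j" "j \<le> n" and i: "i \<in> {1..n}" and j: "j \<in> {1..n}" and r: "1 < 1 + \<epsilon>" by auto
    note f = \<open>cube_taylor n (1 + \<epsilon>) c f\<close>
    note c = cube_taylor_series_on[OF f]
    have "\<exists>Q \<zeta> E. joint_resolution (complex_of_real ` {-1..1}) n x Q \<zeta> E"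
    proof (rule commuting_selfadjoint_joint_resolution)
      fix i j assume l: "i \<in> {1..n}" "j \<in> {1..n}"
      then have "blin (x i * x j) = blin (x j * x i)"
        using Xt Xx by (simp add: commuting_contractions_def blin_simps)
      then show "x i * x j = x j * x i" by (simp add: blin_inject)
    next
      fix l assume l: "l \<in> {1..n}"
      have "self_adjoint_op (X l t)" using \<open>\<forall>j\<in>{1..n}. self_adjoint_op (X j t)\<close> l by blast
      then have "blin (star (x l)) = blin (x l)"
        using Xx[OF l] by (simp add: self_adjoint_op_def star.rep_eq)
      then show "star (x l) = x l \<and> norm (x l) \<le> 1" using nx[OF l] by (simp add: blin_inject)
    qed
    then obtain Q \<zeta> E where res: "joint_resolution (complex_of_real ` {-1..1}) n x Q \<zeta> E" by blast
    show ?case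
    proof (rule main[OF c r ij _ res, of "complex_of_real ` {-1..1}"])
      show "D_op_traceable I N n c X i j t" by fact
      show "convex (complex_of_real ` {-1..1})"
        by (intro convex_linear_image bounded_linear.linear[OF bounded_linear_of_real]) simp
      show "0 \<le> (\<Sum>\<^sub>\<infinity>k\<in>multi_indices n. cmod (hess_coeff c i j k))" by (simp add: infsum_nonneg)
      show "AE y in cube_measure n. cmod (rpartial i (rpartial j f) y) \<le> (\<Sum>\<^sub>\<infinity>k\<in>multi_indices n. cmod (hess_coeff c i j k))"
        using AE_cube
      proof eventually_elim
        case (elim y)
        have y: "y l \<in> {-1..1}" if "l \<in> {1..n}" for l using PiE_mem[OF elim that] .
        have "y l \<in> {-(1 + \<epsilon>)<..<1 + \<epsilon>}" if "l \<in> {1..n}" for l using y[OF that] r by auto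
        then have "y \<in> {1..n} \<rightarrow>\<^sub>E {-(1 + \<epsilon>)<..<1 + \<epsilon>}" using elim by (auto simp: PiE_iff)
        then have "rpartial i (rpartial j f) y = series_sum n (multi_indices n) (hess_coeff c i j) (\<lambda>k. dec i (dec j k)) (\<lambda>l. complex_of_real (y l))"
          using r by (intro rpartial_rpartial[OF f _ i j]) auto
        moreover have "cmod (complex_of_real (y l)) \<le> 1" if "l \<in> {1..n}" for l using y[OF that] by (simp add: abs_le_iff)
        ultimately show ?case
          using series_sum_bounded[OF series_on_hess[OF c i j] r, of "\<lambda>l. complex_of_real (y l)"] by simp
      qed
      fix C \<eta> assume "AE y in cube_measure n. cmod (rpartial i (rpartial j f) y) \<le> C" "0 < (\<eta>::real)"
      then show "\<forall>\<^sub>F F in finite_subsets_at_top (multi_indices n). \<forall>z. (\<forall>l\<in>{1..n}. z l \<in> complex_of_real ` {-1..1}) \<longrightarrow>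
          cmod (\<Sum>k\<in>F. hess_coeff c i j k * mon n (dec i (dec j k)) z) \<le> C + \<eta>"
        by (rule cube_bound_partial_sums[OF f r i j])
    qed auto
  qed
qed

end
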